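(* Let $n\geq 3$. For every bounded harmonic function $u$ on $\mathbb{B}^n$ and every $x\in\mathbb{B}^n$, \[ |\nabla u(x)| ~\leq~ \frac{c_n}{1-|x|^2} \left\{\int_{-1}^1 \frac {\left| t - \frac{n-2}n |x| \right| (1-t^2)^{\frac {n-3}{2}}} {(1-2t|x|+|x|^2)^{\frac {n-2}{2}}}\, dt \right\}\|u\|_{\infty}, \] where $c_n:= \frac {2\Gamma(\frac {n+2}{2})} {\Gamma(\frac{1}{2}) \Gamma(\frac {n-1}{2})}$, and this inequality is sharp, i.e. for each fixed $x\in\mathbb{B}^n$ the factor multiplying $\|u\|_\infty$ is the smallest constant for which the inequality holds for all bounded harmonic $u$.
   Context: $\mathbb{B}^n$ is the open unit ball of $\mathbb{R}^n$, $\|u\|_\infty=\sup_{y\in\mathbb{B}^n}|u(y)|$, and $\Gamma$ is the Gamma function. *)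

theory Defs
  imports "HOL-Analysis.Analysis"
begin

definition partial_deriv :: "('a::euclidean_space \<Rightarrow> real) \<Rightarrow> 'a \<Rightarrow> 'a \<Rightarrow> real" where
  "partial_deriv u i y = frechet_derivative u (at y) i"

definition harmonic_on :: "('a::euclidean_space) set \<Rightarrow> ('a \<Rightarrow> real) \<Rightarrow> bool" where
  "harmonic_on S u \<longleftrightarrow> open S \<and>
     (\<forall>y\<in>S. u differentiable (at y)) \<and>
     (\<forall>i\<in>Basis. \<forall>y\<in>S. partial_deriv u i differentiable (at y)) \<and>
     (\<forall>i\<in>Basis. \<forall>j\<in>Basis. continuous_on S (partial_deriv (partial_deriv u i) j)) \<and>
     (\<forall>y\<in>S. (\<Sum>i\<in>Basis. partial_deriv (partial_deriv u i) i y) = 0)"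

definition grad :: "('a::euclidean_space \<Rightarrow> real) \<Rightarrow> 'a \<Rightarrow> 'a" where
  "grad u y = (\<Sum>i\<in>Basis. partial_deriv u i y *\<^sub>R i)"

definition sup_norm_ball :: "('a::euclidean_space \<Rightarrow> real) \<Rightarrow> real" where
  "sup_norm_ball u = (SUP y\<in>ball 0 1. \<bar>u y\<bar>)"

definition c_const :: "nat \<Rightarrow> real" where
  "c_const n = 2 * Gamma ((real n + 2) / 2) / (Gamma (1/2) * Gamma ((real n - 1) / 2))"

definition K_const :: "nat \<Rightarrow> real \<Rightarrow> real" where
  "K_const n r = c_const n / (1 - r\<^sup>2) *
     integral {-1..1} (\<lambda>t. \<bar>t - (real n - 2) / real n * r\<bar> * (1 - t\<^sup>2) powr ((real n - 3) / 2)
        / (1 - 2 * t * r + r\<^sup>2) powr ((real n - 2) / 2))"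

end

theory Submission
  imports Defs
begin

text \<open>
  Bounded harmonic functions are limits of Poisson integrals, so the best constant in direction \<open>l\<close> is
  \<open>N(l) = \<integral> \<bar>\<partial>\<^sub>l P(x, z)\<bar> d\<sigma>(z)\<close>, attained by the Poisson integral of the sign of \<open>\<partial>\<^sub>l P(x, \<cdot>)\<close>; the point
  is that \<open>N\<close> is maximal when \<open>l\<close> is radial. Write \<open>q = \<bar>x\<bar>\<close>, \<open>\<nu> = (n - 2) / 2\<close> and \<open>a = (n - 2) / n\<close>.
  The Moebius involution of the sphere exchanging \<open>x\<close> and \<open>0\<close> turns \<open>N(l)\<close> into \<open>n / (1 - q\<^sup>2)\<close> times
  \<open>\<integral> \<bar>(z - a x) \<bullet> l\<bar> \<bar>z - x\<bar> powr (2 - n) d\<sigma>(z)\<close>, which is the stated integral for radial \<open>l\<close>. For general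
  \<open>l\<close> project to the plane spanned by \<open>x\<close> and \<open>l\<close>: on the unit disc the measure has density proportional to
  \<open>(1 - \<bar>z\<bar>\<^sup>2) powr (\<nu> - 1) / (1 + q\<^sup>2 - 2 x \<bullet> z) powr \<nu>\<close>. The level curves of
  \<open>g = (1 - \<bar>z\<bar>\<^sup>2) / (1 + q\<^sup>2 - 2 x \<bullet> z)\<close> are the circles \<open>z = g x + R e(\<theta>)\<close> with
  \<open>R\<^sup>2 = (1 - g) (1 - g q\<^sup>2)\<close>, and in the coordinates \<open>(g, \<theta>)\<close> the density is proportional to \<open>g powr (\<nu> - 1)\<close>. Hence
  \<open>N(l)\<close> is an average over \<open>g\<close> of the means of \<open>\<bar>(g - a) (x \<bullet> l) + R cos \<theta>\<bar>\<close> over \<open>\<theta>\<close>, and each of these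
  increases with \<open>\<bar>x \<bullet> l\<bar>\<close>.
\<close>

section \<open>Rotation-invariant measure on the sphere\<close>

text \<open>A bounded harmonic function on the open ball comes without boundary values. The Poisson
  formula is therefore applied to the dilates \<open>u (c *\<^sub>R y)\<close> with c < 1, which are
  continuous on the closed ball, and c tends to 1 only in the gradient estimate. The sphere measure
  is an image of Lebesgue measure on the ball and is known through its total mass and its rotation
  invariance alone. Its planar density is found by moments: infinitesimal rotations give a
  recursion, an explicit product weight obeys the same recursion, and Stone-Weierstrass extends the
  equality to continuous integrands. Every change of variables is one-dimensional. In the disc
  coordinates (t, w), with second planar coordinate sqrt(1 - t^2) w, the Moebius map moves t and
  leaves w fixed. The passage to (g, \<theta>) exchanges w for g at fixed t and then t for \<theta>
  at fixed g, with Fubini in between. These steps are carried out for \<open>ennreal\<close>-valued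
  integrals, so that exchanging the order asks only for measurability.\<close>

lemma orthogonal_transformation_borel_measurable:
  fixes T :: "'a::euclidean_space \<Rightarrow> 'a"
  assumes "orthogonal_transformation T"
  shows "T \<in> borel_measurable borel"
  using assms
  by (intro borel_measurable_continuous_onI linear_continuous_on)
     (simp add: linear_conv_bounded_linear[symmetric] orthogonal_transformation_linear)

text \<open>Comparing a translation-invariant measure with Lebesgue measure by Fubini only needs one
  set on which both agree; an orthogonal map fixes the unit ball.\<close>

lemma distr_lborel_orthogonal_transformation:
  fixes T :: "'a::euclidean_space \<Rightarrow> 'a"
  assumes T: "orthogonal_transformation T"
  shows "distr lborel borel T = lborel"
proof (rule measure_eqI)
  let ?M = "distr lborel borel T"
  show "sets ?M = sets lborel" by simp
  fix A assume "A \<in> sets ?M"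
  then have A[measurable]: "A \<in> sets borel" by simp
  have T_meas[measurable]: "T \<in> borel_measurable borel"
    by (rule orthogonal_transformation_borel_measurable[OF T])
  have lin: "linear T" using T by (rule orthogonal_transformation_linear)
  obtain S where S: "orthogonal_transformation S" "S \<circ> T = id" "T \<circ> S = id"
    using T by (metis orthogonal_transformation_bij orthogonal_transformation_inv bij_is_inj bij_is_surj inj_iff surj_iff)
  \<comment> \<open>Translation by \<open>c\<close> after \<open>T\<close> is \<open>T\<close> after
    translation by \<open>S c\<close>, so \<open>?M\<close> inherits translation invariance from
    Lebesgue measure.\<close>
  have transl: "distr ?M borel (\<lambda>x. c + x) = ?M" for c
  proof -
    have "distr ?M borel (\<lambda>x. c + x) = distr lborel borel ((\<lambda>x. c + x) \<circ> T)"
      by (subst distr_distr) auto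
    also have "(\<lambda>x. c + x) \<circ> T = T \<circ> (\<lambda>x. S c + x)"
      using S(3) by (auto simp: fun_eq_iff linear_add[OF lin])
    also have "distr lborel borel \<dots> = distr (distr lborel borel (\<lambda>x. S c + x)) borel T"
      by (subst distr_distr) auto
    finally show ?thesis by (simp add: lborel_distr_plus)
  qed
  let ?B = "ball (0::'a) 1"
  have [measurable]: "?B \<in> sets borel" by simp
  have MB: "emeasure ?M ?B = emeasure lborel ?B"
  proof -
    have "T -` ?B = ?B" using T by (auto simp: orthogonal_transformation_norm)
    then show ?thesis by (subst emeasure_distr) auto
  qed
  interpret M: sigma_finite_measure ?M
  proof
    show "\<exists>A. countable A \<and> A \<subseteq> sets ?M \<and> \<Union> A = space ?M \<and> (\<forall>a\<in>A. emeasure ?M a \<noteq> \<infinity>)"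
    proof (intro exI[of _ "range (\<lambda>n::nat. ball (0::'a) (real n))"] conjI ballI)
      show "\<Union> (range (\<lambda>n::nat. ball (0::'a) (real n))) = space ?M"
        using reals_Archimedean2 by auto
      fix a assume "a \<in> range (\<lambda>n::nat. ball (0::'a) (real n))"
      then obtain n :: nat where a: "a = ball 0 (real n)" by auto
      have "T -` a = a" using T by (auto simp: a orthogonal_transformation_norm)
      then show "emeasure ?M a \<noteq> \<infinity>"
        unfolding a by (subst emeasure_distr) (auto simp: emeasure_ball)
    qed auto
  qed
  interpret pair_sigma_finite ?M lborel ..
  \<comment> \<open>After the shift of \<open>x\<close> by \<open>y\<close> the second factor is
    evaluated at \<open>- x\<close>; the symmetry of the ball removes the sign.\<close>
  have uB: "indicator ?B (- x) = (indicator ?B x :: ennreal)" for x :: 'a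
    by (simp add: indicator_def)
  have "emeasure ?M A * emeasure lborel ?B = (\<integral>\<^sup>+x. indicator A x * emeasure lborel ?B \<partial>?M)"
    by (simp add: nn_integral_multc)
  also have "\<dots> = (\<integral>\<^sup>+x. (\<integral>\<^sup>+y. indicator A x * indicator ?B (y - x) \<partial>lborel) \<partial>?M)"
  proof (rule nn_integral_cong)
    fix x
    have "(\<integral>\<^sup>+y. indicator ?B (y - x) \<partial>lborel) = (\<integral>\<^sup>+y. indicator ?B y \<partial>distr lborel borel (\<lambda>y. - x + y))"
      by (subst nn_integral_distr) (simp_all only: uminus_add_conv_diff, measurable)
    also have "\<dots> = emeasure lborel ?B" by (simp only: lborel_distr_plus) simp
    finally show "indicator A x * emeasure lborel ?B = (\<integral>\<^sup>+y. indicator A x * indicator ?B (y - x) \<partial>lborel)"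
      by (simp add: nn_integral_cmult)
  qed
  also have "\<dots> = (\<integral>\<^sup>+y. (\<integral>\<^sup>+x. indicator A x * indicator ?B (y - x) \<partial>?M) \<partial>lborel)"
    by (rule Fubini'[symmetric]) (simp add: split_beta)
  also have "\<dots> = (\<integral>\<^sup>+y. (\<integral>\<^sup>+x. indicator A (y + x) * indicator ?B x \<partial>?M) \<partial>lborel)"
  proof (rule nn_integral_cong)
    fix y
    have "(\<integral>\<^sup>+x. indicator A x * indicator ?B (y - x) \<partial>?M)
        = (\<integral>\<^sup>+x. indicator A x * indicator ?B (y - x) \<partial>distr ?M borel (\<lambda>x. y + x))"
      by (simp only: transl)
    also have "\<dots> = (\<integral>\<^sup>+x. indicator A (y + x) * indicator ?B (- x) \<partial>?M)"
      by (subst nn_integral_distr) (auto simp: algebra_simps)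
    finally show "(\<integral>\<^sup>+x. indicator A x * indicator ?B (y - x) \<partial>?M)
        = (\<integral>\<^sup>+x. indicator A (y + x) * indicator ?B x \<partial>?M)" by (simp only: uB)
  qed
  also have "\<dots> = (\<integral>\<^sup>+x. (\<integral>\<^sup>+y. indicator A (y + x) * indicator ?B x \<partial>lborel) \<partial>?M)"
    by (rule Fubini') (simp add: split_beta)
  also have "\<dots> = (\<integral>\<^sup>+x. emeasure lborel A * indicator ?B x \<partial>?M)"
  proof (rule nn_integral_cong)
    fix x
    have "(\<integral>\<^sup>+y. indicator A (y + x) \<partial>lborel) = (\<integral>\<^sup>+y. indicator A y \<partial>distr lborel borel (\<lambda>y. x + y))"
      by (subst nn_integral_distr) (auto simp: algebra_simps)
    also have "\<dots> = emeasure lborel A" by (simp add: lborel_distr_plus)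
    finally show "(\<integral>\<^sup>+y. indicator A (y + x) * indicator ?B x \<partial>lborel) = emeasure lborel A * indicator ?B x"
      by (simp add: nn_integral_multc)
  qed
  also have "\<dots> = emeasure lborel A * emeasure lborel ?B"
    by (simp add: nn_integral_cmult MB del: emeasure_distr)
  finally have eq: "emeasure ?M A * emeasure lborel ?B = emeasure lborel A * emeasure lborel ?B" .
  have "emeasure lborel ?B \<noteq> 0" "emeasure lborel ?B \<noteq> \<infinity>"
    using less_irrefl[of "unit_ball_vol (real DIM('a))"] unit_ball_vol_pos[of "real DIM('a)"]
    by (auto simp: emeasure_ball simp del: unit_ball_vol_pos)
  with eq show "emeasure ?M A = emeasure lborel A"
    by (metis ennreal_divide_times ennreal_times_divide ennreal_divide_self mult.right_neutral ennreal_mult_divide_eq infinity_ennreal_def)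
qed

text \<open>The value at \<open>0\<close> is an arbitrary unit vector, so that every point is mapped to the sphere.\<close>

definition to_sphere :: "'a::euclidean_space \<Rightarrow> 'a" where
  "to_sphere y = (if y = 0 then (SOME b. b \<in> Basis) else sgn y)"

text \<open>Normalised surface measure, as the radial projection of the uniform distribution on the
  ball. The restricted sigma-algebra makes the space the sphere itself, so that membership in the
  space already gives \<open>norm z = 1\<close>.\<close>

definition sphere_measure :: "'a::euclidean_space measure" where
  "sphere_measure = distr (uniform_measure lborel (ball 0 1)) (restrict_space borel (sphere 0 1)) to_sphere"

lemma space_sphere_measure [simp]: "space sphere_measure = sphere 0 1"
  by (simp add: sphere_measure_def space_restrict_space)

lemma sets_sphere_measure [measurable_cong]: "sets sphere_measure = sets (restrict_space borel (sphere 0 1))"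
  by (simp add: sphere_measure_def)

lemma norm_to_sphere [simp]: "norm (to_sphere y) = 1"
  by (auto simp: to_sphere_def norm_sgn norm_Basis some_in_eq)

lemma to_sphere_measurable [measurable]: "to_sphere \<in> borel_measurable borel"
proof -
  have "(\<lambda>y::'a. if y = 0 then (SOME b. b \<in> Basis) else sgn y) \<in> borel_measurable borel"
    unfolding sgn_div_norm by measurable
  then show ?thesis by (simp add: to_sphere_def[abs_def])
qed

lemma to_sphere_measurable_restrict:
  "to_sphere \<in> measurable (uniform_measure lborel (ball 0 1)) (restrict_space borel (sphere 0 1))"
  by (rule measurable_restrict_space2) (auto simp: measurable_cong_sets[OF sets_uniform_measure refl])

lemma sphere_measure_measurable:
  "f \<in> borel_measurable borel \<Longrightarrow> f \<in> borel_measurable sphere_measure"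
  by (simp add: measurable_cong_sets[OF sets_sphere_measure refl] measurable_restrict_space1)

lemma emeasure_sphere_measure_space: "emeasure (sphere_measure::'a::euclidean_space measure) (sphere 0 1) = 1"
proof -
  have "emeasure lborel (ball (0::'a) 1) \<noteq> 0" "emeasure lborel (ball (0::'a) 1) \<noteq> \<infinity>"
    using less_irrefl[of "unit_ball_vol (real DIM('a))"] unit_ball_vol_pos[of "real DIM('a)"]
    by (auto simp: emeasure_ball simp del: unit_ball_vol_pos)
  then have 1: "emeasure (uniform_measure lborel (ball (0::'a) 1)) UNIV = 1"
    by (subst emeasure_uniform_measure) (auto simp: ennreal_divide_self less_top)
  have "sphere 0 1 \<in> sets (restrict_space borel (sphere (0::'a) 1))"
    by (simp add: sets_restrict_space_iff)
  moreover have "to_sphere -` sphere 0 1 = (UNIV :: 'a set)" by auto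
  ultimately show ?thesis
    unfolding sphere_measure_def
    by (subst emeasure_distr[OF to_sphere_measurable_restrict]) (auto simp: 1)
qed

lemma finite_sphere_measure: "finite_measure (sphere_measure::'a::euclidean_space measure)"
  by standard (simp add: emeasure_sphere_measure_space)

lemma measure_sphere_measure [simp]: "measure (sphere_measure::'a::euclidean_space measure) (sphere 0 1) = 1"
  by (simp add: measure_def emeasure_sphere_measure_space)

lemma integrable_sphere_measure:
  fixes f :: "'a::euclidean_space \<Rightarrow> real"
  assumes "f \<in> borel_measurable sphere_measure" "\<And>z. norm z = 1 \<Longrightarrow> \<bar>f z\<bar> \<le> B"
  shows "integrable sphere_measure f"
  by (rule finite_measure.integrable_const_bound[OF finite_sphere_measure, of _ B])
     (use assms in auto)

text \<open>Away from the null point 0 an orthogonal map commutes with radial projection, and it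
  preserves both the ball and Lebesgue measure.\<close>

lemma integral_sphere_measure_orthogonal_transformation:
  fixes f :: "'a::euclidean_space \<Rightarrow> real" and T :: "'a \<Rightarrow> 'a"
  assumes T: "orthogonal_transformation T" and f[measurable]: "f \<in> borel_measurable borel"
  shows "(\<integral>z. f (T z) \<partial>sphere_measure) = (\<integral>z. f z \<partial>sphere_measure)"
proof -
  have Tm[measurable]: "T \<in> borel_measurable borel"
    by (rule orthogonal_transformation_borel_measurable[OF T])
  have pull: "(\<integral>z. h z \<partial>sphere_measure)
      = (\<integral>y. (indicator (ball 0 1) y / measure lborel (ball (0::'a) 1)) * h (to_sphere y) \<partial>lborel)"
    if [measurable]: "h \<in> borel_measurable borel" for h :: "'a \<Rightarrow> real"
  proof -
    have "(\<integral>z. h z \<partial>sphere_measure) = (\<integral>y. h (to_sphere y) \<partial>uniform_measure lborel (ball (0::'a) 1))"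
      unfolding sphere_measure_def
      by (rule integral_distr[OF to_sphere_measurable_restrict]) (simp add: measurable_restrict_space1)
    also have "\<dots> = (\<integral>y. (indicator (ball 0 1) y / measure lborel (ball (0::'a) 1)) *\<^sub>R h (to_sphere y) \<partial>lborel)"
    proof -
      have pos: "0 < measure lborel (ball (0::'a) 1)" by (simp add: measure_def emeasure_ball)
      then have em: "emeasure lborel (ball (0::'a) 1) = ennreal (measure lborel (ball (0::'a) 1))"
        by (simp add: measure_def emeasure_ball)
      have "uniform_measure lborel (ball (0::'a) 1)
          = density lborel (\<lambda>y. ennreal (indicator (ball 0 1) y / measure lborel (ball (0::'a) 1)))"
        unfolding uniform_measure_def em using pos
        by (intro arg_cong2[where f=density] refl ext) (auto simp: indicator_def divide_ennreal[symmetric] ennreal_1[symmetric] simp del: ennreal_1)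
      then show ?thesis
        by (simp only:, subst integral_density) (measurable, simp_all)
    qed
    finally show ?thesis by simp
  qed
  have [measurable]: "ball (0::'a) 1 \<in> sets borel" by simp
  have inj: "T y = 0 \<longleftrightarrow> y = 0" for y
    using orthogonal_transformation_norm[OF T, of y] by (metis norm_eq_zero)
  have com: "to_sphere (T y) = T (to_sphere y)" if "y \<noteq> 0" for y
    using that T inj[of y]
    by (simp add: to_sphere_def sgn_div_norm orthogonal_transformation_norm linear_cmul orthogonal_transformation_linear)
  let ?c = "measure lborel (ball (0::'a) 1)"
  have "(\<integral>z. f (T z) \<partial>sphere_measure) = (\<integral>y. (indicator (ball 0 1) y / ?c) * f (T (to_sphere y)) \<partial>lborel)"
    by (rule pull) simp
  also have "\<dots> = (\<integral>y. (indicator (ball 0 1) (T y) / ?c) * f (to_sphere (T y)) \<partial>lborel)"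
  proof (rule integral_cong_AE)
    have "AE y in lborel. y \<noteq> (0::'a)"
      by (rule AE_I[of _ _ "{0}"]) auto
    then show "AE y in lborel. indicator (ball 0 1) y / ?c * f (T (to_sphere y)) =
         indicator (ball 0 1) (T y) / ?c * f (to_sphere (T y))"
      by eventually_elim (simp add: com indicator_def orthogonal_transformation_norm[OF T])
  qed (measurable; simp)+
  also have "\<dots> = (\<integral>y. (indicator (ball 0 1) y / ?c) * f (to_sphere y) \<partial>distr lborel borel T)"
    by (subst integral_distr) (measurable; simp)+
  also have "\<dots> = (\<integral>z. f z \<partial>sphere_measure)"
    by (simp add: distr_lborel_orthogonal_transformation[OF T] pull)
  finally show ?thesis .
qed

section \<open>Differentiation and continuity under the integral sign\<close>

text \<open>On the convex set \<open>U\<close> the gradient bound makes \<open>p\<close> Lipschitz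
  in \<open>y\<close>, uniformly in \<open>z\<close>. The error in the difference quotient is then
  at most \<open>2 * B\<close> and tends to 0 pointwise, so dominated convergence applies along
  sequences.\<close>

lemma has_derivative_integral_bounded_gradient:
  fixes p :: "'a::euclidean_space \<Rightarrow> 'z \<Rightarrow> real" and G :: "'a \<Rightarrow> 'z \<Rightarrow> 'a"
  assumes fin: "finite_measure M" and U: "open U" "convex U" "y0 \<in> U"
    and der: "\<And>y z. y \<in> U \<Longrightarrow> z \<in> space M \<Longrightarrow> ((\<lambda>y. p y z) has_derivative (\<lambda>h. G y z \<bullet> h)) (at y)"
    and bound: "\<And>y z. y \<in> U \<Longrightarrow> z \<in> space M \<Longrightarrow> norm (G y z) \<le> B"
    and int: "\<And>y. y \<in> U \<Longrightarrow> integrable M (p y)"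
    and meas: "G y0 \<in> borel_measurable M"
  shows "((\<lambda>y. \<integral>z. p y z \<partial>M) has_derivative (\<lambda>h. \<integral>z. G y0 z \<bullet> h \<partial>M)) (at y0)"
proof -
  interpret finite_measure M by (rule fin)
  note [measurable] = meas
  have intG: "integrable M (\<lambda>z. G y0 z \<bullet> h)" for h
  proof (rule integrable_const_bound[of _ "B * norm h"])
    show "AE z in M. norm (G y0 z \<bullet> h) \<le> B * norm h"
    proof (rule AE_I2)
      fix z assume "z \<in> space M"
      then have "norm (G y0 z) * norm h \<le> B * norm h" using bound U by (intro mult_right_mono) auto
      then show "norm (G y0 z \<bullet> h) \<le> B * norm h" using Cauchy_Schwarz_ineq2[of "G y0 z" h] by auto
    qed
  qed measurable
  have lip: "\<bar>p y z - p y0 z\<bar> \<le> B * norm (y - y0)" if y: "y \<in> U" and z: "z \<in> space M" for y z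
  proof -
    have "norm (p y z - p y0 z) \<le> B * norm (y - y0)"
    proof (rule differentiable_bound[OF U(2) _ _ y U(3)])
      fix x assume x: "x \<in> U"
      show "((\<lambda>y. p y z) has_derivative (\<lambda>h. G x z \<bullet> h)) (at x within U)"
        using der[OF x z] by (rule has_derivative_at_withinI)
      show "onorm ((\<bullet>) (G x z)) \<le> B"
      proof (rule onorm_le)
        fix h
        show "norm (G x z \<bullet> h) \<le> B * norm h"
          using Cauchy_Schwarz_ineq2[of "G x z" h] mult_right_mono[OF bound[OF x z], of "norm h"] by simp
      qed
    qed
    then show ?thesis by simp
  qed
  \<comment> \<open>A sequence tending to \<open>y0\<close> may have early terms outside
    \<open>U\<close>; the value 0 there keeps the domination valid for all indices.\<close>
  define q where "q y z = (if y \<in> U then (p y z - p y0 z - G y0 z \<bullet> (y - y0)) / norm (y - y0) else 0)" for y z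
  have "(\<lambda>y. (\<integral>z. q y z \<partial>M)) \<midarrow>y0\<rightarrow> 0"
    unfolding tendsto_at_iff_sequentially
  proof (intro allI impI)
    fix X assume X: "\<forall>i::nat. X i \<in> UNIV - {y0}" "X \<longlonglongrightarrow> y0"
    have "(\<lambda>i. \<integral>z. q (X i) z \<partial>M) \<longlonglongrightarrow> (\<integral>z. 0 \<partial>M)"
    proof (rule integral_dominated_convergence[where w="\<lambda>_. 2 * B"])
      show "q (X i) \<in> borel_measurable M" for i
      proof (cases "X i \<in> U")
        case True
        have [measurable]: "p (X i) \<in> borel_measurable M" "p y0 \<in> borel_measurable M"
          using int True U by auto
        show ?thesis using True by (simp add: q_def[abs_def])
      qed (simp add: q_def[abs_def])
      show "AE z in M. norm (q (X i) z) \<le> 2 * B" for i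
      proof (rule AE_I2)
        fix z assume z: "z \<in> space M"
        have B: "0 \<le> B" using bound[OF U(3) z] by (meson norm_ge_zero order_trans)
        show "norm (q (X i) z) \<le> 2 * B"
        proof (cases "X i \<in> U")
          case True
          have pos: "norm (X i - y0) > 0" using X(1) by auto
          have "\<bar>G y0 z \<bullet> (X i - y0)\<bar> \<le> B * norm (X i - y0)"
            using Cauchy_Schwarz_ineq2[of "G y0 z" "X i - y0"] mult_right_mono[OF bound[OF U(3) z], of "norm (X i - y0)"] by auto
          with lip[OF True z] have "\<bar>p (X i) z - p y0 z - G y0 z \<bullet> (X i - y0)\<bar> \<le> 2 * B * norm (X i - y0)"
            by linarith
          then show ?thesis using pos True by (simp add: q_def field_simps)
        qed (use B in \<open>simp add: q_def\<close>)
      qed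
      show "AE z in M. (\<lambda>i. q (X i) z) \<longlonglongrightarrow> 0"
      proof (rule AE_I2)
        fix z assume z: "z \<in> space M"
        have "((\<lambda>y. norm ((p y z - p y0 z) - G y0 z \<bullet> (y - y0)) / norm (y - y0)) \<longlongrightarrow> 0) (at y0)"
          using der[OF U(3) z] by (simp add: has_derivative_iff_norm)
        then have "(\<lambda>i. norm ((p (X i) z - p y0 z) - G y0 z \<bullet> (X i - y0)) / norm (X i - y0)) \<longlonglongrightarrow> 0"
          using X unfolding tendsto_at_iff_sequentially comp_def by blast
        moreover have "\<forall>\<^sub>F i in sequentially. norm (q (X i) z) \<le> norm ((p (X i) z - p y0 z) - G y0 z \<bullet> (X i - y0)) / norm (X i - y0)"
          by (intro always_eventually allI) (simp add: q_def)
        ultimately show "(\<lambda>i. q (X i) z) \<longlonglongrightarrow> 0"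
          by (rule Lim_null_comparison[rotated])
      qed
    qed auto
    then show "((\<lambda>y. \<integral>z. q y z \<partial>M) \<circ> X) \<longlonglongrightarrow> 0" by (simp add: comp_def)
  qed
  moreover have "\<forall>\<^sub>F y in at y0. \<bar>\<integral>z. q y z \<partial>M\<bar> = norm ((\<integral>z. p y z \<partial>M) - (\<integral>z. p y0 z \<partial>M) - (\<integral>z. G y0 z \<bullet> (y - y0) \<partial>M)) / norm (y - y0)"
  proof -
    have "\<forall>\<^sub>F y in at y0. y \<in> U" using U by (simp add: eventually_at_topological) blast
    then show ?thesis
    proof eventually_elim
      case (elim y)
      have "(\<integral>z. q y z \<partial>M) = (\<integral>z. (p y z - p y0 z - G y0 z \<bullet> (y - y0)) / norm (y - y0) \<partial>M)"
        using elim by (simp add: q_def)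
      also have "\<dots> = ((\<integral>z. p y z \<partial>M) - (\<integral>z. p y0 z \<partial>M) - (\<integral>z. G y0 z \<bullet> (y - y0) \<partial>M)) / norm (y - y0)"
        using int[OF elim] int[OF U(3)] intG[of "y - y0"] by simp
      finally show ?case by simp
    qed
  qed
  ultimately have lim: "((\<lambda>y. norm ((\<integral>z. p y z \<partial>M) - (\<integral>z. p y0 z \<partial>M) - (\<integral>z. G y0 z \<bullet> (y - y0) \<partial>M)) / norm (y - y0)) \<longlongrightarrow> 0) (at y0)"
    by (rule Lim_transform_eventually[OF tendsto_rabs_zero])
  have "linear (\<lambda>h. \<integral>z. G y0 z \<bullet> h \<partial>M)"
    by (rule linearI) (use intG in \<open>simp_all add: inner_add_right\<close>)
  with lim show ?thesis
    by (simp add: has_derivative_iff_norm linear_conv_bounded_linear)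
qed

lemma continuous_on_integral_bounded:
  fixes p :: "'a::euclidean_space \<Rightarrow> 'z \<Rightarrow> real"
  assumes fin: "finite_measure M"
    and cont: "\<And>z. z \<in> space M \<Longrightarrow> continuous_on U (\<lambda>y. p y z)"
    and bound: "\<And>y z. y \<in> U \<Longrightarrow> z \<in> space M \<Longrightarrow> \<bar>p y z\<bar> \<le> B"
    and meas: "\<And>y. y \<in> U \<Longrightarrow> p y \<in> borel_measurable M"
  shows "continuous_on U (\<lambda>y. \<integral>z. p y z \<partial>M)"
  unfolding continuous_on_sequentially comp_def
proof (intro allI ballI impI)
  interpret finite_measure M by (rule fin)
  fix X y assume y: "y \<in> U" and X: "(\<forall>n. X n \<in> U) \<and> X \<longlonglongrightarrow> y"
  show "(\<lambda>n. \<integral>z. p (X n) z \<partial>M) \<longlonglongrightarrow> (\<integral>z. p y z \<partial>M)"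
  proof (rule integral_dominated_convergence[where w="\<lambda>_. B"])
    show "AE z in M. (\<lambda>n. p (X n) z) \<longlonglongrightarrow> p y z"
      using cont y X unfolding continuous_on_sequentially comp_def by (intro AE_I2) blast
  qed (use meas y X bound in auto)
qed

section \<open>Poisson kernel\<close>

text \<open>Normalised against the probability measure \<open>sphere_measure\<close>, hence without
  a factor for the area of the sphere.\<close>

definition poisson_kernel :: "'a::euclidean_space \<Rightarrow> 'a \<Rightarrow> real" where
  "poisson_kernel y z = (1 - (norm y)\<^sup>2) / norm (y - z) ^ DIM('a)"

definition poisson_grad :: "'a::euclidean_space \<Rightarrow> 'a \<Rightarrow> 'a" where
  "poisson_grad y z = - (2 / norm (y - z) ^ DIM('a)) *\<^sub>R y
     - (DIM('a) * (1 - (norm y)\<^sup>2) / norm (y - z) ^ (DIM('a) + 2)) *\<^sub>R (y - z)"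

text \<open>The Hessian in \<open>y\<close> applied to \<open>v\<close>, that is, the gradient of
  \<open>poisson_grad y z \<bullet> v\<close>; the five terms are those of the product rule.\<close>

definition poisson_hess :: "'a::euclidean_space \<Rightarrow> 'a \<Rightarrow> 'a \<Rightarrow> 'a" where
  "poisson_hess v y z = - (2 / norm (y - z) ^ DIM('a)) *\<^sub>R v
     + (2 * DIM('a) * (y \<bullet> v) / norm (y - z) ^ (DIM('a) + 2)) *\<^sub>R (y - z)
     + (2 * DIM('a) * ((y - z) \<bullet> v) / norm (y - z) ^ (DIM('a) + 2)) *\<^sub>R y
     - (DIM('a) * (1 - (norm y)\<^sup>2) / norm (y - z) ^ (DIM('a) + 2)) *\<^sub>R v
     + (DIM('a) * (DIM('a) + 2) * (1 - (norm y)\<^sup>2) * ((y - z) \<bullet> v) / norm (y - z) ^ (DIM('a) + 4)) *\<^sub>R (y - z)"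

lemma has_derivative_inverse_norm_power:
  fixes y z :: "'a::euclidean_space"
  assumes "y \<noteq> z"
  shows "((\<lambda>y. 1 / norm (y - z) ^ k) has_derivative (\<lambda>h. - (k / norm (y - z) ^ (k + 2)) * ((y - z) \<bullet> h))) (at y)"
proof (cases k)
  case (Suc m)
  let ?N = "norm (y - z)"
  have N: "?N > 0" using assms by simp
  have 1: "((\<lambda>y. norm (y - z)) has_derivative (\<lambda>h. (y - z) \<bullet> h / ?N)) (at y)"
  proof -
    have "(norm has_derivative (\<lambda>h. h \<bullet> sgn (y - z))) (at (y - z))"
      using assms by (intro has_derivative_norm) auto
    then have "((\<lambda>y. norm (y - z)) has_derivative (\<lambda>h. h \<bullet> sgn (y - z))) (at y)"
      by (rule has_derivative_compose[rotated, where f="\<lambda>y. y - z", unfolded o_def])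
         (auto intro!: derivative_eq_intros)
    then show ?thesis by (simp add: sgn_div_norm inner_commute divide_inverse mult.commute)
  qed
  show ?thesis
    by (rule has_derivative_eq_rhs, rule has_derivative_divide[OF has_derivative_const has_derivative_power[OF 1]])
       (use N in \<open>auto simp: Suc field_simps\<close>)
qed auto

lemma has_derivative_one_minus_norm_sq:
  "((\<lambda>y::'a::euclidean_space. 1 - (norm y)\<^sup>2) has_derivative (\<lambda>h. - 2 * (y \<bullet> h))) (at y)"
  unfolding power2_norm_eq_inner
  by (rule has_derivative_eq_rhs, (rule derivative_intros)+) (simp add: inner_commute fun_eq_iff)

lemma has_derivative_poisson_kernel:
  fixes y z :: "'a::euclidean_space"
  assumes "y \<noteq> z"
  shows "((\<lambda>y. poisson_kernel y z) has_derivative (\<lambda>h. poisson_grad y z \<bullet> h)) (at y)"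
proof -
  have "((\<lambda>y. (1 - (norm y)\<^sup>2) * (1 / norm (y - z) ^ DIM('a))) has_derivative
     (\<lambda>h. (1 - (norm y)\<^sup>2) * (- (DIM('a) / norm (y - z) ^ (DIM('a) + 2)) * ((y - z) \<bullet> h))
        + - 2 * (y \<bullet> h) * (1 / norm (y - z) ^ DIM('a)))) (at y)"
    by (intro has_derivative_mult has_derivative_one_minus_norm_sq has_derivative_inverse_norm_power assms)
  moreover have "(\<lambda>y. poisson_kernel y z) = (\<lambda>y. (1 - (norm y)\<^sup>2) * (1 / norm (y - z) ^ DIM('a)))"
    by (simp add: poisson_kernel_def)
  ultimately show ?thesis
    by (elim has_derivative_eq_rhs[rotated] ssubst)
       (auto simp: poisson_grad_def fun_eq_iff inner_diff_left add_divide_distrib diff_divide_distrib algebra_simps)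
qed

lemma has_derivative_poisson_grad_inner:
  fixes y z :: "'a::euclidean_space"
  assumes "y \<noteq> z"
  shows "((\<lambda>y. poisson_grad y z \<bullet> v) has_derivative (\<lambda>h. poisson_hess v y z \<bullet> h)) (at y)"
proof -
  have 0: "((\<lambda>y. y \<bullet> v) has_derivative (\<lambda>h. h \<bullet> v)) (at y)" 
    "((\<lambda>y. (y - z) \<bullet> v) has_derivative (\<lambda>h. h \<bullet> v)) (at y)"
    by (auto intro!: derivative_eq_intros)
  let ?n = "DIM('a)"
  have "((\<lambda>y. (- 2 * (y \<bullet> v)) * (1 / norm (y - z) ^ ?n)
       - (?n * (1 - (norm y)\<^sup>2)) * ((y - z) \<bullet> v) * (1 / norm (y - z) ^ (?n + 2))) has_derivative
     (\<lambda>h. ((- 2 * (y \<bullet> v)) * (- (?n / norm (y - z) ^ (?n + 2)) * ((y - z) \<bullet> h))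
        + (- 2 * (h \<bullet> v)) * (1 / norm (y - z) ^ ?n))
       - ((?n * (1 - (norm y)\<^sup>2)) * ((y - z) \<bullet> v) * (- (real (?n + 2) / norm (y - z) ^ (?n + 2 + 2)) * ((y - z) \<bullet> h))
        + ((?n * (1 - (norm y)\<^sup>2)) * (h \<bullet> v) + (?n * (- 2 * (y \<bullet> h))) * ((y - z) \<bullet> v)) * (1 / norm (y - z) ^ (?n + 2))))) (at y)"
    by (intro has_derivative_diff has_derivative_mult has_derivative_mult_right has_derivative_one_minus_norm_sq 0
        has_derivative_inverse_norm_power assms)
  moreover have "(\<lambda>y. poisson_grad y z \<bullet> v) = (\<lambda>y. (- 2 * (y \<bullet> v)) * (1 / norm (y - z) ^ ?n)
       - (?n * (1 - (norm y)\<^sup>2)) * ((y - z) \<bullet> v) * (1 / norm (y - z) ^ (?n + 2)))"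
    by (auto simp: poisson_grad_def fun_eq_iff inner_diff_left add_divide_distrib diff_divide_distrib algebra_simps)
  moreover have "poisson_hess v y z \<bullet> h = ((- 2 * (y \<bullet> v)) * (- (?n / norm (y - z) ^ (?n + 2)) * ((y - z) \<bullet> h))
        + (- 2 * (h \<bullet> v)) * (1 / norm (y - z) ^ ?n))
       - ((?n * (1 - (norm y)\<^sup>2)) * ((y - z) \<bullet> v) * (- (real (?n + 2) / norm (y - z) ^ (?n + 2 + 2)) * ((y - z) \<bullet> h))
        + ((?n * (1 - (norm y)\<^sup>2)) * (h \<bullet> v) + (?n * (- 2 * (y \<bullet> h))) * ((y - z) \<bullet> v)) * (1 / norm (y - z) ^ (?n + 2)))" for h
  proof -
    obtain d where d: "d = y - z" by blast
    have p4: "norm d ^ (?n + 2 + 2) = norm d ^ (?n + 4)" by (rule arg_cong[of _ _ "power (norm d)"]) simp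
    show ?thesis
      unfolding poisson_hess_def d[symmetric] p4
      by (simp add: inner_diff_left inner_add_left inner_commute[of v]
         add_divide_distrib diff_divide_distrib algebra_simps del: power_Suc)
  qed
  ultimately show ?thesis by (simp only:)
qed

text \<open>With N = |y - z| the trace is a multiple of - N^2 + 2 y . (y - z) + 1 - |y|^2, and this
  vanishes because |z| = 1 gives N^2 = |y|^2 - 2 y . z + 1.\<close>

lemma poisson_hess_trace:
  fixes y z :: "'a::euclidean_space"
  assumes z: "norm z = 1" and "y \<noteq> z"
  shows "(\<Sum>i\<in>Basis. poisson_hess i y z \<bullet> i) = 0"
proof -
  let ?n = "real DIM('a)" and ?N = "norm (y - z)"
  have N: "?N > 0" using assms by simp
  have N2: "?N\<^sup>2 = (norm y)\<^sup>2 - 2 * (y \<bullet> z) + 1"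
    using z by (simp add: power2_norm_eq_inner inner_diff_left inner_diff_right inner_commute norm_eq_1)
  have yN: "y \<bullet> (y - z) = (norm y)\<^sup>2 - y \<bullet> z" by (simp add: inner_diff_right power2_norm_eq_inner)
  have S: "(\<Sum>i\<in>Basis. (a \<bullet> i) * (b \<bullet> i)) = a \<bullet> b" for a b :: 'a by (simp add: euclidean_inner[of a b])
  define E where "E = 1 / ?N ^ (DIM('a) + 2)"
  have E0: "1 / ?N ^ DIM('a) = ?N\<^sup>2 * E" and E4: "1 / ?N ^ (DIM('a) + 4) * ?N\<^sup>2 = E"
    using N by (auto simp: E_def power_add field_simps power2_eq_square eval_nat_numeral)
  have h: "poisson_hess i y z \<bullet> i = - 2 * (1 / ?N ^ DIM('a)) + 4 * ?n * E * ((y \<bullet> i) * ((y - z) \<bullet> i))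
       - ?n * (1 - (norm y)\<^sup>2) * E + ?n * (?n + 2) * (1 - (norm y)\<^sup>2) * (1 / ?N ^ (DIM('a) + 4)) * (((y - z) \<bullet> i) * ((y - z) \<bullet> i))"
    if "i \<in> Basis" for i
    using that by (simp add: poisson_hess_def E_def inner_add_left inner_diff_left algebra_simps add_divide_distrib diff_divide_distrib)
  have S2: "(\<Sum>i\<in>Basis. a + b * ((y \<bullet> i) * ((y - z) \<bullet> i)) - c + d * (((y - z) \<bullet> i) * ((y - z) \<bullet> i)))
      = ?n * (a - c) + b * (y \<bullet> (y - z)) + d * ((y - z) \<bullet> (y - z))" for a b c d
    by (simp only: sum.distrib sum_subtractf sum_distrib_left[symmetric] S) (simp add: algebra_simps)
  have "(\<Sum>i\<in>Basis. poisson_hess i y z \<bullet> i) = ?n * (- 2 * (1 / ?N ^ DIM('a)) - ?n * (1 - (norm y)\<^sup>2) * E)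
      + 4 * ?n * E * (y \<bullet> (y - z)) + ?n * (?n + 2) * (1 - (norm y)\<^sup>2) * (1 / ?N ^ (DIM('a) + 4)) * ?N\<^sup>2"
    by (simp only: sum.cong[OF refl h] S2 power2_norm_eq_inner[of "y - z"])
  also have "\<dots> = 2 * ?n * E * (- ?N\<^sup>2 + 2 * (y \<bullet> (y - z)) + (1 - (norm y)\<^sup>2))"
    unfolding E0 by (simp only: mult.assoc E4) (simp add: algebra_simps)
  also have "\<dots> = 0" by (simp add: N2 yN)
  finally show ?thesis .
qed

lemma partial_deriv_eqI:
  assumes "(u has_derivative u') (at y)" shows "partial_deriv u i y = u' i"
  using frechet_derivative_at[OF assms] by (simp add: partial_deriv_def)

lemma grad_inner:
  fixes u :: "'a::euclidean_space \<Rightarrow> real"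
  assumes "(u has_derivative u') (at y)"
  shows "grad u y \<bullet> h = u' h"
proof -
  have lin: "linear u'" using assms by (rule has_derivative_linear)
  have "grad u y \<bullet> h = (\<Sum>i\<in>Basis. (h \<bullet> i) * u' i)"
    by (simp add: grad_def inner_sum_left partial_deriv_eqI[OF assms] mult.commute inner_commute[of h])
  also have "\<dots> = u' (\<Sum>i\<in>Basis. (h \<bullet> i) *\<^sub>R i)"
    by (simp add: linear_sum[OF lin] linear_cmul[OF lin])
  finally show ?thesis by (simp add: euclidean_representation)
qed

lemma poisson_measurable [measurable]:
  fixes y v :: "'a::euclidean_space"
  shows "poisson_kernel y \<in> borel_measurable borel"
    and "poisson_grad y \<in> borel_measurable borel"
    and "poisson_hess v y \<in> borel_measurable borel"
  unfolding poisson_kernel_def[abs_def] poisson_grad_def[abs_def] poisson_hess_def[abs_def]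
  by measurable

text \<open>Kernel and derivatives are continuous on the compact product of \<open>cball 0 s\<close>
  with the sphere, where \<open>y\<close> and \<open>z\<close> stay apart since
  \<open>s < 1\<close>. Finiteness of \<open>Basis\<close> yields a single bound.\<close>

lemma poisson_bounds:
  fixes s :: real
  assumes "s < 1"
  obtains B where "B > 0"
    "\<And>y z::'a::euclidean_space. norm y \<le> s \<Longrightarrow> norm z = 1 \<Longrightarrow> \<bar>poisson_kernel y z\<bar> \<le> B"
    "\<And>y z::'a::euclidean_space. norm y \<le> s \<Longrightarrow> norm z = 1 \<Longrightarrow> norm (poisson_grad y z) \<le> B"
    "\<And>v y z::'a::euclidean_space. v \<in> Basis \<Longrightarrow> norm y \<le> s \<Longrightarrow> norm z = 1 \<Longrightarrow> norm (poisson_hess v y z) \<le> B"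
proof -
  let ?K = "cball (0::'a) s \<times> sphere (0::'a) 1"
  have nz: "norm (fst p - snd p) ^ k \<noteq> 0" if "p \<in> ?K" for p k
    using that assms by auto
  have bd: "bounded (f ` ?K)" if "continuous_on ?K f" for f :: "'a \<times> 'a \<Rightarrow> 'b::real_normed_vector"
    using that by (intro compact_imp_bounded compact_continuous_image compact_Times) auto
  have "continuous_on ?K (\<lambda>p. poisson_kernel (fst p) (snd p))"
    unfolding poisson_kernel_def by (intro continuous_intros ballI nz)
  then obtain B1 where B1: "\<And>p. p \<in> ?K \<Longrightarrow> norm (poisson_kernel (fst p) (snd p)) \<le> B1"
    using bd unfolding bounded_iff by (metis (no_types, lifting) imageI)
  have "continuous_on ?K (\<lambda>p. poisson_grad (fst p) (snd p))"
    unfolding poisson_grad_def by (intro continuous_intros ballI nz)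
  then obtain B2 where B2: "\<And>p. p \<in> ?K \<Longrightarrow> norm (poisson_grad (fst p) (snd p)) \<le> B2"
    using bd unfolding bounded_iff by (metis (no_types, lifting) imageI)
  have "continuous_on ?K (\<lambda>p. poisson_hess v (fst p) (snd p))" for v
    unfolding poisson_hess_def by (intro continuous_intros ballI nz)
  then have "\<exists>B. \<forall>p\<in>?K. norm (poisson_hess v (fst p) (snd p)) \<le> B" for v
    using bd unfolding bounded_iff by (metis (no_types, lifting) imageI)
  then obtain B3 where B3: "\<And>v p. p \<in> ?K \<Longrightarrow> norm (poisson_hess v (fst p) (snd p)) \<le> B3 v"
    by metis
  define B where "B = 1 + \<bar>B1\<bar> + \<bar>B2\<bar> + (\<Sum>v\<in>Basis. \<bar>B3 v\<bar>)"
  have B3': "B3 v \<le> (\<Sum>v\<in>Basis. \<bar>B3 v\<bar>)" if "v \<in> Basis" for v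
    using member_le_sum[OF that, of "\<lambda>v. \<bar>B3 v\<bar>"] by simp
  have B3'': "0 \<le> (\<Sum>v\<in>Basis. \<bar>B3 v\<bar>)" by (simp add: sum_nonneg)
  show thesis
  proof (rule that[of B])
    show "B > 0" using B3'' unfolding B_def by linarith
    fix y z :: 'a assume yz: "norm y \<le> s" "norm z = 1"
    then have p: "(y, z) \<in> ?K" by auto
    show "\<bar>poisson_kernel y z\<bar> \<le> B"
      using B1[OF p] B3'' abs_ge_self[of B1] unfolding B_def fst_conv snd_conv real_norm_def by linarith
    show "norm (poisson_grad y z) \<le> B"
      using B2[OF p] B3'' abs_ge_self[of B2] unfolding B_def fst_conv snd_conv by linarith
    show "norm (poisson_hess v y z) \<le> B" if "v \<in> Basis" for v
      using B3[OF p, of v] B3'[OF that] unfolding B_def fst_conv snd_conv by linarith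
  qed
qed

definition poisson_integral :: "('a::euclidean_space \<Rightarrow> real) \<Rightarrow> 'a \<Rightarrow> real" where
  "poisson_integral g y = (\<integral>z. g z * poisson_kernel y z \<partial>sphere_measure)"

context
  fixes g :: "'a::euclidean_space \<Rightarrow> real" and C :: real
  assumes g_meas: "g \<in> borel_measurable borel" and g_bound: "\<And>z. norm z = 1 \<Longrightarrow> \<bar>g z\<bar> \<le> C"
begin

lemma integrable_poisson_kernel:
  assumes "norm y < 1" shows "integrable sphere_measure (\<lambda>z. g z * poisson_kernel y z)"
proof -
  note [measurable] = g_meas
  obtain B where B: "B > 0" "\<And>z::'a. norm z = 1 \<Longrightarrow> \<bar>poisson_kernel y z\<bar> \<le> B"
    using poisson_bounds[OF assms] by (metis order_refl)
  show ?thesis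
    by (rule integrable_sphere_measure[of _ "C * B"])
       (use B g_bound in \<open>auto intro!: sphere_measure_measurable mult_mono simp: abs_mult
          intro: order_trans[OF abs_ge_zero]\<close>)
qed

lemma integrable_poisson_grad:
  assumes "norm y < 1" shows "integrable sphere_measure (\<lambda>z. g z * (poisson_grad y z \<bullet> h))"
proof -
  note [measurable] = g_meas
  obtain B where B: "B > 0" "\<And>z::'a. norm z = 1 \<Longrightarrow> norm (poisson_grad y z) \<le> B"
    using poisson_bounds[OF assms] by (metis order_refl)
  have "\<bar>g z * (poisson_grad y z \<bullet> h)\<bar> \<le> C * (B * norm h)" if z: "norm z = 1" for z
    unfolding abs_mult
    using g_bound[OF z] Cauchy_Schwarz_ineq2[of "poisson_grad y z" h] mult_right_mono[OF B(2)[OF z], of "norm h"]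
    by (intro mult_mono) auto
  then show ?thesis
    by (intro integrable_sphere_measure[of _ "C * (B * norm h)"] sphere_measure_measurable) auto
qed

lemma has_derivative_poisson_integral:
  assumes y: "norm y < 1"
  shows "(poisson_integral g has_derivative (\<lambda>h. \<integral>z. g z * (poisson_grad y z \<bullet> h) \<partial>sphere_measure)) (at y)"
proof -
  note [measurable] = g_meas
  \<comment> \<open>Halfway between \<open>norm y\<close> and 1: \<open>ball 0 s\<close> is a
    neighbourhood of \<open>y\<close> with uniform kernel bounds.\<close>
  define s where "s = (1 + norm y) / 2"
  have s: "s < 1" "norm y < s" using y by (auto simp: s_def)
  obtain B where B: "B > 0" "\<And>y z::'a. norm y \<le> s \<Longrightarrow> norm z = 1 \<Longrightarrow> norm (poisson_grad y z) \<le> B"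
    using poisson_bounds[OF s(1)] by metis
  \<comment> \<open>\<open>to_sphere 0\<close> merely supplies some point of the sphere.\<close>
  have C: "0 \<le> C" using g_bound[of "to_sphere 0"] by (auto intro: order_trans[OF abs_ge_zero])
  have "((\<lambda>y. \<integral>z. g z * poisson_kernel y z \<partial>sphere_measure) has_derivative
      (\<lambda>h. \<integral>z. (g z *\<^sub>R poisson_grad y z) \<bullet> h \<partial>sphere_measure)) (at y)"
  proof (rule has_derivative_integral_bounded_gradient[OF finite_sphere_measure, where U="ball 0 s" and B="C * B"])
    fix x z :: 'a assume x: "x \<in> ball 0 s" and "z \<in> space sphere_measure"
    then have z: "norm z = 1" and "x \<noteq> z" using s by auto
    then show "((\<lambda>y. g z * poisson_kernel y z) has_derivative (\<lambda>h. (g z *\<^sub>R poisson_grad x z) \<bullet> h)) (at x)"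
      using has_derivative_mult_right[OF has_derivative_poisson_kernel, of x z "g z"] by simp
    show "norm (g z *\<^sub>R poisson_grad x z) \<le> C * B"
      using g_bound[OF z] B(2)[of x z] x z C by (auto intro!: mult_mono)
  next
    fix x :: 'a assume "x \<in> ball 0 s"
    then show "integrable sphere_measure (\<lambda>z. g z * poisson_kernel x z)"
      using s by (intro integrable_poisson_kernel) auto
  next
    show "(\<lambda>z. g z *\<^sub>R poisson_grad y z) \<in> borel_measurable sphere_measure"
      by (rule sphere_measure_measurable) measurable
  qed (use s in auto)
  then show ?thesis by (simp add: poisson_integral_def[abs_def])
qed

lemma has_derivative_integral_poisson_grad:
  assumes y: "norm y < 1" and v: "v \<in> Basis"
  shows "((\<lambda>y. \<integral>z. g z * (poisson_grad y z \<bullet> v) \<partial>sphere_measure) has_derivative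
    (\<lambda>h. \<integral>z. g z * (poisson_hess v y z \<bullet> h) \<partial>sphere_measure)) (at y)"
proof -
  note [measurable] = g_meas
  define s where "s = (1 + norm y) / 2"
  have s: "s < 1" "norm y < s" using y by (auto simp: s_def)
  obtain B where B: "B > 0" "\<And>v y z::'a. v \<in> Basis \<Longrightarrow> norm y \<le> s \<Longrightarrow> norm z = 1 \<Longrightarrow> norm (poisson_hess v y z) \<le> B"
    using poisson_bounds[OF s(1)] by metis
  have C: "0 \<le> C" using g_bound[of "to_sphere 0"] by (auto intro: order_trans[OF abs_ge_zero])
  have "((\<lambda>y. \<integral>z. g z * (poisson_grad y z \<bullet> v) \<partial>sphere_measure) has_derivative
      (\<lambda>h. \<integral>z. (g z *\<^sub>R poisson_hess v y z) \<bullet> h \<partial>sphere_measure)) (at y)"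
  proof (rule has_derivative_integral_bounded_gradient[OF finite_sphere_measure, where U="ball 0 s" and B="C * B"])
    fix x z :: 'a assume x: "x \<in> ball 0 s" and "z \<in> space sphere_measure"
    then have z: "norm z = 1" and "x \<noteq> z" using s by auto
    then show "((\<lambda>y. g z * (poisson_grad y z \<bullet> v)) has_derivative (\<lambda>h. (g z *\<^sub>R poisson_hess v x z) \<bullet> h)) (at x)"
      using has_derivative_mult_right[OF has_derivative_poisson_grad_inner, of x z "g z" v] by simp
    show "norm (g z *\<^sub>R poisson_hess v x z) \<le> C * B"
      using g_bound[OF z] B(2)[OF v, of x z] x z C by (auto intro!: mult_mono)
  next
    fix x :: 'a assume "x \<in> ball 0 s"
    then show "integrable sphere_measure (\<lambda>z. g z * (poisson_grad x z \<bullet> v))"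
      using s by (intro integrable_poisson_grad) auto
  next
    show "(\<lambda>z. g z *\<^sub>R poisson_hess v y z) \<in> borel_measurable sphere_measure"
      by (rule sphere_measure_measurable) measurable
  qed (use s in auto)
  then show ?thesis by simp
qed

lemma partial_deriv_poisson_integral:
  assumes "norm y < 1"
  shows "partial_deriv (poisson_integral g) i y = (\<integral>z. g z * (poisson_grad y z \<bullet> i) \<partial>sphere_measure)"
  by (rule partial_deriv_eqI[OF has_derivative_poisson_integral[OF assms]])

lemma has_derivative_partial_deriv_poisson_integral:
  assumes y: "norm y < 1" and i: "i \<in> Basis"
  shows "(partial_deriv (poisson_integral g) i has_derivative
    (\<lambda>h. \<integral>z. g z * (poisson_hess i y z \<bullet> h) \<partial>sphere_measure)) (at y)"
  by (rule has_derivative_transform_within_open[OF has_derivative_integral_poisson_grad[OF assms], of "ball 0 1"])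
     (use y in \<open>auto simp: partial_deriv_poisson_integral\<close>)

lemma partial_deriv2_poisson_integral:
  assumes "norm y < 1" "i \<in> Basis"
  shows "partial_deriv (partial_deriv (poisson_integral g) i) j y = (\<integral>z. g z * (poisson_hess i y z \<bullet> j) \<partial>sphere_measure)"
  by (rule partial_deriv_eqI[OF has_derivative_partial_deriv_poisson_integral[OF assms]])

lemma integrable_poisson_hess:
  assumes "norm y < 1" "i \<in> Basis" shows "integrable sphere_measure (\<lambda>z. g z * (poisson_hess i y z \<bullet> h))"
proof -
  note [measurable] = g_meas
  obtain B where B: "B > 0" "\<And>z::'a. norm z = 1 \<Longrightarrow> norm (poisson_hess i y z) \<le> B"
    using poisson_bounds[OF assms(1)] assms(2) by (metis order_refl)
  have "\<bar>g z * (poisson_hess i y z \<bullet> h)\<bar> \<le> C * (B * norm h)" if z: "norm z = 1" for z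
    unfolding abs_mult
    using g_bound[OF z] Cauchy_Schwarz_ineq2[of "poisson_hess i y z" h] mult_right_mono[OF B(2)[OF z], of "norm h"]
    by (intro mult_mono) auto
  then show ?thesis
    by (intro integrable_sphere_measure[of _ "C * (B * norm h)"] sphere_measure_measurable) auto
qed

text \<open>Uniform bounds exist only on balls of radius \<open>s < 1\<close>; these open balls
  exhaust the unit ball, and continuity is local.\<close>

lemma continuous_on_integral_poisson_hess:
  assumes i: "i \<in> Basis"
  shows "continuous_on (ball 0 1) (\<lambda>y. \<integral>z. g z * (poisson_hess i y z \<bullet> j) \<partial>sphere_measure)"
proof -
  note [measurable] = g_meas
  have C: "0 \<le> C" using g_bound[of "to_sphere 0"] by (auto intro: order_trans[OF abs_ge_zero])
  have "continuous_on (ball 0 s) (\<lambda>y. \<integral>z. g z * (poisson_hess i y z \<bullet> j) \<partial>sphere_measure)" if s: "s < 1" for s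
  proof -
    obtain B where B: "B > 0" "\<And>v y z::'a. v \<in> Basis \<Longrightarrow> norm y \<le> s \<Longrightarrow> norm z = 1 \<Longrightarrow> norm (poisson_hess v y z) \<le> B"
      using poisson_bounds[OF s(1)] by metis
    show ?thesis
    proof (rule continuous_on_integral_bounded[OF finite_sphere_measure, where B="C * (B * norm j)"])
      fix z :: 'a assume "z \<in> space sphere_measure"
      then have z: "norm z = 1" by simp
      then have nz: "norm (y - z) ^ k \<noteq> 0" if "y \<in> ball 0 s" for y k using that s by auto
      show "continuous_on (ball 0 s) (\<lambda>y. g z * (poisson_hess i y z \<bullet> j))"
        unfolding poisson_hess_def by (intro continuous_intros ballI nz)
      show "\<bar>g z * (poisson_hess i y z \<bullet> j)\<bar> \<le> C * (B * norm j)" if "y \<in> ball 0 s" for y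
        unfolding abs_mult
        using g_bound[OF z] Cauchy_Schwarz_ineq2[of "poisson_hess i y z" j] mult_right_mono[OF B(2)[OF i, of y z], of "norm j"] that z
        by (intro mult_mono) auto
    qed (intro sphere_measure_measurable, measurable)
  qed
  then have "continuous_on (\<Union>s\<in>{..<1}. ball 0 s) (\<lambda>y. \<integral>z. g z * (poisson_hess i y z \<bullet> j) \<partial>sphere_measure)"
    by (intro continuous_on_open_UN) auto
  moreover have "(\<Union>s\<in>{..<1}. ball (0::'a) s) = ball 0 1"
    using dense by (fastforce simp: Bex_def)
  ultimately show ?thesis by simp
qed

lemma harmonic_on_poisson_integral: "harmonic_on (ball 0 1) (poisson_integral g)"
  unfolding harmonic_on_def
proof (intro conjI ballI)
  show "poisson_integral g differentiable at y" if "y \<in> ball 0 1" for y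
    using has_derivative_poisson_integral[of y] that by (auto simp: differentiable_def)
  show "partial_deriv (poisson_integral g) i differentiable at y" if "y \<in> ball 0 1" "i \<in> Basis" for i y
    using has_derivative_partial_deriv_poisson_integral[of y i] that by (auto simp: differentiable_def)
  show "continuous_on (ball 0 1) (partial_deriv (partial_deriv (poisson_integral g) i) j)"
    if "i \<in> Basis" "j \<in> Basis" for i j
    by (rule continuous_on_eq[OF continuous_on_integral_poisson_hess[OF that(1), of j]])
       (use that in \<open>auto simp: partial_deriv2_poisson_integral\<close>)
  fix y :: 'a assume "y \<in> ball 0 1"
  then have y: "norm y < 1" by simp
  have "(\<Sum>i\<in>Basis. partial_deriv (partial_deriv (poisson_integral g) i) i y)
      = (\<Sum>i\<in>Basis. \<integral>z. g z * (poisson_hess i y z \<bullet> i) \<partial>sphere_measure)"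
    using y by (simp add: partial_deriv2_poisson_integral)
  also have "\<dots> = (\<integral>z. (\<Sum>i\<in>Basis. g z * (poisson_hess i y z \<bullet> i)) \<partial>sphere_measure)"
    using y by (intro Bochner_Integration.integral_sum[symmetric] integrable_poisson_hess) auto
  also have "\<dots> = (\<integral>z. 0 \<partial>(sphere_measure :: 'a measure))"
  proof (rule Bochner_Integration.integral_cong[OF refl])
    fix z :: 'a assume "z \<in> space sphere_measure"
    then have "norm z = 1" "y \<noteq> z" using y by auto
    then show "(\<Sum>i\<in>Basis. g z * (poisson_hess i y z \<bullet> i)) = 0"
      by (simp add: sum_distrib_left[symmetric] poisson_hess_trace)
  qed
  finally show "(\<Sum>i\<in>Basis. partial_deriv (partial_deriv (poisson_integral g) i) i y) = 0" by simp
qed auto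

end

section \<open>Poisson formula\<close>

text \<open>A form of harmonicity by partial derivatives along the axes only, which is stable under differences and
  scaling without any Frechet differentiability of the first derivatives.\<close>

definition laplace_zero_on ::
  "'a::euclidean_space set \<Rightarrow> ('a \<Rightarrow> real) \<Rightarrow> ('a \<Rightarrow> 'a \<Rightarrow> real) \<Rightarrow> ('a \<Rightarrow> 'a \<Rightarrow> real) \<Rightarrow> bool" where
  "laplace_zero_on S w p q \<longleftrightarrow> (\<forall>y\<in>S.
     (\<forall>i\<in>Basis. ((\<lambda>t. w (y + t *\<^sub>R i)) has_real_derivative p i y) (at 0) \<and>
                ((\<lambda>t. p i (y + t *\<^sub>R i)) has_real_derivative q i y) (at 0)) \<and>
     (\<Sum>i\<in>Basis. q i y) = 0)"

lemma has_real_derivative_along: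
  fixes u :: "'a::real_normed_vector \<Rightarrow> real"
  assumes "(u has_derivative u') (at (y + t *\<^sub>R i))"
  shows "((\<lambda>t. u (y + t *\<^sub>R i)) has_real_derivative u' i) (at t)"
proof -
  have "((\<lambda>t. y + t *\<^sub>R i) has_derivative (\<lambda>s. s *\<^sub>R i)) (at t)"
    by (auto intro!: derivative_eq_intros)
  from has_derivative_compose[OF this assms] show ?thesis
    using linear_cmul[OF has_derivative_linear[OF assms]]
    by (simp add: has_field_derivative_def mult_commute_abs)
qed

lemma laplace_zero_on_harmonic:
  assumes "harmonic_on S u"
  shows "laplace_zero_on S u (partial_deriv u) (\<lambda>i. partial_deriv (partial_deriv u i) i)"
proof -
  have "((\<lambda>t. v (y + t *\<^sub>R i)) has_real_derivative partial_deriv v i y) (at 0)"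
    if "v differentiable (at y)" for v :: "'a \<Rightarrow> real" and i y
    using has_real_derivative_along[of v "frechet_derivative v (at y)" y 0 i] that
    by (simp add: frechet_derivative_works[symmetric] partial_deriv_def)
  with assms show ?thesis by (auto simp: laplace_zero_on_def harmonic_on_def)
qed

lemma laplace_zero_on_diff:
  assumes "laplace_zero_on S u p q" "laplace_zero_on S v p' q'"
  shows "laplace_zero_on S (\<lambda>y. u y - v y) (\<lambda>i y. p i y - p' i y) (\<lambda>i y. q i y - q' i y)"
  using assms by (auto simp: laplace_zero_on_def sum_subtractf intro!: DERIV_diff)

lemma laplace_zero_on_minus:
  assumes "laplace_zero_on S u p q"
  shows "laplace_zero_on S (\<lambda>y. - u y) (\<lambda>i y. - p i y) (\<lambda>i y. - q i y)"
  using assms by (auto simp: laplace_zero_on_def sum_negf intro!: DERIV_minus)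

lemma laplace_zero_on_subset: "laplace_zero_on S u p q \<Longrightarrow> T \<subseteq> S \<Longrightarrow> laplace_zero_on T u p q"
  by (auto simp: laplace_zero_on_def)

text \<open>All second derivatives pick up the same factor \<open>c\<^sup>2\<close>, so their sum
  stays zero. This serves the dilates of a bounded harmonic function.\<close>

lemma laplace_zero_on_scale:
  fixes u :: "'a::euclidean_space \<Rightarrow> real"
  assumes "laplace_zero_on S u p q" and "\<And>y. y \<in> T \<Longrightarrow> c *\<^sub>R y \<in> S"
  shows "laplace_zero_on T (\<lambda>y. u (c *\<^sub>R y)) (\<lambda>i y. c * p i (c *\<^sub>R y)) (\<lambda>i y. c\<^sup>2 * q i (c *\<^sub>R y))"
proof -
  have *: "((\<lambda>t. v (c *\<^sub>R (y + t *\<^sub>R i))) has_real_derivative c * d) (at 0)"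
    if "((\<lambda>t. v (c *\<^sub>R y + t *\<^sub>R i)) has_real_derivative d) (at 0)" for v :: "'a \<Rightarrow> real" and y i d
  proof -
    have "((\<lambda>t. c * t) has_real_derivative c) (at 0)" by (auto intro!: derivative_eq_intros)
    moreover have "((\<lambda>t. v (c *\<^sub>R y + t *\<^sub>R i)) has_real_derivative d) (at (c * 0))" using that by simp
    ultimately have "((\<lambda>t. v (c *\<^sub>R y + (c * t) *\<^sub>R i)) has_real_derivative d * c) (at 0)"
      using DERIV_chain2[of "\<lambda>t. v (c *\<^sub>R y + t *\<^sub>R i)" d "\<lambda>t. c * t" 0 c UNIV] by simp
    then show ?thesis by (simp add: scaleR_add_right mult.commute)
  qed
  show ?thesis
    unfolding laplace_zero_on_def
  proof (intro ballI conjI)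
    fix y i :: 'a assume y: "y \<in> T" and i: "i \<in> Basis"
    note S = assms(2)[OF y]
    show "((\<lambda>t. u (c *\<^sub>R (y + t *\<^sub>R i))) has_real_derivative c * p i (c *\<^sub>R y)) (at 0)"
      using assms(1) S i by (intro *) (auto simp: laplace_zero_on_def)
    have "((\<lambda>t. p i (c *\<^sub>R (y + t *\<^sub>R i))) has_real_derivative c * q i (c *\<^sub>R y)) (at 0)"
      using assms(1) S i by (intro *) (auto simp: laplace_zero_on_def)
    from DERIV_cmult[OF this, of c]
    show "((\<lambda>t. c * p i (c *\<^sub>R (y + t *\<^sub>R i))) has_real_derivative c\<^sup>2 * q i (c *\<^sub>R y)) (at 0)"
      by (simp add: power2_eq_square mult.assoc)
  qed (use assms in \<open>auto simp: laplace_zero_on_def sum_distrib_left[symmetric]\<close>)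
qed

section \<open>Maximum principle\<close>

text \<open>If \<open>c > 0\<close>, then \<open>f'\<close> is positive just to the right of 0 and
  the mean value theorem makes \<open>f\<close> exceed \<open>f 0\<close>. Only the derivative of
  \<open>f'\<close> at the single point 0 enters.\<close>

lemma second_derivative_le_zero_at_max:
  fixes f f' :: "real \<Rightarrow> real"
  assumes "d > 0" and der: "\<And>t. \<bar>t\<bar> < d \<Longrightarrow> (f has_real_derivative f' t) (at t)"
    and der2: "(f' has_real_derivative c) (at 0)"
    and max: "\<And>t. \<bar>t\<bar> < d \<Longrightarrow> f t \<le> f 0"
  shows "c \<le> 0"
proof (rule ccontr)
  assume "\<not> c \<le> 0"
  then have c: "c > 0" by simp
  have f'0: "f' 0 = 0"
    using DERIV_local_max[OF der[of 0], of d] \<open>d > 0\<close> max by auto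
  obtain e where e: "e > 0" "\<And>h. 0 < h \<Longrightarrow> h < e \<Longrightarrow> f' 0 < f' (0 + h)"
    using DERIV_pos_inc_right[OF der2 c] by auto
  define b where "b = min d e / 2"
  have b: "0 < b" "b < d" "b < e" using \<open>d > 0\<close> e by (auto simp: b_def)
  obtain x where x: "0 < x" "x < b" "f b - f 0 = (b - 0) * f' x"
    using MVT2[of 0 b f f'] b der by force
  have "f' x > 0" using e(2)[of x] x b f'0 by simp
  with b have "b * f' x > 0" by simp
  with x have "f b > f 0" by simp
  with max[of b] b show False by simp
qed

text \<open>Adding a small multiple of |y|^2 makes the sum of second derivatives strictly positive,
  which is impossible at an interior maximum, where each of them is at most 0.\<close>

lemma laplace_zero_on_le_sphere:
  fixes w :: "'a::euclidean_space \<Rightarrow> real"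
  assumes lz: "laplace_zero_on (ball 0 s) w p q" and cont: "continuous_on (cball 0 s) w"
    and bdry: "\<And>y. norm y = s \<Longrightarrow> w y \<le> m" and y1: "norm y1 \<le> s"
  shows "w y1 \<le> m"
proof (rule ccontr)
  assume "\<not> w y1 \<le> m"
  then have gt: "w y1 > m" by simp
  have s: "s > 0" using bdry gt y1 by (cases "norm y1 = s") (auto simp: order_less_le intro: order_trans[OF norm_ge_zero])
  \<comment> \<open>Half of the largest admissible slope: on the sphere the perturbation adds
    \<open>k * s\<^sup>2\<close>, half of the excess of \<open>w y1\<close> over \<open>m\<close>,
    so the maximum of \<open>v\<close> cannot lie there.\<close>
  define k where "k = (w y1 - m) / (2 * s\<^sup>2)"
  have k: "k > 0" "k * s\<^sup>2 < w y1 - m" using gt s by (auto simp: k_def)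
  define v where "v y = w y + k * (norm y)\<^sup>2" for y
  have "continuous_on (cball 0 s) v" unfolding v_def by (intro continuous_intros cont)
  moreover have "cball (0::'a) s \<noteq> {}" using s by simp
  ultimately obtain y0 where y0: "norm y0 \<le> s" and max: "\<And>y. norm y \<le> s \<Longrightarrow> v y \<le> v y0"
    using continuous_attains_sup[OF compact_cball, of 0 s v] by auto
  have "w y1 \<le> v y1" using k by (simp add: v_def)
  also have "\<dots> \<le> v y0" by (rule max[OF y1])
  finally have "norm y0 \<noteq> s" using bdry[of y0] k by (auto simp: v_def)
  with y0 have y0s: "norm y0 < s" by simp
  define d where "d = s - norm y0"
  have d: "d > 0" using y0s by (simp add: d_def)
  have nin: "norm (y0 + t *\<^sub>R i) < s" if "\<bar>t\<bar> < d" "i \<in> Basis" for t i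
    using norm_triangle_ineq[of y0 "t *\<^sub>R i"] that by (simp add: d_def)
  have "q i y0 + 2 * k \<le> 0" if i: "i \<in> Basis" for i
  proof (rule second_derivative_le_zero_at_max[OF d])
    have sq: "((\<lambda>t. k * (norm (y0 + t *\<^sub>R i))\<^sup>2) has_real_derivative 2 * k * ((y0 + t *\<^sub>R i) \<bullet> i)) (at t)" for t
    proof -
      have "(norm (y0 + t *\<^sub>R i))\<^sup>2 = (norm y0)\<^sup>2 + 2 * t * (y0 \<bullet> i) + t\<^sup>2" for t
        unfolding power2_norm_eq_inner using i by (simp add: inner_add_left inner_add_right inner_commute algebra_simps power2_eq_square)
      then show ?thesis using i by (auto intro!: derivative_eq_intros simp: inner_add_left algebra_simps)
    qed
    show "((\<lambda>t. v (y0 + t *\<^sub>R i)) has_real_derivative p i (y0 + t *\<^sub>R i) + 2 * k * ((y0 + t *\<^sub>R i) \<bullet> i)) (at t)"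
      if t: "\<bar>t\<bar> < d" for t
    proof -
      have "((\<lambda>s. w (y0 + t *\<^sub>R i + s *\<^sub>R i)) has_real_derivative p i (y0 + t *\<^sub>R i)) (at 0)"
        using lz nin[OF t i] i by (auto simp: laplace_zero_on_def)
      then have "((\<lambda>s. w (y0 + (s + t) *\<^sub>R i)) has_real_derivative p i (y0 + t *\<^sub>R i)) (at 0)"
        by (simp add: scaleR_add_left algebra_simps)
      then have "((\<lambda>s. w (y0 + s *\<^sub>R i)) has_real_derivative p i (y0 + t *\<^sub>R i)) (at t)"
        using DERIV_shift[of "\<lambda>s. w (y0 + s *\<^sub>R i)" _ 0 t] by simp
      then show ?thesis unfolding v_def by (intro DERIV_add sq)
    qed
    show "((\<lambda>t. p i (y0 + t *\<^sub>R i) + 2 * k * ((y0 + t *\<^sub>R i) \<bullet> i)) has_real_derivative q i y0 + 2 * k) (at 0)"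
    proof (rule DERIV_add)
      show "((\<lambda>t. p i (y0 + t *\<^sub>R i)) has_real_derivative q i y0) (at 0)"
        using lz y0s i by (auto simp: laplace_zero_on_def)
      show "((\<lambda>t. 2 * k * ((y0 + t *\<^sub>R i) \<bullet> i)) has_real_derivative 2 * k) (at 0)"
        using i by (auto intro!: derivative_eq_intros simp: inner_add_left)
    qed
    show "v (y0 + t *\<^sub>R i) \<le> v (y0 + 0 *\<^sub>R i)" if "\<bar>t\<bar> < d" for t
      using max[of "y0 + t *\<^sub>R i"] nin[OF that i] by simp
  qed
  then have "(\<Sum>i\<in>Basis. q i y0 + 2 * k) \<le> 0" by (rule sum_nonpos)
  moreover have "(\<Sum>i\<in>Basis. q i y0) = 0" using lz y0s by (auto simp: laplace_zero_on_def)
  ultimately show False using k by (simp add: sum.distrib mult_le_0_iff)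
qed

text \<open>The reflection along \<open>v = a - b\<close>. Equal norms give 2 v . a = v . v, so that
  \<open>a\<close> is sent to \<open>a - v = b\<close>.\<close>

lemma orthogonal_transformation_exists_euclidean:
  fixes a b :: "'a::euclidean_space"
  assumes "norm a = norm b"
  obtains T where "orthogonal_transformation T" "T a = b"
proof (cases "a = b")
  case True
  then show ?thesis using that[of "\<lambda>x. x"] by simp
next
  case False
  define v where "v = a - b"
  have vv: "v \<bullet> v \<noteq> 0" using False by (simp add: v_def)
  define T where "T x = x - (2 * (v \<bullet> x) / (v \<bullet> v)) *\<^sub>R v" for x
  have "orthogonal_transformation T"
    unfolding orthogonal_transformation_def
  proof
    show "linear T"
    proof (rule linearI)
      have c: "2 * (v \<bullet> (x + y)) / (v \<bullet> v) = 2 * (v \<bullet> x) / (v \<bullet> v) + 2 * (v \<bullet> y) / (v \<bullet> v)"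
        "2 * (v \<bullet> (r *\<^sub>R x)) / (v \<bullet> v) = r * (2 * (v \<bullet> x) / (v \<bullet> v))" for x y r
        by (simp_all add: inner_add_right add_divide_distrib)
      show "T (x + y) = T x + T y" for x y
        unfolding T_def c scaleR_add_left by simp
      show "T (r *\<^sub>R x) = r *\<^sub>R T x" for r x
        unfolding T_def c scaleR_diff_right scaleR_scaleR ..
    qed
    show "\<forall>x y. T x \<bullet> T y = x \<bullet> y"
    proof (intro allI)
      fix x y
      have "T x \<bullet> T y = x \<bullet> y - (2 * (v \<bullet> y) / (v \<bullet> v)) * (v \<bullet> x)
          - (2 * (v \<bullet> x) / (v \<bullet> v)) * (v \<bullet> y - (2 * (v \<bullet> y) / (v \<bullet> v)) * (v \<bullet> v))"
        by (simp only: T_def inner_diff_left inner_diff_right inner_scaleR_left inner_scaleR_right inner_commute[of x v])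
           (simp add: right_diff_distrib)
      also have "(2 * (v \<bullet> y) / (v \<bullet> v)) * (v \<bullet> v) = 2 * (v \<bullet> y)" using vv by simp
      finally show "T x \<bullet> T y = x \<bullet> y" by simp
    qed
  qed
  moreover have "a \<bullet> a = b \<bullet> b" using assms by (simp add: norm_eq)
  then have "2 * (v \<bullet> a) = v \<bullet> v" by (simp add: v_def inner_diff_left inner_diff_right inner_commute)
  then have "T a = b" using vv by (simp add: T_def v_def)
  ultimately show ?thesis using that by blast
qed

lemma poisson_kernel_nonneg: "norm y \<le> 1 \<Longrightarrow> 0 \<le> poisson_kernel y z"
  by (simp add: poisson_kernel_def power_le_one)

text \<open>The Poisson integral of 1 is harmonic and, by rotation invariance, radial. It is
  constant on the sphere through \<open>y\<close>, so the maximum principle for it and its negative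
  forces the value at \<open>y\<close> to agree with the value 1 at the centre.\<close>

lemma integral_poisson_kernel:
  fixes y :: "'a::euclidean_space"
  assumes y: "norm y < 1"
  shows "(\<integral>z. poisson_kernel y z \<partial>sphere_measure) = 1"
proof -
  define f :: "'a \<Rightarrow> real" where "f = poisson_integral (\<lambda>_. 1)"
  have harm: "harmonic_on (ball 0 1) f"
    unfolding f_def by (rule harmonic_on_poisson_integral[of _ 1]) auto
  have f0: "f 0 = 1"
  proof -
    have "f 0 = (\<integral>z. 1 \<partial>(sphere_measure::'a measure))"
      unfolding f_def poisson_integral_def
      by (rule Bochner_Integration.integral_cong) (auto simp: poisson_kernel_def)
    then show ?thesis by simp
  qed
  have rad: "f a = f y" if eq: "norm a = norm y" for a
  proof -
    obtain T where T: "orthogonal_transformation T" "T a = y"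
      using orthogonal_transformation_exists_euclidean[OF eq] by blast
    have "poisson_kernel y (T z) = poisson_kernel a z" for z
      using T orthogonal_transformation_norm[OF T(1), of "a - z"] eq
      by (simp add: poisson_kernel_def linear_diff[OF orthogonal_transformation_linear])
    then show ?thesis
      using integral_sphere_measure_orthogonal_transformation[OF T(1), of "poisson_kernel y"]
      by (simp add: f_def poisson_integral_def)
  qed
  let ?s = "norm y"
  note lz = laplace_zero_on_subset[OF laplace_zero_on_harmonic[OF harm], of "ball 0 ?s"]
  have "continuous_on (ball 0 1) f"
    using harm by (intro differentiable_imp_continuous_on) (auto simp: harmonic_on_def differentiable_on_def intro: differentiable_at_withinI)
  then have cont: "continuous_on (cball 0 ?s) f" 
    by (rule continuous_on_subset) (use y in auto)
  have sub: "ball 0 ?s \<subseteq> ball (0::'a) 1" using y by auto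
  have "f 0 \<le> f y"
    by (rule laplace_zero_on_le_sphere[OF lz[OF sub] cont]) (erule eq_refl[OF rad], simp)
  moreover have "- f 0 \<le> - f y"
    by (rule laplace_zero_on_le_sphere[OF laplace_zero_on_minus[OF lz[OF sub]] continuous_on_minus[OF cont]])
       (erule eq_refl[OF arg_cong[OF rad]], simp)
  ultimately show ?thesis using f0 by (simp add: f_def poisson_integral_def)
qed


text \<open>The Poisson integral of the boundary values minus \<open>u\<close> has zero Laplacian
  and becomes uniformly small towards the sphere, so the maximum principle on slightly smaller balls
  makes it vanish. The indicator turns the boundary values into a Borel function on the whole
  space.\<close>

lemma poisson_formula:
  fixes u :: "'a::euclidean_space \<Rightarrow> real"
  assumes lz: "laplace_zero_on (ball 0 1) u p q" and cont: "continuous_on (cball 0 1) u"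
    and y0: "norm y0 < 1"
  shows "poisson_integral (\<lambda>z. indicator (sphere 0 1) z *\<^sub>R u z) y0 = u y0"
proof -
  define g where "g z = indicator (sphere 0 1) z *\<^sub>R u z" for z
  have g_meas: "g \<in> borel_measurable borel"
    unfolding g_def by (rule borel_measurable_continuous_on_indicator) (auto intro: continuous_on_subset[OF cont])
  have "bounded (u ` cball 0 1)"
    by (intro compact_imp_bounded compact_continuous_image cont) auto
  then obtain M where M: "\<And>y. norm y \<le> 1 \<Longrightarrow> \<bar>u y\<bar> \<le> M"
    unfolding bounded_iff by fastforce
  have M0: "M \<ge> 0" using M[of 0] by simp
  have g_bound: "\<bar>g z\<bar> \<le> M" if "norm z = 1" for z using M[of z] that by (simp add: g_def)
  note harm = harmonic_on_poisson_integral[OF g_meas g_bound]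
  define w where "w y = poisson_integral g y - u y" for y
  have lw: "laplace_zero_on (ball 0 1) w (\<lambda>i y. partial_deriv (poisson_integral g) i y - p i y)
      (\<lambda>i y. partial_deriv (partial_deriv (poisson_integral g) i) i y - q i y)"
    unfolding w_def by (rule laplace_zero_on_diff[OF laplace_zero_on_harmonic[OF harm] lz])
  have "continuous_on (ball 0 1) (poisson_integral g)"
    using harm by (intro differentiable_imp_continuous_on) (auto simp: harmonic_on_def differentiable_on_def intro: differentiable_at_withinI)
  then have cw: "continuous_on (ball 0 1) w"
    unfolding w_def by (intro continuous_intros continuous_on_subset[OF cont]) auto
  have small: "\<bar>w y0\<bar> \<le> 2 * e" if e: "e > 0" for e
  proof -
    have "uniformly_continuous_on (cball 0 1) u"
      by (rule compact_uniformly_continuous[OF cont compact_cball])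
    then obtain d where d: "d > 0" "\<And>y z. norm y \<le> 1 \<Longrightarrow> norm z \<le> 1 \<Longrightarrow> dist z y < d \<Longrightarrow> \<bar>u z - u y\<bar> < e"
      using e unfolding uniformly_continuous_on_def by (auto simp: dist_real_def)
    \<comment> \<open>Since the kernel has total mass 1, \<open>w y\<close> is the kernel mean of
      \<open>u z - u y\<close>. Points \<open>z\<close> close to \<open>y\<close> contribute at most
      \<open>e\<close> by uniform continuity; at distance \<open>d\<close> or more the kernel is at
      most (1 - |y|^2) / d^n.\<close>
    have near: "\<bar>w y\<bar> \<le> e + 2 * M * (1 - (norm y)\<^sup>2) / d ^ DIM('a)" if y: "norm y < 1" for y
    proof -
      have y2: "(norm y)\<^sup>2 \<le> 1" using y by (simp add: power_le_one)
      have int1: "integrable sphere_measure (\<lambda>z::'a. poisson_kernel y z)"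
        using integrable_poisson_kernel[of "\<lambda>_. 1" 1 y] y by simp
      note intg = integrable_poisson_kernel[OF g_meas g_bound y]
      have "w y = (\<integral>z. g z * poisson_kernel y z \<partial>sphere_measure) - (\<integral>z. u y * poisson_kernel y z \<partial>sphere_measure)"
        using integral_poisson_kernel[OF y] by (simp add: w_def poisson_integral_def)
      also have "\<dots> = (\<integral>z. g z * poisson_kernel y z - u y * poisson_kernel y z \<partial>sphere_measure)"
        using intg int1 by simp
      finally have "\<bar>w y\<bar> \<le> (\<integral>z. \<bar>g z * poisson_kernel y z - u y * poisson_kernel y z\<bar> \<partial>sphere_measure)"
        using integral_abs_bound by metis
      also have "\<dots> \<le> (\<integral>z. e * poisson_kernel y z + 2 * M * (1 - (norm y)\<^sup>2) / d ^ DIM('a) \<partial>sphere_measure)"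
      proof (rule integral_mono)
        fix z :: 'a assume "z \<in> space sphere_measure"
        then have z: "norm z = 1" by simp
        have gz: "g z = u z" using z by (simp add: g_def)
        have P: "0 \<le> poisson_kernel y z" using y by (intro poisson_kernel_nonneg) simp
        have eq: "\<bar>g z * poisson_kernel y z - u y * poisson_kernel y z\<bar> = \<bar>u z - u y\<bar> * poisson_kernel y z"
          using P by (simp add: gz abs_mult left_diff_distrib[symmetric])
        show "\<bar>g z * poisson_kernel y z - u y * poisson_kernel y z\<bar> \<le> e * poisson_kernel y z + 2 * M * (1 - (norm y)\<^sup>2) / d ^ DIM('a)"
        proof (cases "dist z y < d")
          case True
          then have "\<bar>u z - u y\<bar> * poisson_kernel y z \<le> e * poisson_kernel y z"
            using d(2)[of y z] y z P by (intro mult_right_mono) auto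
          moreover have "0 \<le> 2 * M * (1 - (norm y)\<^sup>2) / d ^ DIM('a)"
            using M0 d(1) y2 by simp
          ultimately show ?thesis unfolding eq by linarith
        next
          case False
          then have dn: "d \<le> norm (y - z)" by (simp add: dist_norm norm_minus_commute)
          have "\<bar>u z - u y\<bar> \<le> 2 * M" using M[of z] M[of y] y z by auto
          moreover have "poisson_kernel y z \<le> (1 - (norm y)\<^sup>2) / d ^ DIM('a)"
            unfolding poisson_kernel_def using d(1) dn y2
            by (intro divide_left_mono power_mono mult_pos_pos zero_less_power) auto
          ultimately have "\<bar>u z - u y\<bar> * poisson_kernel y z \<le> (2 * M) * ((1 - (norm y)\<^sup>2) / d ^ DIM('a))"
            using P M0 by (intro mult_mono) auto
          moreover have "0 \<le> e * poisson_kernel y z" using e P by simp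
          ultimately show ?thesis unfolding eq by simp
        qed
      qed (use intg int1 in \<open>auto intro!: Bochner_Integration.integrable_add finite_measure.integrable_const[OF finite_sphere_measure]\<close>)
      also have "\<dots> = e + 2 * M * (1 - (norm y)\<^sup>2) / d ^ DIM('a)"
        using integral_poisson_kernel[OF y] int1 finite_measure.integrable_const[OF finite_sphere_measure]
        by (subst Bochner_Integration.integral_add) simp_all
      finally show ?thesis .
    qed
    \<comment> \<open>The far contribution vanishes as the radius tends to 1, which provides a
      sphere beyond \<open>y0\<close> on which \<open>w\<close> is at most \<open>2 * e\<close> in
      modulus.\<close>
    have "((\<lambda>s::real. e + 2 * M * (1 - s\<^sup>2) / d ^ DIM('a)) \<longlongrightarrow> e + 2 * M * (1 - 1\<^sup>2) / d ^ DIM('a)) (at_left 1)"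
      by (intro tendsto_intros) (use d in auto)
    then have "\<forall>\<^sub>F s in at_left (1::real). e + 2 * M * (1 - s\<^sup>2) / d ^ DIM('a) < 2 * e"
      by (rule order_tendstoD) (use e in simp)
    moreover have "\<forall>\<^sub>F s in at_left (1::real). s \<in> {norm y0<..<1}"
      using y0 by (rule eventually_at_left_real)
    ultimately have "\<forall>\<^sub>F s in at_left (1::real). e + 2 * M * (1 - s\<^sup>2) / d ^ DIM('a) < 2 * e \<and> s \<in> {norm y0<..<1}"
      by (rule eventually_conj)
    then obtain s where s: "e + 2 * M * (1 - s\<^sup>2) / d ^ DIM('a) < 2 * e" "norm y0 < s" "s < 1"
      using eventually_happens'[OF trivial_limit_at_left_real] by force
    have sub: "ball 0 s \<subseteq> ball (0::'a) 1" "cball 0 s \<subseteq> ball (0::'a) 1" using s by auto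
    have bd: "\<bar>w y\<bar> \<le> 2 * e" if "norm y = s" for y
      using near[of y] that s by simp
    have "w y0 \<le> 2 * e"
      by (rule laplace_zero_on_le_sphere[OF laplace_zero_on_subset[OF lw sub(1)] continuous_on_subset[OF cw sub(2)]])
         (use bd s in \<open>auto simp: abs_le_iff\<close>)
    moreover have "- w y0 \<le> 2 * e"
      by (rule laplace_zero_on_le_sphere[OF laplace_zero_on_minus[OF laplace_zero_on_subset[OF lw sub(1)]]
            continuous_on_minus[OF continuous_on_subset[OF cw sub(2)]]])
         (use bd s in \<open>auto simp: abs_le_iff\<close>)
    ultimately show ?thesis by (simp add: abs_le_iff)
  qed
  have "\<bar>w y0\<bar> \<le> 0 + e" if "e > 0" for e
    using small[of "e / 2"] that by simp
  then have "\<bar>w y0\<bar> \<le> 0" by (rule field_le_epsilon)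
  then show ?thesis by (simp add: w_def g_def[abs_def])
qed

text \<open>For c < 1 the dilate extends continuously to the closed ball and equals its Poisson
  integral, whose density is bounded by \<open>M\<close>. The limit c to 1 is taken in the gradient,
  continuous because the partial derivatives of \<open>u\<close> are differentiable.\<close>

lemma grad_le_integral_poisson_grad:
  fixes u :: "'a::euclidean_space \<Rightarrow> real"
  assumes harm: "harmonic_on (ball 0 1) u" and M: "\<And>y. norm y < 1 \<Longrightarrow> \<bar>u y\<bar> \<le> M" and x: "norm x < 1"
  shows "grad u x \<bullet> l \<le> M * (\<integral>z. \<bar>poisson_grad x z \<bullet> l\<bar> \<partial>sphere_measure)"
proof -
  have du: "(u has_derivative frechet_derivative u (at y)) (at y)" if "norm y < 1" for y
    using harm that by (auto simp: harmonic_on_def frechet_derivative_works)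
  have lin: "c * (grad u (c *\<^sub>R x) \<bullet> l) \<le> M * (\<integral>z. \<bar>poisson_grad x z \<bullet> l\<bar> \<partial>sphere_measure)"
    if c: "0 < c" "c < 1" for c
  proof -
    define v where "v y = u (c *\<^sub>R y)" for y
    have cy: "norm (c *\<^sub>R y) < 1" if "norm y \<le> 1" for y :: 'a
      using c that mult_le_one[of c "norm y"] by (cases "norm y = 1") (auto intro: mult_less_le_imp_less order_le_less_trans[OF mult_left_le_one_le])
    have cont_u: "continuous_on (ball 0 1) u"
      using harm by (intro differentiable_imp_continuous_on) (auto simp: harmonic_on_def differentiable_on_def intro: differentiable_at_withinI)
    have cont: "continuous_on (cball 0 1) v"
      unfolding v_def by (rule continuous_on_compose2[OF cont_u]) (use cy in \<open>auto intro!: continuous_intros\<close>)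
    have lz: "laplace_zero_on (ball 0 1) v (\<lambda>i y. c * partial_deriv u i (c *\<^sub>R y))
       (\<lambda>i y. c\<^sup>2 * partial_deriv (partial_deriv u i) i (c *\<^sub>R y))"
      unfolding v_def by (rule laplace_zero_on_scale[OF laplace_zero_on_harmonic[OF harm]]) (use cy in auto)
    define g where "g z = indicator (sphere 0 1) z *\<^sub>R v z" for z
    have g_meas: "g \<in> borel_measurable borel"
      unfolding g_def by (rule borel_measurable_continuous_on_indicator) (auto intro: continuous_on_subset[OF cont])
    have g_bound: "\<bar>g z\<bar> \<le> M" if "norm z = 1" for z using M[OF cy[of z]] that by (simp add: g_def v_def)
    have "(v has_derivative (\<lambda>h. \<integral>z. g z * (poisson_grad x z \<bullet> h) \<partial>sphere_measure)) (at x)"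
      by (rule has_derivative_transform_within_open[OF has_derivative_poisson_integral[OF g_meas g_bound x], of "ball 0 1"])
         (use x poisson_formula[OF lz cont] in \<open>auto simp: g_def[abs_def]\<close>)
    \<comment> \<open>The same derivative by the chain rule; uniqueness identifies it with the
      integral.\<close>
    moreover have "(v has_derivative (\<lambda>h. frechet_derivative u (at (c *\<^sub>R x)) (c *\<^sub>R h))) (at x)"
      unfolding v_def
      by (rule has_derivative_compose[OF _ du]) (use cy[of x] x in \<open>auto intro!: derivative_eq_intros\<close>)
    ultimately have "frechet_derivative u (at (c *\<^sub>R x)) (c *\<^sub>R l) = (\<integral>z. g z * (poisson_grad x z \<bullet> l) \<partial>sphere_measure)"
      by (metis has_derivative_unique)
    then have "c * (grad u (c *\<^sub>R x) \<bullet> l) = (\<integral>z. g z * (poisson_grad x z \<bullet> l) \<partial>sphere_measure)"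
      using grad_inner[OF du, of "c *\<^sub>R x" "c *\<^sub>R l"] cy[of x] x by simp
    also have "\<dots> \<le> (\<integral>z. M * \<bar>poisson_grad x z \<bullet> l\<bar> \<partial>sphere_measure)"
    proof (rule integral_mono)
      show "integrable sphere_measure (\<lambda>z. g z * (poisson_grad x z \<bullet> l))"
        by (rule integrable_poisson_grad[OF g_meas g_bound x])
      have "integrable sphere_measure (\<lambda>z. poisson_grad x z \<bullet> l)"
        using integrable_poisson_grad[of "\<lambda>_. 1" 1 x] x by simp
      then show "integrable sphere_measure (\<lambda>z. M * \<bar>poisson_grad x z \<bullet> l\<bar>)" by simp
      fix z :: 'a assume "z \<in> space sphere_measure"
      then have "\<bar>g z\<bar> \<le> M" using g_bound by simp
      then have "\<bar>g z * (poisson_grad x z \<bullet> l)\<bar> \<le> M * \<bar>poisson_grad x z \<bullet> l\<bar>"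
        unfolding abs_mult by (intro mult_right_mono) auto
      then show "g z * (poisson_grad x z \<bullet> l) \<le> M * \<bar>poisson_grad x z \<bullet> l\<bar>" by linarith
    qed
    finally show ?thesis by simp
  qed
  have "isCont (\<lambda>c. c * (grad u (c *\<^sub>R x) \<bullet> l)) 1"
  proof -
    have "isCont (partial_deriv u i) (1 *\<^sub>R x)" if "i \<in> Basis" for i
      using harm that x by (auto simp: harmonic_on_def intro!: differentiable_imp_continuous_within)
    then have "isCont (\<lambda>c. partial_deriv u i (c *\<^sub>R x)) 1" if "i \<in> Basis" for i
      using isCont_o2[of "1::real" "\<lambda>c. c *\<^sub>R x" "partial_deriv u i"] that
      by (simp add: continuous_ident)
    then show ?thesis unfolding grad_def inner_sum_left inner_scaleR_left
      by (intro isCont_mult isCont_sum continuous_ident continuous_const ballI)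
  qed
  then have "((\<lambda>c. c * (grad u (c *\<^sub>R x) \<bullet> l)) \<longlongrightarrow> 1 * (grad u (1 *\<^sub>R x) \<bullet> l)) (at_left 1)"
    unfolding isCont_def by (rule filterlim_mono[OF _ order_refl]) (simp add: at_le)
  then have "1 * (grad u (1 *\<^sub>R x) \<bullet> l) \<le> M * (\<integral>z. \<bar>poisson_grad x z \<bullet> l\<bar> \<partial>sphere_measure)"
    by (rule tendsto_upperbound)
       (use eventually_at_left_real[of 0 1] lin in \<open>auto elim!: eventually_mono\<close>)
  then show ?thesis by simp
qed

section \<open>Planar projections of the sphere\<close>

lemma orthogonal_transformation_planar_rotation:
  fixes e g :: "'a::euclidean_space" and \<phi> :: real
  assumes "e \<bullet> e = 1" "g \<bullet> g = 1" "e \<bullet> g = 0"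
  obtains T where "orthogonal_transformation T"
    "\<And>z. T z \<bullet> e = cos \<phi> * (z \<bullet> e) - sin \<phi> * (z \<bullet> g)"
    "\<And>z. T z \<bullet> g = sin \<phi> * (z \<bullet> e) + cos \<phi> * (z \<bullet> g)"
    "\<And>z v. v \<bullet> e = 0 \<Longrightarrow> v \<bullet> g = 0 \<Longrightarrow> T z \<bullet> v = z \<bullet> v"
proof -
  define A where "A z = (cos \<phi> - 1) * (z \<bullet> e) - sin \<phi> * (z \<bullet> g)" for z
  define B where "B z = sin \<phi> * (z \<bullet> e) + (cos \<phi> - 1) * (z \<bullet> g)" for z
  define T where "T z = z + A z *\<^sub>R e + B z *\<^sub>R g" for z
  have ge: "g \<bullet> e = 0" using assms by (simp add: inner_commute)
  have "linear T"
  proof (rule linearI)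
    have AB: "A (x + y) = A x + A y" "B (x + y) = B x + B y" "A (r *\<^sub>R x) = r * A x" "B (r *\<^sub>R x) = r * B x" for x y r
      by (simp_all add: A_def B_def inner_add_left algebra_simps)
    show "T (x + y) = T x + T y" for x y unfolding T_def AB scaleR_add_left by simp
    show "T (r *\<^sub>R x) = r *\<^sub>R T x" for r x unfolding T_def AB scaleR_add_right scaleR_scaleR ..
  qed
  moreover have "norm (T z) = norm z" for z
  proof -
    have "T z \<bullet> T z = z \<bullet> z + (2 * (A z * (z \<bullet> e) + B z * (z \<bullet> g)) + (A z)\<^sup>2 + (B z)\<^sup>2)"
      using assms ge by (simp add: T_def inner_add_left inner_add_right inner_commute[of e z] inner_commute[of g z] power2_eq_square algebra_simps)
    also have "2 * (A z * (z \<bullet> e) + B z * (z \<bullet> g)) + (A z)\<^sup>2 + (B z)\<^sup>2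
        = ((cos \<phi>)\<^sup>2 + (sin \<phi>)\<^sup>2 - 1) * ((z \<bullet> e)\<^sup>2 + (z \<bullet> g)\<^sup>2)"
      unfolding A_def B_def by algebra
    finally show ?thesis by (simp add: norm_eq)
  qed
  ultimately have "orthogonal_transformation T" by (simp add: orthogonal_transformation)
  moreover have "T z \<bullet> v = z \<bullet> v" if "v \<bullet> e = 0" "v \<bullet> g = 0" for z v
    using that by (simp add: T_def inner_add_left inner_commute[of e v] inner_commute[of g v])
  ultimately show thesis
    by (intro that[of T]) (use assms ge in \<open>simp_all add: T_def A_def B_def inner_add_left algebra_simps\<close>)
qed

lemma integrable_sphere_measure_continuous:
  fixes f :: "'a::euclidean_space \<Rightarrow> real"
  assumes "continuous_on UNIV f"
  shows "integrable sphere_measure f"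
proof -
  have "bounded (f ` sphere 0 1)"
    by (intro compact_imp_bounded compact_continuous_image continuous_on_subset[OF assms]) auto
  then obtain B where "\<And>z. norm z = 1 \<Longrightarrow> \<bar>f z\<bar> \<le> B" unfolding bounded_iff by fastforce
  then show ?thesis
    by (intro integrable_sphere_measure[of _ B] sphere_measure_measurable borel_measurable_continuous_onI assms)
qed

text \<open>Rotation by the angle \<open>t\<close> in the plane of \<open>e\<close> and
  \<open>g\<close> leaves the integral of a monomial unchanged; the identity is the vanishing of its
  derivative at \<open>t = 0\<close>. For \<open>a = 0\<close> or \<open>b = 0\<close> the truncated
  exponent is multiplied by zero.\<close>

lemma sphere_moment_rotation:
  fixes e g v :: "'a::euclidean_space"
  assumes e: "e \<bullet> e = 1" and g: "g \<bullet> g = 1" and eg: "e \<bullet> g = 0" and v: "v \<bullet> e = 0" "v \<bullet> g = 0"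
  shows "a * (\<integral>z. (z \<bullet> e) ^ (a - 1) * (z \<bullet> g) ^ (b + 1) * (z \<bullet> v) ^ k \<partial>sphere_measure)
       = b * (\<integral>z. (z \<bullet> e) ^ (a + 1) * (z \<bullet> g) ^ (b - 1) * (z \<bullet> v) ^ k \<partial>sphere_measure)"
proof -
  define X where "X t z = cos t * (z \<bullet> e) - sin t * (z \<bullet> g)" for t and z :: 'a
  define Y where "Y t z = sin t * (z \<bullet> e) + cos t * (z \<bullet> g)" for t and z :: 'a
  define p where "p t z = X t z ^ a * Y t z ^ b * (z \<bullet> v) ^ k" for t and z :: 'a
  define G where "G t z = (b * X t z ^ (a + 1) * Y t z ^ (b - 1) - a * X t z ^ (a - 1) * Y t z ^ (b + 1)) * (z \<bullet> v) ^ k" for t and z :: 'a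
  have contG0: "continuous_on UNIV (G t)" and contp: "continuous_on UNIV (p t)" for t
    unfolding G_def p_def X_def Y_def by (intro continuous_intros)+
  have const: "(\<integral>z. p t z \<partial>sphere_measure) = (\<integral>z. p 0 z \<partial>sphere_measure)" for t
  proof -
    obtain T where T: "orthogonal_transformation T"
      "\<And>z. T z \<bullet> e = X t z" "\<And>z. T z \<bullet> g = Y t z"
      "\<And>z v. v \<bullet> e = 0 \<Longrightarrow> v \<bullet> g = 0 \<Longrightarrow> T z \<bullet> v = z \<bullet> v"
      using orthogonal_transformation_planar_rotation[OF e g eg, of t] unfolding X_def Y_def by metis
    have "p t z = p 0 (T z)" for z
      using T(4)[OF v] by (simp add: p_def X_def[of 0] Y_def[of 0] T(2,3))
    then show ?thesis
      using integral_sphere_measure_orthogonal_transformation[OF T(1), of "p 0"]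
      by (simp add: borel_measurable_continuous_onI[OF contp])
  qed
  have der: "((\<lambda>t. p t z) has_derivative (\<lambda>h. G t z \<bullet> h)) (at t)" for t z
  proof -
    have "((\<lambda>t. X t z) has_real_derivative - Y t z) (at t)" "((\<lambda>t. Y t z) has_real_derivative X t z) (at t)"
      unfolding X_def Y_def by (auto intro!: derivative_eq_intros simp: algebra_simps)
    then have "((\<lambda>t. X t z ^ a * Y t z ^ b * (z \<bullet> v) ^ k) has_real_derivative G t z) (at t)"
      by (auto intro!: derivative_eq_intros simp: G_def algebra_simps)
    then show ?thesis by (simp add: p_def has_field_derivative_def mult_commute_abs)
  qed
  have contG: "continuous_on A (\<lambda>p. G (fst p) (snd p))" for A
    unfolding G_def X_def Y_def by (intro continuous_intros)
  have "bounded ((\<lambda>p. G (fst p) (snd p)) ` (cball 0 1 \<times> sphere 0 1))"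
    by (intro compact_imp_bounded compact_continuous_image compact_Times contG) auto
  then obtain B where B: "\<And>t z. \<bar>t\<bar> \<le> 1 \<Longrightarrow> norm z = 1 \<Longrightarrow> \<bar>G t z\<bar> \<le> B"
    unfolding bounded_iff by fastforce
  have "((\<lambda>t. \<integral>z. p t z \<partial>sphere_measure) has_derivative (\<lambda>h. \<integral>z. G 0 z \<bullet> h \<partial>sphere_measure)) (at 0)"
    by (rule has_derivative_integral_bounded_gradient[OF finite_sphere_measure, where U="ball 0 1" and B=B])
       (use der B in \<open>auto intro!: integrable_sphere_measure_continuous contp sphere_measure_measurable borel_measurable_continuous_onI contG0\<close>)
  moreover have "(\<lambda>t. \<integral>z. p t z \<partial>sphere_measure) = (\<lambda>t. \<integral>z. p 0 z \<partial>sphere_measure)"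
    by (rule ext) (rule const)
  then have "((\<lambda>t. \<integral>z. p t z \<partial>sphere_measure) has_derivative (\<lambda>h. 0)) (at 0)"
    by (simp only: has_derivative_const)
  ultimately have "(\<integral>z. G 0 z \<bullet> 1 \<partial>sphere_measure) = 0"
    by (metis has_derivative_unique)
  then have "0 = (\<integral>z. b * ((z \<bullet> e) ^ (a + 1) * (z \<bullet> g) ^ (b - 1) * (z \<bullet> v) ^ k)
      - a * ((z \<bullet> e) ^ (a - 1) * (z \<bullet> g) ^ (b + 1) * (z \<bullet> v) ^ k) \<partial>sphere_measure)"
    by (simp add: G_def X_def Y_def algebra_simps)
  also have "\<dots> = (\<integral>z. b * ((z \<bullet> e) ^ (a + 1) * (z \<bullet> g) ^ (b - 1) * (z \<bullet> v) ^ k) \<partial>sphere_measure)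
      - (\<integral>z. a * ((z \<bullet> e) ^ (a - 1) * (z \<bullet> g) ^ (b + 1) * (z \<bullet> v) ^ k) \<partial>sphere_measure)"
    by (intro Bochner_Integration.integral_diff integrable_sphere_measure_continuous continuous_intros)
  finally show ?thesis by simp
qed

definition sphere_moment :: "'a::euclidean_space \<Rightarrow> 'a \<Rightarrow> nat \<Rightarrow> nat \<Rightarrow> real" where
  "sphere_moment e f i j = (\<integral>z. (z \<bullet> e) ^ i * (z \<bullet> f) ^ j \<partial>sphere_measure)"

lemma sphere_moment_commute: "sphere_moment e f i j = sphere_moment f e j i"
  by (simp add: sphere_moment_def mult.commute)

text \<open>The factor 1 = |z|^2 is split into (z . e)^2, (z . f)^2 and the squares of coordinates
  orthogonal to both. Infinitesimal rotation converts every resulting moment into a multiple of the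
  moment with exponents \<open>i + 2\<close> and \<open>j\<close>.\<close>

lemma sphere_moment_rec:
  fixes e f :: "'a::euclidean_space"
  assumes e: "e \<bullet> e = 1" and f: "f \<bullet> f = 1" and ef: "e \<bullet> f = 0"
  shows "(i + j + DIM('a)) * sphere_moment e f (i + 2) j = (i + 1) * sphere_moment e f i j"
proof -
  have fe: "f \<bullet> e = 0" using ef by (simp add: inner_commute)
  let ?I = "\<lambda>F::'a \<Rightarrow> real. \<integral>z. F z \<partial>sphere_measure"
  have 1: "(i + 1) * sphere_moment e f i (j + 2) = (j + 1) * sphere_moment e f (i + 2) j"
    using sphere_moment_rotation[OF e f ef, of 0 "i + 1" "j + 1" 0] by (simp add: sphere_moment_def)
  \<comment> \<open>For a unit vector \<open>g\<close> along \<open>v\<close>, rotation in the plane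
    of \<open>e\<close> and \<open>g\<close> trades (z . g)^2 for (z . e)^2; scaling contributes
    \<open>v \<bullet> v\<close>.\<close>
  have unit: "(i + 1) * ?I (\<lambda>z. (z \<bullet> e) ^ i * (z \<bullet> f) ^ j * (z \<bullet> v)\<^sup>2) = (v \<bullet> v) * sphere_moment e f (i + 2) j"
    if v: "v \<bullet> e = 0" "v \<bullet> f = 0" for v
  proof (cases "v = 0")
    case False
    define g where "g = sgn v"
    have g: "g \<bullet> g = 1" "e \<bullet> g = 0" "f \<bullet> g = 0" 
      using False v by (auto simp: g_def sgn_div_norm inner_commute power2_norm_eq_inner[symmetric] power2_eq_square)
    have vg: "(z \<bullet> v)\<^sup>2 = (v \<bullet> v) * (z \<bullet> g)\<^sup>2" for z
      using False by (simp add: g_def sgn_div_norm power_mult_distrib power2_norm_eq_inner[symmetric] field_simps)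
    have "(i + 1) * ?I (\<lambda>z. (z \<bullet> e) ^ i * (z \<bullet> g)\<^sup>2 * (z \<bullet> f) ^ j) = sphere_moment e f (i + 2) j"
      using sphere_moment_rotation[OF e g(1) g(2) fe g(3), of "i + 1" 1 j] by (simp add: sphere_moment_def power2_eq_square)
    moreover have "(\<lambda>z. (z \<bullet> e) ^ i * (z \<bullet> f) ^ j * (z \<bullet> v)\<^sup>2) = (\<lambda>z. (v \<bullet> v) * ((z \<bullet> e) ^ i * (z \<bullet> g)\<^sup>2 * (z \<bullet> f) ^ j))"
      unfolding vg by (simp add: fun_eq_iff mult_ac)
    ultimately show ?thesis by simp
  qed simp
  \<comment> \<open>Projections of the standard basis onto the complement of \<open>e\<close> and
    \<open>f\<close>. They replace an orthonormal basis there: the squares of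
    \<open>z \<bullet> w b\<close> add up to the squared length of the projection of
    \<open>z\<close>, and the squared lengths of all \<open>w b\<close> to n - 2.\<close>
  define w where "w b = b - (b \<bullet> e) *\<^sub>R e - (b \<bullet> f) *\<^sub>R f" for b
  have wort: "w b \<bullet> e = 0" "w b \<bullet> f = 0" for b
    using e f ef fe by (simp_all add: w_def inner_diff_left)
  have ww: "(\<Sum>b\<in>Basis. w b \<bullet> w b) = real DIM('a) - 2"
  proof -
    have "w b \<bullet> w b = 1 - (e \<bullet> b) * (e \<bullet> b) - (f \<bullet> b) * (f \<bullet> b)" if "b \<in> Basis" for b
      using that e f ef fe by (simp add: w_def inner_diff_left inner_diff_right inner_commute[of b e] inner_commute[of b f])
    then have "(\<Sum>b\<in>Basis. w b \<bullet> w b) = (\<Sum>b\<in>Basis. 1 - (e \<bullet> b) * (e \<bullet> b) - (f \<bullet> b) * (f \<bullet> b))"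
      by (rule sum.cong[OF refl])
    also have "\<dots> = real DIM('a) - e \<bullet> e - f \<bullet> f"
      by (simp only: sum_subtractf euclidean_inner[symmetric]) simp
    finally show ?thesis using e f by simp
  qed
  have zz: "(\<Sum>b\<in>Basis. (z \<bullet> w b)\<^sup>2) = z \<bullet> z - (z \<bullet> e)\<^sup>2 - (z \<bullet> f)\<^sup>2" for z
  proof -
    define z' where "z' = z - (z \<bullet> e) *\<^sub>R e - (z \<bullet> f) *\<^sub>R f"
    have "z \<bullet> w b = z' \<bullet> b" for b
      by (simp add: w_def z'_def inner_diff_left inner_diff_right inner_commute[of b e] inner_commute[of b f])
    then have "(\<Sum>b\<in>Basis. (z \<bullet> w b)\<^sup>2) = z' \<bullet> z'"
      by (simp add: power2_eq_square euclidean_inner[symmetric])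
    also have "\<dots> = z \<bullet> z - (z \<bullet> e)\<^sup>2 - (z \<bullet> f)\<^sup>2"
      using e f ef fe by (simp add: z'_def inner_diff_left inner_diff_right inner_commute[of e z] inner_commute[of f z] power2_eq_square)
    finally show ?thesis .
  qed
  have "sphere_moment e f i j = ?I (\<lambda>z. (z \<bullet> e) ^ (i + 2) * (z \<bullet> f) ^ j + (z \<bullet> e) ^ i * (z \<bullet> f) ^ (j + 2)
      + (\<Sum>b\<in>Basis. (z \<bullet> e) ^ i * (z \<bullet> f) ^ j * (z \<bullet> w b)\<^sup>2))"
    unfolding sphere_moment_def
  proof (rule Bochner_Integration.integral_cong[OF refl])
    fix z :: 'a assume "z \<in> space sphere_measure"
    then have "z \<bullet> z = 1" by (simp add: norm_eq_1)
    then show "(z \<bullet> e) ^ i * (z \<bullet> f) ^ j = (z \<bullet> e) ^ (i + 2) * (z \<bullet> f) ^ j + (z \<bullet> e) ^ i * (z \<bullet> f) ^ (j + 2)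
      + (\<Sum>b\<in>Basis. (z \<bullet> e) ^ i * (z \<bullet> f) ^ j * (z \<bullet> w b)\<^sup>2)"
      unfolding sum_distrib_left[symmetric] zz by (simp add: power_add power2_eq_square algebra_simps)
  qed
  also have "\<dots> = sphere_moment e f (i + 2) j + sphere_moment e f i (j + 2)
      + (\<Sum>b\<in>Basis. ?I (\<lambda>z. (z \<bullet> e) ^ i * (z \<bullet> f) ^ j * (z \<bullet> w b)\<^sup>2))"
    unfolding sphere_moment_def
    by (subst Bochner_Integration.integral_add,
        intro integrable_sphere_measure_continuous continuous_intros,
        intro integrable_sphere_measure_continuous continuous_intros)+
       (simp, intro Bochner_Integration.integral_sum integrable_sphere_measure_continuous continuous_intros)
  finally have "(i + 1) * sphere_moment e f i j = (i + 1) * sphere_moment e f (i + 2) j + (i + 1) * sphere_moment e f i (j + 2)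
      + (\<Sum>b\<in>Basis. (i + 1) * ?I (\<lambda>z. (z \<bullet> e) ^ i * (z \<bullet> f) ^ j * (z \<bullet> w b)\<^sup>2))"
    by (simp add: distrib_left sum_distrib_left)
  also have "\<dots> = (i + 1) * sphere_moment e f (i + 2) j + (j + 1) * sphere_moment e f (i + 2) j
      + (real DIM('a) - 2) * sphere_moment e f (i + 2) j"
    unfolding 1 unit[OF wort] by (simp add: sum_distrib_right[symmetric] ww)
  finally show ?thesis by (simp add: algebra_simps)
qed

text \<open>The rotation identity with exponent 0 at \<open>e\<close>: one side has the factor 0,
  the other is a positive multiple of this moment.\<close>

lemma sphere_moment_1:
  fixes e f :: "'a::euclidean_space"
  assumes "e \<bullet> e = 1" "f \<bullet> f = 1" "e \<bullet> f = 0"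
  shows "sphere_moment e f 1 j = 0"
  using sphere_moment_rotation[OF assms, of 0 0 "j + 1" 0] by (simp add: sphere_moment_def)

lemma sphere_moment_0 [simp]: "sphere_moment e (f::'a::euclidean_space) 0 0 = 1"
  by (simp add: sphere_moment_def)

text \<open>The factor \<open>i + j + n\<close> is positive, so the recursions lower either exponent
  by two until the pair (0, 0) or an exponent 1 is reached.\<close>

lemma planar_moments_unique:
  fixes s t :: "nat \<Rightarrow> nat \<Rightarrow> real" and n :: nat
  assumes "n > 0" and st0: "s 0 0 = t 0 0"
    and odd: "\<And>j. s 1 j = 0" "\<And>i. s i 1 = 0" "\<And>j. t 1 j = 0" "\<And>i. t i 1 = 0"
    and recs: "\<And>i j. (i + j + n) * s (i + 2) j = (i + 1) * s i j" "\<And>i j. (i + j + n) * s i (j + 2) = (j + 1) * s i j"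
    and rect: "\<And>i j. (i + j + n) * t (i + 2) j = (i + 1) * t i j" "\<And>i j. (i + j + n) * t i (j + 2) = (j + 1) * t i j"
  shows "s i j = t i j"
proof (induction "i + j" arbitrary: i j rule: less_induct)
  case less
  have nz: "real (a + b + n) \<noteq> 0" for a b using \<open>n > 0\<close> by simp
  consider "i = 0" "j = 0" | "i = 1" | "j = 1" | k where "i = k + 2" | k where "j = k + 2"
    by (metis One_nat_def Suc_1 add_2_eq_Suc' not0_implies_Suc)
  then show ?case
  proof cases
    case (4 k)
    with less[of k j] recs(1)[of k j] rect(1)[of k j] nz[of k j] show ?thesis by (metis add_less_mono1 less_add_same_cancel1 mult_cancel_left zero_less_numeral)
  next
    case (5 k)
    with less[of i k] recs(2)[of i k] rect(2)[of i k] nz[of i k] show ?thesis by (metis add_less_cancel_left less_add_same_cancel1 mult_cancel_left zero_less_numeral)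
  qed (use st0 odd in auto)
qed

section \<open>Jacobi weights on the interval and their moments\<close>

lemma nn_integral_substitution_Icc:
  fixes f :: "real \<Rightarrow> real"
  assumes "f \<in> borel_measurable borel"
    and "\<And>x. x \<in> {a..b} \<Longrightarrow> (g has_real_derivative g' x) (at x)"
    and "continuous_on {a..b} g'" and "\<And>x. x \<in> {a..b} \<Longrightarrow> 0 \<le> g' x" and "a \<le> b"
  shows "(\<integral>\<^sup>+x. ennreal (f x) * indicator {g a..g b} x \<partial>lborel)
       = (\<integral>\<^sup>+x. ennreal (f (g x) * g' x) * indicator {a..b} x \<partial>lborel)"
proof -
  have "(\<integral>\<^sup>+x. ennreal (f x * indicator {g a..g b} x) \<partial>lborel)
      = (\<integral>\<^sup>+x. ennreal (f (g x) * g' x * indicator {a..b} x) \<partial>lborel)"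
    by (rule nn_integral_substitution) (use assms in \<open>auto simp: set_borel_measurable_def\<close>)
  then show ?thesis by (simp add: ennreal_mult'' ennreal_indicator)
qed

text \<open>The symmetric Jacobi (Gegenbauer) weight, left unnormalised; it is finite for
  \<open>\<beta> > -1\<close>, even when unbounded at the endpoints.\<close>

definition jacobi_measure :: "real \<Rightarrow> real measure" where
  "jacobi_measure \<beta> = density lborel (\<lambda>t. ennreal (indicator {-1..1} t * (1 - t\<^sup>2) powr \<beta>))"

lemma space_jacobi_measure [simp]: "space (jacobi_measure \<beta>) = UNIV"
  by (simp add: jacobi_measure_def)

lemma sets_jacobi_measure [simp, measurable_cong]: "sets (jacobi_measure \<beta>) = sets borel"
  by (simp add: jacobi_measure_def)

text \<open>The substitution of \<open>x\<^sup>2\<close> in the Beta integral gives twice the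
  integral over [0, 1], and evenness of the weight moves one copy to [-1, 0].\<close>

lemma emeasure_jacobi_measure:
  assumes "\<beta> > -1"
  shows "emeasure (jacobi_measure \<beta>) UNIV = ennreal (Beta (1/2) (\<beta> + 1))"
proof -
  let ?w = "\<lambda>x::real. (1 - x\<^sup>2) powr \<beta>"
  have "((\<lambda>t. t powr (-1/2) * (1 - t) powr \<beta>) has_integral Beta (1/2) (\<beta> + 1)) {0..1}"
    using has_integral_Beta_real[of "1/2" "\<beta> + 1"] assms by simp
  from nn_integral_has_integral_lebesgue[OF _ this]
  have "ennreal (Beta (1/2) (\<beta> + 1)) = (\<integral>\<^sup>+t. ennreal (t powr (-1/2) * (1 - t) powr \<beta>) * indicator {0\<^sup>2..1\<^sup>2} t \<partial>lborel)"
    by (simp add: mult_ac ennreal_mult' ennreal_indicator)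
  also have "\<dots> = (\<integral>\<^sup>+x. ennreal (x\<^sup>2 powr (-1/2) * (1 - x\<^sup>2) powr \<beta> * (2 * x)) * indicator {0..1} x \<partial>lborel)"
    by (rule nn_integral_substitution_Icc) (auto intro!: derivative_eq_intros continuous_intros)
  \<comment> \<open>\<open>x\<^sup>2 powr (-1/2)\<close> cancels the Jacobian \<open>2 * x\<close>
    up to the factor 2, except at the null point 0.\<close>
  also have "\<dots> = (\<integral>\<^sup>+x. 2 * (ennreal (?w x) * indicator {0..1} x) \<partial>lborel)"
    by (intro nn_integral_cong_AE AE_I[of _ _ "{0}"])
       (auto simp: indicator_def powr_minus powr_half_sqrt field_split_simps ennreal_mult')
  also have "\<dots> = (\<integral>\<^sup>+x. ennreal (?w x) * indicator {0..1} x \<partial>lborel) + (\<integral>\<^sup>+x. ennreal (?w x) * indicator {0..1} x \<partial>lborel)"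
    by (simp only: mult_2, rule nn_integral_add) auto
  also have "(\<integral>\<^sup>+x. ennreal (?w x) * indicator {0..1} x \<partial>lborel) + (\<integral>\<^sup>+x. ennreal (?w x) * indicator {0..1} x \<partial>lborel)
      = (\<integral>\<^sup>+x. ennreal (?w x) * indicator {-1..0} x \<partial>lborel) + (\<integral>\<^sup>+x. ennreal (?w x) * indicator {0..1} x \<partial>lborel)"
    by (subst nn_integral_real_affine[of _ "-1" 0]) (auto simp: indicator_def intro!: arg_cong2[where f="(+)"] nn_integral_cong)
  also have "\<dots> = (\<integral>\<^sup>+x. ennreal (?w x) * indicator {-1..0} x + ennreal (?w x) * indicator {0..1} x \<partial>lborel)"
    by (rule nn_integral_add[symmetric]) auto
  also have "\<dots> = (\<integral>\<^sup>+x. ennreal (indicator {-1..1} x * ?w x) \<partial>lborel)"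
    by (intro nn_integral_cong_AE AE_I[of _ _ "{0}"]) (auto simp: indicator_def)
  also have "\<dots> = emeasure (jacobi_measure \<beta>) UNIV"
    by (simp add: jacobi_measure_def emeasure_density)
  finally show ?thesis ..
qed

lemma finite_jacobi_measure: "\<beta> > -1 \<Longrightarrow> finite_measure (jacobi_measure \<beta>)"
  by standard (simp add: emeasure_jacobi_measure)

lemma measure_jacobi_measure: "\<beta> > -1 \<Longrightarrow> measure (jacobi_measure \<beta>) UNIV = Beta (1/2) (\<beta> + 1)"
  by (simp add: measure_def emeasure_jacobi_measure Beta_def Gamma_real_pos less_imp_le)

lemma AE_jacobi_measure: "AE t in jacobi_measure \<beta>. \<bar>t\<bar> < 1"
proof -
  have "AE t::real in lborel. t \<notin> {-1, 1}"
    by (rule AE_I[of _ _ "{-1, 1}"]) (auto simp: emeasure_lborel_countable)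
  then show ?thesis
    unfolding jacobi_measure_def by (subst AE_density) (auto elim!: eventually_mono simp: abs_less_iff order_less_le power2_eq_1_iff split: split_indicator_asm)
qed

lemma integrable_jacobi_measure:
  fixes f :: "real \<Rightarrow> real"
  assumes "\<beta> > -1" "f \<in> borel_measurable borel" "\<And>t. \<bar>t\<bar> < 1 \<Longrightarrow> \<bar>f t\<bar> \<le> B"
  shows "integrable (jacobi_measure \<beta>) f"
  by (rule finite_measure.integrable_const_bound[OF finite_jacobi_measure, of _ _ B])
     (use assms AE_jacobi_measure[of \<beta>] in \<open>auto elim!: eventually_mono simp: measurable_cong_sets[OF sets_jacobi_measure refl]\<close>)

lemma integral_jacobi_measure:
  fixes f :: "real \<Rightarrow> real"
  assumes "f \<in> borel_measurable borel"
  shows "(\<integral>t. f t \<partial>jacobi_measure \<beta>) = (\<integral>t. indicator {-1..1} t * (1 - t\<^sup>2) powr \<beta> * f t \<partial>lborel)"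
    and "integrable (jacobi_measure \<beta>) f \<longleftrightarrow> integrable lborel (\<lambda>t. indicator {-1..1} t * (1 - t\<^sup>2) powr \<beta> * f t)"
  unfolding jacobi_measure_def using assms
  by (simp_all add: integral_density integrable_density)

lemma integrable_jacobi_power [simp]: "\<beta> > -1 \<Longrightarrow> integrable (jacobi_measure \<beta>) (\<lambda>t. t ^ k)"
  by (rule integrable_jacobi_measure[of _ _ 1]) (auto simp: power_abs power_le_one)

text \<open>The integrand times the weight is the derivative of t^m (1 - t^2)^(\<beta> + 1), which
  vanishes at both endpoints because \<beta> + 1 > 0.\<close>

lemma jacobi_parts:
  assumes \<beta>: "\<beta> > -1"
  shows "(\<integral>t. m * t ^ (m - 1) * (1 - t\<^sup>2) - 2 * (\<beta> + 1) * t ^ (m + 1) \<partial>jacobi_measure \<beta>) = 0"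
proof -
  let ?h = "\<lambda>t::real. m * t ^ (m - 1) * (1 - t\<^sup>2) - 2 * (\<beta> + 1) * t ^ (m + 1)"
  let ?F = "\<lambda>t::real. t ^ m * (1 - t\<^sup>2) powr (\<beta> + 1)"
  have sq: "t\<^sup>2 \<le> 1" if "t \<in> {-1..1}" for t :: real using that by (simp add: abs_square_le_1 abs_le_iff)
  have "((\<lambda>t. (1 - t\<^sup>2) powr \<beta> * ?h t) has_integral ?F 1 - ?F (-1)) {-1..1}"
  proof (rule fundamental_theorem_of_calculus_interior)
    show "continuous_on {-1..1} ?F"
      using \<beta> sq by (intro continuous_intros continuous_on_powr') auto
    fix t :: real assume "t \<in> {-1<..<1}"
    then have pos: "1 - t\<^sup>2 > 0" by (simp add: abs_square_less_1 abs_less_iff)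
    have "(?F has_real_derivative (1 - t\<^sup>2) powr \<beta> * ?h t) (at t)"
    proof -
      have p1: "(1 - t\<^sup>2) powr (\<beta> + 1) = (1 - t\<^sup>2) powr \<beta> * (1 - t\<^sup>2)" using pos by (simp add: powr_add)
      have d1: "((\<lambda>t. t ^ m) has_real_derivative m * t ^ (m - 1)) (at t)"
        using DERIV_pow[of m t] by simp
      have d2: "((\<lambda>t. (1 - t\<^sup>2) powr (\<beta> + 1)) has_real_derivative (\<beta> + 1) * (1 - t\<^sup>2) powr \<beta> * (- 2 * t)) (at t)"
        using pos by (auto intro!: derivative_eq_intros)
      show ?thesis
        by (rule DERIV_cong[OF DERIV_mult[OF d1 d2]]) (simp only: p1, simp add: algebra_simps)
    qed
    then show "(?F has_vector_derivative (1 - t\<^sup>2) powr \<beta> * ?h t) (at t)"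
      by (simp add: has_real_derivative_iff_has_vector_derivative)
  qed auto
  then have FTC: "((\<lambda>t. (1 - t\<^sup>2) powr \<beta> * ?h t) has_integral 0) {-1..1}" by simp
  have "continuous_on {-1..1} ?h" by (intro continuous_intros)
  then have "bounded (?h ` {-1..1})" by (intro compact_imp_bounded compact_continuous_image) auto
  then obtain B where B: "\<And>t. t \<in> {-1..1} \<Longrightarrow> \<bar>?h t\<bar> \<le> B" unfolding bounded_iff by fastforce
  have "integrable (jacobi_measure \<beta>) ?h"
    by (rule integrable_jacobi_measure[OF \<beta>, of _ B]) (use B in \<open>auto simp: abs_less_iff\<close>)
  then have int: "integrable lborel (\<lambda>t. indicator {-1..1} t * (1 - t\<^sup>2) powr \<beta> * ?h t)"
    by (subst (asm) integral_jacobi_measure(2)) auto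
  have "((\<lambda>t. indicator {-1..1} t * (1 - t\<^sup>2) powr \<beta> * ?h t) has_integral
      (\<integral>t. indicator {-1..1} t * (1 - t\<^sup>2) powr \<beta> * ?h t \<partial>lborel)) UNIV"
    by (rule has_integral_integral_lborel[OF int])
  moreover have "(\<lambda>t. indicator {-1..1} t * (1 - t\<^sup>2) powr \<beta> * ?h t) = (\<lambda>t. if t \<in> {-1..1} then (1 - t\<^sup>2) powr \<beta> * ?h t else 0)"
    by (auto simp: fun_eq_iff indicator_def)
  ultimately have "((\<lambda>t. (1 - t\<^sup>2) powr \<beta> * ?h t) has_integral
      (\<integral>t. indicator {-1..1} t * (1 - t\<^sup>2) powr \<beta> * ?h t \<partial>lborel)) {-1..1}"
    by (simp only: has_integral_restrict_UNIV)
  from has_integral_unique[OF this FTC] show ?thesis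
    by (subst integral_jacobi_measure(1)) auto
qed

definition jacobi_moment :: "real \<Rightarrow> nat \<Rightarrow> real" where
  "jacobi_moment \<beta> k = (\<integral>t. t ^ k \<partial>jacobi_measure \<beta>)"

lemma jacobi_moment_rec:
  assumes "\<beta> > -1"
  shows "(k + 2 * \<beta> + 3) * jacobi_moment \<beta> (k + 2) = (k + 1) * jacobi_moment \<beta> k"
proof -
  have "(\<integral>t. (k + 1) * t ^ k - (k + 2 * \<beta> + 3) * t ^ (k + 2) \<partial>jacobi_measure \<beta>) = 0"
    using jacobi_parts[OF assms, of "k + 1"] by (simp add: algebra_simps power2_eq_square)
  moreover have "(\<integral>t. (k + 1) * t ^ k - (k + 2 * \<beta> + 3) * t ^ (k + 2) \<partial>jacobi_measure \<beta>)
      = (k + 1) * jacobi_moment \<beta> k - (k + 2 * \<beta> + 3) * jacobi_moment \<beta> (k + 2)"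
    unfolding jacobi_moment_def using assms
    by (subst Bochner_Integration.integral_diff) (auto simp del: power_Suc simp add: add_2_eq_Suc' power_Suc[symmetric])
  ultimately have "(k + 1) * jacobi_moment \<beta> k - (k + 2 * \<beta> + 3) * jacobi_moment \<beta> (k + 2) = 0" by metis
  then show ?thesis by (simp add: add.commute)
qed

lemma jacobi_moment_1: "\<beta> > -1 \<Longrightarrow> jacobi_moment \<beta> 1 = 0"
  using jacobi_parts[of \<beta> 0] by (simp add: jacobi_moment_def)

lemma integral_jacobi_sqrt_power:
  "(\<integral>t. t ^ i * sqrt (1 - t\<^sup>2) ^ j \<partial>jacobi_measure \<beta>) = jacobi_moment (\<beta> + j / 2) i"
proof -
  have eq: "indicator {-1..1} t * (1 - t\<^sup>2) powr \<beta> * (t ^ i * sqrt (1 - t\<^sup>2) ^ j)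
      = indicator {-1..1} t * (1 - t\<^sup>2) powr (\<beta> + j / 2) * t ^ i" for t :: real
  proof (cases "\<bar>t\<bar> < 1")
    case True
    then have pos: "1 - t\<^sup>2 > 0" by (simp add: abs_square_less_1)
    have "sqrt (1 - t\<^sup>2) ^ j = (1 - t\<^sup>2) powr (j / 2)"
      using pos by (simp add: powr_half_sqrt[symmetric] powr_powr powr_realpow[symmetric])
    then show ?thesis by (simp add: powr_add)
  next
    \<comment> \<open>At the endpoints both sides are 0, as \<open>0 powr x = 0\<close> for every
      exponent \<open>x\<close>; outside, the indicator vanishes.\<close>
    case False
    then show ?thesis by (cases "\<bar>t\<bar> = 1") (auto simp: indicator_def abs_le_iff abs_if split: if_splits)
  qed
  have meas: "(\<lambda>t. t ^ i * sqrt (1 - t\<^sup>2) ^ j) \<in> borel_measurable borel" "(\<lambda>t::real. t ^ i) \<in> borel_measurable borel"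
    by measurable
  show ?thesis
    unfolding jacobi_moment_def integral_jacobi_measure(1)[OF meas(1)] integral_jacobi_measure(1)[OF meas(2)] eq ..
qed

text \<open>Raising the exponent of the weight by one inserts the factor 1 - t^2, so the new moment
  is a difference of two old ones, related by \<open>jacobi_moment_rec\<close>.\<close>

lemma jacobi_moment_shift:
  assumes "\<beta> > -1"
  shows "(i + 2 * \<beta> + 3) * jacobi_moment (\<beta> + 1) i = (2 * \<beta> + 2) * jacobi_moment \<beta> i"
proof -
  have "jacobi_moment (\<beta> + 1) i = (\<integral>t. t ^ i * sqrt (1 - t\<^sup>2) ^ 2 \<partial>jacobi_measure \<beta>)"
    by (simp only: integral_jacobi_sqrt_power) simp
  also have "\<dots> = (\<integral>t. t ^ i - t ^ (i + 2) \<partial>jacobi_measure \<beta>)"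
  proof (rule integral_cong_AE)
    show "AE t in jacobi_measure \<beta>. t ^ i * sqrt (1 - t\<^sup>2) ^ 2 = t ^ i - t ^ (i + 2)"
      using AE_jacobi_measure[of \<beta>]
    proof eventually_elim
      case (elim t)
      then have "0 \<le> 1 - t\<^sup>2" by (simp add: abs_square_less_1 less_imp_le)
      then show ?case by (simp add: algebra_simps power2_eq_square)
    qed
  qed auto
  also have "\<dots> = jacobi_moment \<beta> i - jacobi_moment \<beta> (i + 2)"
    unfolding jacobi_moment_def using assms
    by (subst Bochner_Integration.integral_diff) (auto simp del: power_Suc simp add: add_2_eq_Suc' power_Suc[symmetric])
  finally show ?thesis
    by (simp only: right_diff_distrib jacobi_moment_rec[OF assms]) (simp add: algebra_simps)
qed

section \<open>Planar integrals against polynomials and continuous functions\<close>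

text \<open>Polynomials in two variables as sums of monomials, so that induction reduces an integral
  identity to moments.\<close>

inductive bipolynomial :: "(real \<times> real \<Rightarrow> real) \<Rightarrow> bool" where
  monomial: "bipolynomial (\<lambda>z. c * (fst z ^ i * snd z ^ j))"
| add: "bipolynomial p \<Longrightarrow> bipolynomial q \<Longrightarrow> bipolynomial (\<lambda>z. p z + q z)"

lemma bipolynomial_mult:
  assumes "bipolynomial p" "bipolynomial q"
  shows "bipolynomial (\<lambda>z. p z * q z)"
  using assms(1)
proof induction
  case (monomial c i j)
  show ?case
    using assms(2)
  proof induction
    case (monomial d k l)
    have "(\<lambda>z. c * (fst z ^ i * snd z ^ j) * (d * (fst z ^ k * snd z ^ l)))
        = (\<lambda>z::real\<times>real. (c * d) * (fst z ^ (i + k) * snd z ^ (j + l)))"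
      by (simp add: fun_eq_iff power_add mult_ac)
    then show ?case by (simp only: bipolynomial.monomial)
  next
    case (add p q)
    then show ?case by (simp only: distrib_left bipolynomial.add)
  qed
next
  case (add p q)
  then show ?case by (simp only: distrib_right bipolynomial.add)
qed

lemma bipolynomial_real_polynomial_function:
  fixes p :: "real \<times> real \<Rightarrow> real"
  assumes "real_polynomial_function p"
  shows "bipolynomial p"
  using assms
proof induction
  case (linear f)
  interpret bounded_linear f by fact
  have "f z = f (1, 0) * (fst z ^ 1 * snd z ^ 0) + f (0, 1) * (fst z ^ 0 * snd z ^ 1)" for z
  proof -
    have "z = fst z *\<^sub>R (1, 0) + snd z *\<^sub>R (0, 1)" by (simp add: prod_eq_iff)
    then have "f z = f (fst z *\<^sub>R (1, 0) + snd z *\<^sub>R (0, 1))" by simp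
    then show ?thesis by (simp only: add scaleR) simp
  qed
  then have "f = (\<lambda>z. f (1, 0) * (fst z ^ 1 * snd z ^ 0) + f (0, 1) * (fst z ^ 0 * snd z ^ 1))" by (rule ext)
  then show ?case by (elim ssubst) (intro bipolynomial.add bipolynomial.monomial)
next
  case (const c)
  show ?case using bipolynomial.monomial[of c 0 0] by simp
qed (simp_all add: bipolynomial.add bipolynomial_mult)

text \<open>The disc density (1 - a^2 - b^2)^(\<nu> - 1) in the coordinates a = t, b = sqrt(1 - t^2)
  w. The Jacobian sqrt(1 - t^2) raises the first exponent by 1/2, and the measure becomes a
  product.\<close>

abbreviation planar_measure :: "real \<Rightarrow> (real \<times> real) measure" where
  "planar_measure \<nu> \<equiv> jacobi_measure (\<nu> - 1/2) \<Otimes>\<^sub>M jacobi_measure (\<nu> - 1)"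

definition disc_point :: "real \<times> real \<Rightarrow> real \<times> real" where
  "disc_point = (\<lambda>(t, w). (t, sqrt (1 - t\<^sup>2) * w))"

lemma disc_point_measurable [measurable]: "disc_point \<in> borel_measurable borel"
  unfolding disc_point_def borel_prod[symmetric] by measurable

lemma disc_point_box:
  assumes "\<bar>t\<bar> \<le> 1" "\<bar>w\<bar> \<le> 1"
  shows "disc_point (t, w) \<in> cbox (-1, -1) (1, 1)"
proof -
  have "t\<^sup>2 \<le> 1" using assms by (simp add: abs_square_le_1)
  then have "\<bar>sqrt (1 - t\<^sup>2) * w\<bar> \<le> 1 * 1"
    unfolding abs_mult using assms by (intro mult_mono) auto
  then show ?thesis using assms by (simp add: disc_point_def cbox_Pair_eq abs_le_iff)
qed

context
  fixes \<nu> :: real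
  assumes lam: "\<nu> > 0"
begin

interpretation J1: finite_measure "jacobi_measure (\<nu> - 1/2)" by (rule finite_jacobi_measure) (use lam in simp)
interpretation J2: finite_measure "jacobi_measure (\<nu> - 1)" by (rule finite_jacobi_measure) (use lam in simp)
interpretation J: pair_sigma_finite "jacobi_measure (\<nu> - 1/2)" "jacobi_measure (\<nu> - 1)" ..
interpretation JP: finite_measure "planar_measure \<nu>"
  by (rule finite_measure_pair_measure) unfold_locales

lemma sets_planar_measure: "sets (planar_measure \<nu>) = sets borel"
  unfolding borel_prod[symmetric] by (rule sets_pair_measure_cong) simp_all

lemma AE_planar_measure: "AE z in planar_measure \<nu>. disc_point z \<in> cbox (-1, -1) (1, 1)"
proof (rule J.AE_pair_measure)
  show "{z \<in> space (planar_measure \<nu>). disc_point z \<in> cbox (-1, -1) (1, 1)} \<in> sets (planar_measure \<nu>)"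
  proof -
    have "disc_point -` cbox (-1, -1) (1, 1) \<in> sets borel"
      using measurable_sets_borel[OF disc_point_measurable, of "cbox (-1, -1) (1, 1)"] by simp
    moreover have "{z \<in> space (planar_measure \<nu>). disc_point z \<in> cbox (-1, -1) (1, 1)} = disc_point -` cbox (-1, -1) (1, 1)"
      by (auto simp: space_pair_measure)
    ultimately show ?thesis by (simp only: sets_planar_measure)
  qed
  show "AE t in jacobi_measure (\<nu> - 1/2). AE w in jacobi_measure (\<nu> - 1). disc_point (t, w) \<in> cbox (-1, -1) (1, 1)"
    using AE_jacobi_measure
  proof eventually_elim
    case (elim t)
    show ?case
      using AE_jacobi_measure by eventually_elim (rule disc_point_box, use elim in auto)
  qed
qed

lemma integrable_planar_measure:
  assumes "F \<in> borel_measurable borel" "\<And>z. z \<in> cbox (-1, -1) (1, 1) \<Longrightarrow> \<bar>F z\<bar> \<le> B"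
  shows "integrable (planar_measure \<nu>) (\<lambda>z. F (disc_point z) :: real)"
proof (rule JP.integrable_const_bound[of _ B])
  show "AE z in planar_measure \<nu>. norm (F (disc_point z)) \<le> B"
    using AE_planar_measure by eventually_elim (use assms in auto)
  show "(\<lambda>z. F (disc_point z)) \<in> borel_measurable (planar_measure \<nu>)"
    using measurable_compose[OF disc_point_measurable assms(1)]
    by (simp only: measurable_cong_sets[OF sets_planar_measure refl])
qed

lemma integral_planar_monomial:
  "(\<integral>z. fst (disc_point z) ^ i * snd (disc_point z) ^ j \<partial>planar_measure \<nu>)
     = jacobi_moment (\<nu> - 1/2 + j / 2) i * jacobi_moment (\<nu> - 1) j"
proof -
  have "integrable (planar_measure \<nu>) (\<lambda>z. fst (disc_point z) ^ i * snd (disc_point z) ^ j)"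
    by (rule integrable_planar_measure[where F="\<lambda>z. fst z ^ i * snd z ^ j" and B=1])
       (auto simp: borel_prod[symmetric] abs_mult power_abs cbox_Pair_eq abs_le_iff intro!: mult_le_one power_le_one)
  then have "(\<integral>z. fst (disc_point z) ^ i * snd (disc_point z) ^ j \<partial>planar_measure \<nu>)
      = (\<integral>t. (\<integral>w. t ^ i * (sqrt (1 - t\<^sup>2) * w) ^ j \<partial>jacobi_measure (\<nu> - 1)) \<partial>jacobi_measure (\<nu> - 1/2))"
    by (subst J.integral_fst'[symmetric]) (simp_all add: disc_point_def)
  also have "\<dots> = (\<integral>t. (t ^ i * sqrt (1 - t\<^sup>2) ^ j) * jacobi_moment (\<nu> - 1) j \<partial>jacobi_measure (\<nu> - 1/2))"
    by (simp add: jacobi_moment_def power_mult_distrib mult.assoc[symmetric])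
  also have "\<dots> = jacobi_moment (\<nu> - 1/2 + j / 2) i * jacobi_moment (\<nu> - 1) j"
    by (subst integral_mult_left_zero) (simp only: integral_jacobi_sqrt_power)
  finally show ?thesis .
qed

end

text \<open>Total mass of \<open>planar_measure\<close>, the factor relating it to the probability
  measure on the sphere.\<close>

definition planar_mass :: "real \<Rightarrow> real" where
  "planar_mass \<nu> = jacobi_moment (\<nu> - 1/2) 0 * jacobi_moment (\<nu> - 1) 0"

lemma jacobi_moment_0: "\<beta> > -1 \<Longrightarrow> jacobi_moment \<beta> 0 = Beta (1/2) (\<beta> + 1)"
  by (simp add: jacobi_moment_def measure_jacobi_measure)

lemma jacobi_moment_0_pos: "\<beta> > -1 \<Longrightarrow> jacobi_moment \<beta> 0 > 0"
  by (simp add: jacobi_moment_0 Beta_def Gamma_real_pos)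

lemma planar_mass_pos: "\<nu> > 0 \<Longrightarrow> planar_mass \<nu> > 0"
  by (simp add: planar_mass_def jacobi_moment_0_pos)

context
  fixes e f :: "'a::euclidean_space" and \<nu> :: real
  assumes ef: "e \<bullet> e = 1" "f \<bullet> f = 1" "e \<bullet> f = 0" and lam: "\<nu> > 0" and dim: "real DIM('a) = 2 * \<nu> + 2"
begin

text \<open>In the coordinates \<open>z \<bullet> e = t\<close>, \<open>z \<bullet> f = sqrt (1 - t\<^sup>2) * w\<close> the sphere measure has density proportional to
  \<open>(1 - t\<^sup>2) powr (\<nu> - 1/2) * (1 - w\<^sup>2) powr (\<nu> - 1)\<close>, because both sides have moments with the same recursion.\<close>

lemma sphere_moment_eq_planar:
  "planar_mass \<nu> * sphere_moment e f i j = jacobi_moment (\<nu> - 1/2 + j / 2) i * jacobi_moment (\<nu> - 1) j"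
proof -
  have fe: "f \<bullet> e = 0" using ef by (simp add: inner_commute)
  let ?t = "\<lambda>i j::nat. jacobi_moment (\<nu> - 1/2 + j / 2) i * jacobi_moment (\<nu> - 1) j"
  show ?thesis
  proof (rule planar_moments_unique[where n="DIM('a)" and s="\<lambda>i j. planar_mass \<nu> * sphere_moment e f i j" and t="?t"])
    show "real (i + j + DIM('a)) * (planar_mass \<nu> * sphere_moment e f (i + 2) j) = (real i + 1) * (planar_mass \<nu> * sphere_moment e f i j)" for i j
      using sphere_moment_rec[OF ef, of i j] by (simp add: mult.left_commute[of _ "planar_mass \<nu>"])
    show "real (i + j + DIM('a)) * (planar_mass \<nu> * sphere_moment e f i (j + 2)) = (real j + 1) * (planar_mass \<nu> * sphere_moment e f i j)" for i j
      using sphere_moment_rec[OF ef(2,1) fe, of j i]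
      by (simp add: mult.left_commute[of _ "planar_mass \<nu>"] sphere_moment_commute[of e f] add.commute add.left_commute)
    have beta: "\<nu> - 1/2 + real j / 2 > -1" for j :: nat
    proof -
      have "0 \<le> real j / 2" by simp
      then show ?thesis using lam by linarith
    qed
    show "real (i + j + DIM('a)) * ?t (i + 2) j = (real i + 1) * ?t i j" for i j
    proof -
      have eq: "real i + 2 * (\<nu> - 1/2 + real j / 2) + 3 = real (i + j + DIM('a))" using dim by simp
      show ?thesis by (simp only: mult.assoc[symmetric] jacobi_moment_rec[OF beta[of j], of i, unfolded eq])
    qed
    \<comment> \<open>Two more powers of the second coordinate raise the exponent of the t-weight by
      one. The factor 2 \<nu> + 1 + j from \<open>jacobi_moment_shift\<close> is just the one that
      the recursion for the w-weight cancels.\<close>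
    show "real (i + j + DIM('a)) * ?t i (j + 2) = (real j + 1) * ?t i j" for i j
    proof -
      let ?b = "\<nu> - 1/2 + real j / 2"
      have 0: "\<nu> - 1/2 + real (j + 2) / 2 = ?b + 1" by simp
      have eq: "real i + 2 * ?b + 3 = real (i + j + DIM('a))" "2 * ?b + 2 = 2 * \<nu> + 1 + j" using dim by simp_all
      have 1: "real (i + j + DIM('a)) * jacobi_moment (?b + 1) i = (2 * \<nu> + 1 + j) * jacobi_moment ?b i"
        by (simp only: jacobi_moment_shift[OF beta[of j], of i, unfolded eq])
      have 2: "(2 * \<nu> + 1 + j) * jacobi_moment (\<nu> - 1) (j + 2) = (real j + 1) * jacobi_moment (\<nu> - 1) j"
        using jacobi_moment_rec[of "\<nu> - 1" j] lam by (simp add: algebra_simps)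
      have "real (i + j + DIM('a)) * (jacobi_moment (?b + 1) i * jacobi_moment (\<nu> - 1) (j + 2))
          = (2 * \<nu> + 1 + j) * jacobi_moment ?b i * jacobi_moment (\<nu> - 1) (j + 2)"
        by (simp only: mult.assoc[symmetric] 1)
      also have "\<dots> = jacobi_moment ?b i * ((2 * \<nu> + 1 + j) * jacobi_moment (\<nu> - 1) (j + 2))" by simp
      also have "\<dots> = jacobi_moment ?b i * ((real j + 1) * jacobi_moment (\<nu> - 1) j)" by (simp only: 2)
      finally have "real (i + j + DIM('a)) * (jacobi_moment (?b + 1) i * jacobi_moment (\<nu> - 1) (j + 2))
          = (real j + 1) * (jacobi_moment ?b i * jacobi_moment (\<nu> - 1) j)" by (simp add: mult_ac)
      then show ?thesis by (simp only: 0)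
    qed
    show "planar_mass \<nu> * sphere_moment e f 1 j = 0" for j using sphere_moment_1[OF ef] by simp
    show "planar_mass \<nu> * sphere_moment e f i 1 = 0" for i
      using sphere_moment_1[OF ef(2,1) fe] by (simp add: sphere_moment_commute[of e f])
    show "?t 1 j = 0" for j using jacobi_moment_1[OF beta] by simp
    show "?t i 1 = 0" for i using jacobi_moment_1[of "\<nu> - 1"] lam by simp
  qed (simp_all add: planar_mass_def)
qed

text \<open>Equality of moments gives the claim for polynomials. Both measures are finite and are
  carried, through their planar coordinates, by the square, so uniform approximation there carries
  the claim over to \<open>F\<close>.\<close>

lemma sphere_integral_planar:
  assumes F_meas: "F \<in> borel_measurable borel" and F_cont: "continuous_on (cbox (-1, -1) (1, 1)) F"
  shows "planar_mass \<nu> * (\<integral>z. F (z \<bullet> e, z \<bullet> f) \<partial>sphere_measure) = (\<integral>z. F (disc_point z) \<partial>planar_measure \<nu>)"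
proof -
  let ?K = "cbox (-1, -1) (1, 1) :: (real \<times> real) set"
  interpret N: finite_measure "planar_measure \<nu>"
    by (rule finite_measure_pair_measure; rule finite_jacobi_measure; use lam in simp)
  have mem: "(z \<bullet> e, z \<bullet> f) \<in> ?K" if "norm z = 1" for z :: 'a
    using that Cauchy_Schwarz_ineq2[of z e] Cauchy_Schwarz_ineq2[of z f] ef
    by (simp add: cbox_Pair_eq norm_eq_1[symmetric] abs_le_iff)
  have [measurable]: "(\<lambda>z. (z \<bullet> e, z \<bullet> f)) \<in> borel_measurable (borel :: 'a measure)"
    by (intro borel_measurable_continuous_onI continuous_intros)
  have sint: "integrable sphere_measure (\<lambda>z. G (z \<bullet> e, z \<bullet> f))"
    and pint: "integrable (planar_measure \<nu>) (\<lambda>z. G (disc_point z))"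
    if G: "G \<in> borel_measurable borel" and cont: "continuous_on ?K G" for G :: "real \<times> real \<Rightarrow> real"
  proof -
    have "bounded (G ` ?K)" by (intro compact_imp_bounded compact_continuous_image cont compact_cbox)
    then obtain B where B: "\<And>z. z \<in> ?K \<Longrightarrow> \<bar>G z\<bar> \<le> B" unfolding bounded_iff by fastforce
    note [measurable] = G
    show "integrable sphere_measure (\<lambda>z. G (z \<bullet> e, z \<bullet> f))"
      by (rule integrable_sphere_measure[of _ B]) (use B mem in \<open>auto intro!: sphere_measure_measurable\<close>)
    show "integrable (planar_measure \<nu>) (\<lambda>z. G (disc_point z))"
      by (rule integrable_planar_measure[OF lam G B])
  qed
  have cont_bp: "continuous_on A p" if "bipolynomial p" for p A
    using that by induction (intro continuous_intros)+
  have poly: "planar_mass \<nu> * (\<integral>z. p (z \<bullet> e, z \<bullet> f) \<partial>sphere_measure) = (\<integral>z. p (disc_point z) \<partial>planar_measure \<nu>)"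
    if "bipolynomial p" for p
    using that
  proof induction
    case (monomial c i j)
    have "planar_mass \<nu> * (\<integral>z. c * ((z \<bullet> e) ^ i * (z \<bullet> f) ^ j) \<partial>sphere_measure) = c * (planar_mass \<nu> * sphere_moment e f i j)"
      by (simp add: sphere_moment_def)
    also have "\<dots> = c * (\<integral>z. fst (disc_point z) ^ i * snd (disc_point z) ^ j \<partial>planar_measure \<nu>)"
      by (simp only: sphere_moment_eq_planar integral_planar_monomial[OF lam])
    finally show ?case by simp
  next
    case (add p q)
    note c = cont_bp[OF add.hyps(1)] cont_bp[OF add.hyps(2)]
    note m = borel_measurable_continuous_onI[OF c(1)] borel_measurable_continuous_onI[OF c(2)]
    show ?case
      using add.IH sint[OF m(1) c(1)] sint[OF m(2) c(2)] pint[OF m(1) c(1)] pint[OF m(2) c(2)]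
      by (simp add: distrib_left)
  qed
  have mass: "measure (planar_measure \<nu>) (space (planar_measure \<nu>)) = planar_mass \<nu>"
    using integral_planar_monomial[OF lam, of 0 0] by (simp add: planar_mass_def)
  have small: "\<bar>planar_mass \<nu> * (\<integral>z. F (z \<bullet> e, z \<bullet> f) \<partial>sphere_measure) - (\<integral>z. F (disc_point z) \<partial>planar_measure \<nu>)\<bar> \<le> 2 * planar_mass \<nu> * d"
    if d: "d > 0" for d
  proof -
    obtain p where "real_polynomial_function p" and p: "\<And>z. z \<in> ?K \<Longrightarrow> \<bar>F z - p z\<bar> < d"
      using Stone_Weierstrass_real_polynomial_function[OF compact_cbox F_cont d] by blast
    then have bp: "bipolynomial p" by (intro bipolynomial_real_polynomial_function)
    note c = cont_bp[OF bp]
    note m = borel_measurable_continuous_onI[OF c]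
    have "\<bar>(\<integral>z. F (z \<bullet> e, z \<bullet> f) \<partial>sphere_measure) - (\<integral>z. p (z \<bullet> e, z \<bullet> f) \<partial>sphere_measure)\<bar>
        = \<bar>\<integral>z. F (z \<bullet> e, z \<bullet> f) - p (z \<bullet> e, z \<bullet> f) \<partial>sphere_measure\<bar>"
      using sint[OF F_meas F_cont] sint[OF m c] by simp
    also have "\<dots> \<le> (\<integral>z. \<bar>F (z \<bullet> e, z \<bullet> f) - p (z \<bullet> e, z \<bullet> f)\<bar> \<partial>sphere_measure)" by (rule integral_abs_bound)
    also have "\<dots> \<le> (\<integral>z. d \<partial>(sphere_measure :: 'a measure))"
      using sint[OF F_meas F_cont] sint[OF m c] finite_measure.integrable_const[OF finite_sphere_measure]
      by (intro integral_mono) (auto intro!: less_imp_le[OF p] mem)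
    finally have 1: "\<bar>(\<integral>z. F (z \<bullet> e, z \<bullet> f) \<partial>sphere_measure) - (\<integral>z. p (z \<bullet> e, z \<bullet> f) \<partial>sphere_measure)\<bar> \<le> d" by simp
    have "\<bar>(\<integral>z. F (disc_point z) \<partial>planar_measure \<nu>) - (\<integral>z. p (disc_point z) \<partial>planar_measure \<nu>)\<bar>
        = \<bar>\<integral>z. F (disc_point z) - p (disc_point z) \<partial>planar_measure \<nu>\<bar>"
      using pint[OF F_meas F_cont] pint[OF m c] by simp
    also have "\<dots> \<le> (\<integral>z. \<bar>F (disc_point z) - p (disc_point z)\<bar> \<partial>planar_measure \<nu>)" by (rule integral_abs_bound)
    also have "\<dots> \<le> (\<integral>z. d \<partial>planar_measure \<nu>)"
    proof (rule integral_mono_AE)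
      show "AE z in planar_measure \<nu>. \<bar>F (disc_point z) - p (disc_point z)\<bar> \<le> d"
        using AE_planar_measure[OF lam] by eventually_elim (rule less_imp_le[OF p])
    qed (use pint[OF F_meas F_cont] pint[OF m c] in auto)
    also have "\<dots> = planar_mass \<nu> * d" using mass by simp
    finally have 2: "\<bar>(\<integral>z. F (disc_point z) \<partial>planar_measure \<nu>) - (\<integral>z. p (disc_point z) \<partial>planar_measure \<nu>)\<bar> \<le> planar_mass \<nu> * d" .
    have "\<bar>planar_mass \<nu> * (\<integral>z. F (z \<bullet> e, z \<bullet> f) \<partial>sphere_measure) - planar_mass \<nu> * (\<integral>z. p (z \<bullet> e, z \<bullet> f) \<partial>sphere_measure)\<bar> \<le> planar_mass \<nu> * d"
      using mult_left_mono[OF 1, of "planar_mass \<nu>"] planar_mass_pos[OF lam]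
      by (simp add: abs_mult right_diff_distrib[symmetric])
    with 2 poly[OF bp] show ?thesis by linarith
  qed
  have "\<bar>planar_mass \<nu> * (\<integral>z. F (z \<bullet> e, z \<bullet> f) \<partial>sphere_measure) - (\<integral>z. F (disc_point z) \<partial>planar_measure \<nu>)\<bar> \<le> 0 + d" if "d > 0" for d
    using small[of "d / (2 * planar_mass \<nu>)"] that planar_mass_pos[OF lam] by simp
  then have "\<bar>planar_mass \<nu> * (\<integral>z. F (z \<bullet> e, z \<bullet> f) \<partial>sphere_measure) - (\<integral>z. F (disc_point z) \<partial>planar_measure \<nu>)\<bar> \<le> 0"
    by (rule field_le_epsilon)
  then show ?thesis by simp
qed

end

section \<open>Extremal direction\<close>

lemma nn_integral_jacobi_measure:
  assumes "f \<in> borel_measurable borel"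
  shows "(\<integral>\<^sup>+t. f t \<partial>jacobi_measure \<beta>) = (\<integral>\<^sup>+t. ennreal ((1 - t\<^sup>2) powr \<beta>) * indicator {-1..1} t * f t \<partial>lborel)"
  unfolding jacobi_measure_def using assms
  by (subst nn_integral_density) (auto intro!: nn_integral_cong simp: ennreal_mult'' ennreal_indicator mult_ac)

text \<open>The unnormalised integral in direction \<open>l1 *\<^sub>R e + l2 *\<^sub>R f\<close>
  after the Moebius substitution. Values in \<open>ennreal\<close> and the order of integration suit
  the one-variable substitution in \<open>t\<close> at fixed \<open>w\<close> and the later
  exchange.\<close>

definition extremal_integral :: "real \<Rightarrow> real \<Rightarrow> real \<Rightarrow> real \<Rightarrow> ennreal" where
  "extremal_integral \<nu> q l1 l2 = (\<integral>\<^sup>+w. (\<integral>\<^sup>+t. ennreal ((1 - t\<^sup>2) powr (\<nu> - 1/2) / (1 + q\<^sup>2 - 2 * q * t) powr \<nu>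
     * \<bar>(t - \<nu> / (\<nu> + 1) * q) * l1 + sqrt (1 - t\<^sup>2) * w * l2\<bar>) * indicator {-1..1} t \<partial>lborel) \<partial>jacobi_measure (\<nu> - 1))"

lemma one_plus_sq_pos:
  fixes q t :: real
  assumes "\<bar>q\<bar> < 1" "\<bar>t\<bar> \<le> 1"
  shows "1 + q\<^sup>2 + 2 * q * t > 0" "1 + q\<^sup>2 - 2 * q * t > 0"
proof -
  have "\<bar>q * t\<bar> \<le> \<bar>q\<bar>" using assms by (simp add: abs_mult mult_left_le)
  moreover have "(1 - \<bar>q\<bar>)\<^sup>2 > 0" using assms by simp
  then have "1 + q\<^sup>2 > 2 * \<bar>q\<bar>" by (simp add: power2_diff)
  ultimately show "1 + q\<^sup>2 + 2 * q * t > 0" "1 + q\<^sup>2 - 2 * q * t > 0" by (auto simp: abs_le_iff)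
qed

text \<open>Collects all powers produced by the Moebius substitution, with P = 1 - q^2, S = 1 - s^2
  and E = 1 + q^2 - 2 q s. The factors are the transformed t-weight, a power of |x - z|^2, one more
  factor |x - z|^2 and the Jacobian; taking logarithms makes the identity linear.\<close>

lemma moebius_weight:
  fixes P E S \<nu> :: real
  assumes P: "P > 0" and E: "E > 0" and S: "S \<ge> 0"
  shows "(P\<^sup>2 * S / E\<^sup>2) powr (\<nu> - 1/2) * (P\<^sup>2 / E) powr (- (\<nu> + 2)) * (P\<^sup>2 / E) * (P\<^sup>2 / E\<^sup>2)
       = S powr (\<nu> - 1/2) / E powr \<nu> / P"
proof (cases "S = 0")
  case False
  then have S: "S > 0" using assms by simp
  define p s u where "p = ln P" and "s = ln S" and "u = ln E"
  have e: "P = exp p" "S = exp s" "E = exp u" using P S E by (simp_all add: p_def s_def u_def)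
  have "(exp p)\<^sup>2 * exp s / (exp u)\<^sup>2 = exp (2 * p + s - 2 * u)" "(exp p)\<^sup>2 / exp u = exp (2 * p - u)"
    "(exp p)\<^sup>2 / (exp u)\<^sup>2 = exp (2 * p - 2 * u)"
    by (simp_all add: exp_double[symmetric] exp_add[symmetric] exp_diff[symmetric])
  then show ?thesis
    unfolding e powr_def by (simp add: exp_add[symmetric] exp_diff[symmetric]) (simp add: algebra_simps)
qed simp

context
  fixes e f :: "'a::euclidean_space" and \<nu> q l1 l2 :: real
  assumes ef: "e \<bullet> e = 1" "f \<bullet> f = 1" "e \<bullet> f = 0" and nu: "\<nu> > 0" and dim: "real DIM('a) = 2 * \<nu> + 2"
    and q: "0 \<le> q" "q < 1"
begin

text \<open>The axis \<open>e\<close> points away from \<open>x = - q e\<close>; this makes the Moebius substitution below increasing.\<close>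

definition disc_integrand :: "real \<times> real \<Rightarrow> real" where
  "disc_integrand = (\<lambda>(a, b). \<bar>2 * q * l1 * (1 + q\<^sup>2 + 2 * q * a) powr (- (\<nu> + 1))
      + (2 * \<nu> + 2) * (1 - q\<^sup>2) * ((q + a) * l1 + b * l2) * (1 + q\<^sup>2 + 2 * q * a) powr (- (\<nu> + 2))\<bar>)"

text \<open>Here |x - z|^2 = 1 + q^2 + 2 q (z . e), and n = 2 \<nu> + 2 turns its half-integral
  powers into real exponents \<nu> + 1 and \<nu> + 2.\<close>

lemma poisson_grad_disc_integrand:
  assumes z: "norm z = 1"
  shows "\<bar>poisson_grad (- q *\<^sub>R e) z \<bullet> (l1 *\<^sub>R e + l2 *\<^sub>R f)\<bar> = disc_integrand (z \<bullet> e, z \<bullet> f)"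
proof -
  let ?x = "- q *\<^sub>R e" and ?l = "l1 *\<^sub>R e + l2 *\<^sub>R f" and ?D = "1 + q\<^sup>2 + 2 * q * (z \<bullet> e)"
  have "\<bar>z \<bullet> e\<bar> \<le> 1" using Cauchy_Schwarz_ineq2[of z e] z ef by (simp add: norm_eq_1[symmetric])
  then have D: "?D > 0" using q by (intro one_plus_sq_pos) auto
  have fe: "f \<bullet> e = 0" using ef by (simp add: inner_commute)
  have zz: "z \<bullet> z = 1" using z by (simp add: norm_eq_1)
  have "(norm (?x - z))\<^sup>2 = ?D"
    unfolding power2_norm_eq_inner
    using ef zz by (simp add: inner_diff_left inner_diff_right inner_commute[of e z] power2_eq_square algebra_simps)
  then have N: "norm (?x - z) = ?D powr (1/2)"
    using D by (simp add: powr_half_sqrt real_sqrt_unique)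
  have N1: "norm (?x - z) ^ DIM('a) = ?D powr (\<nu> + 1)"
  proof -
    have "norm (?x - z) ^ DIM('a) = (?D powr (1/2)) powr real DIM('a)"
      unfolding N using D by (intro powr_realpow[symmetric]) simp
    then show ?thesis using dim by (simp add: powr_powr add_divide_distrib)
  qed
  have N2: "norm (?x - z) ^ (DIM('a) + 2) = ?D powr (\<nu> + 2)"
  proof -
    have "norm (?x - z) ^ (DIM('a) + 2) = (?D powr (1/2)) powr real (DIM('a) + 2)"
      unfolding N using D by (intro powr_realpow[symmetric]) simp
    then show ?thesis using dim by (simp add: powr_powr add_divide_distrib add.commute)
  qed
  have nx: "(norm ?x)\<^sup>2 = q\<^sup>2" unfolding power2_norm_eq_inner using ef by (simp add: power2_eq_square)
  have i: "?x \<bullet> ?l = - q * l1" "(?x - z) \<bullet> ?l = - ((q + z \<bullet> e) * l1 + (z \<bullet> f) * l2)"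
    using ef fe by (simp_all add: inner_diff_left inner_add_right algebra_simps)
  have "poisson_grad ?x z \<bullet> ?l = - (2 / ?D powr (\<nu> + 1)) * (?x \<bullet> ?l) - (DIM('a) * (1 - q\<^sup>2) / ?D powr (\<nu> + 2)) * ((?x - z) \<bullet> ?l)"
    unfolding poisson_grad_def N1 N2 nx by (simp only: inner_diff_left[of "_ *\<^sub>R ?x"] inner_scaleR_left)
  also have "\<dots> = 2 * q * l1 * ?D powr (- (\<nu> + 1)) + (2 * \<nu> + 2) * (1 - q\<^sup>2) * ((q + z \<bullet> e) * l1 + (z \<bullet> f) * l2) * ?D powr (- (\<nu> + 2))"
    unfolding i dim by (simp only: powr_minus divide_inverse) (simp add: algebra_simps)
  finally show ?thesis by (simp add: disc_integrand_def)
qed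

lemma disc_integrand_measurable: "disc_integrand \<in> borel_measurable borel"
  unfolding disc_integrand_def borel_prod[symmetric] by measurable

lemma disc_integrand_continuous: "continuous_on (cbox (-1, -1) (1, 1)) disc_integrand"
proof -
  have "1 + q\<^sup>2 + 2 * q * fst z \<noteq> 0" if "z \<in> cbox (-1, -1) (1, 1)" for z :: "real \<times> real"
    using that one_plus_sq_pos(1)[of q "fst z"] q by (cases z) (auto simp: cbox_Pair_eq abs_le_iff)
  then show ?thesis
    unfolding disc_integrand_def case_prod_beta by (intro continuous_intros) auto
qed

lemma disc_integrand_nonneg: "0 \<le> disc_integrand z"
  by (simp add: disc_integrand_def case_prod_beta)

text \<open>\<open>g\<close> is the first coordinate of the Moebius involution composed with the
  antipodal map. The orthogonal coordinates are all multiplied by (1 - q^2) / E, exactly as sqrt(1 -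
  s^2) is, so \<open>w\<close> stays fixed. The last factor on the left is the derivative of
  \<open>g\<close>.\<close>

lemma disc_integrand_moebius:
  assumes s: "\<bar>s\<bar> \<le> 1"
  defines "E \<equiv> 1 + q\<^sup>2 - 2 * q * s"
  defines "g \<equiv> ((1 + q\<^sup>2) * s - 2 * q) / E"
  shows "(1 - g\<^sup>2) powr (\<nu> - 1/2) * disc_integrand (g, sqrt (1 - g\<^sup>2) * w) * ((1 - q\<^sup>2)\<^sup>2 / E\<^sup>2)
     = (2 * \<nu> + 2) / (1 - q\<^sup>2) * ((1 - s\<^sup>2) powr (\<nu> - 1/2) / E powr \<nu> * \<bar>(s - \<nu> / (\<nu> + 1) * q) * l1 + sqrt (1 - s\<^sup>2) * w * l2\<bar>)"
proof -
  have E: "E > 0" unfolding E_def using s q by (intro one_plus_sq_pos) auto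
  have P: "1 - q\<^sup>2 > 0" using q by (simp add: abs_square_less_1)
  have S: "1 - s\<^sup>2 \<ge> 0" using s by (simp add: abs_square_le_1)
  have gE: "g * E = (1 + q\<^sup>2) * s - 2 * q" using E by (simp add: g_def)
  have D: "1 + q\<^sup>2 + 2 * q * g = (1 - q\<^sup>2)\<^sup>2 / E"
  proof -
    have "(1 + q\<^sup>2 + 2 * q * g) * E = (1 + q\<^sup>2) * E + 2 * q * (g * E)" by (simp add: algebra_simps)
    also have "\<dots> = (1 - q\<^sup>2)\<^sup>2" unfolding gE unfolding E_def by algebra
    finally show ?thesis using E by (simp add: field_simps)
  qed
  have T: "1 - g\<^sup>2 = (1 - q\<^sup>2)\<^sup>2 * (1 - s\<^sup>2) / E\<^sup>2"
  proof -
    have "(1 - g\<^sup>2) * E\<^sup>2 = E\<^sup>2 - (g * E)\<^sup>2" by (simp add: algebra_simps power_mult_distrib)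
    also have "\<dots> = (1 - q\<^sup>2)\<^sup>2 * (1 - s\<^sup>2)" unfolding gE unfolding E_def by algebra
    finally show ?thesis using E by (simp add: field_simps)
  qed
  have sq: "sqrt (1 - g\<^sup>2) = (1 - q\<^sup>2) / E * sqrt (1 - s\<^sup>2)"
    unfolding T using E P by (simp add: real_sqrt_divide real_sqrt_mult)
  have qg: "q + g = (1 - q\<^sup>2) / E * (s - q)"
  proof -
    have "(q + g) * E = (1 - q\<^sup>2) * (s - q)" unfolding distrib_right gE unfolding E_def by algebra
    then show ?thesis using E by (simp add: field_simps)
  qed
  define L where "L = (s - \<nu> / (\<nu> + 1) * q) * l1 + sqrt (1 - s\<^sup>2) * w * l2"
  define D where "D = (1 - q\<^sup>2)\<^sup>2 / E"
  have Dpos: "D > 0" using E P by (simp add: D_def)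
  have "disc_integrand (g, sqrt (1 - g\<^sup>2) * w) = \<bar>2 * q * l1 * D powr (- (\<nu> + 1))
      + (2 * \<nu> + 2) * (1 - q\<^sup>2) * ((1 - q\<^sup>2) / E * (s - q) * l1 + (1 - q\<^sup>2) / E * sqrt (1 - s\<^sup>2) * w * l2) * D powr (- (\<nu> + 2))\<bar>"
    unfolding disc_integrand_def prod.case D qg sq D_def ..
  also have "D powr (- (\<nu> + 1)) = D powr (- (\<nu> + 2)) * D"
    using Dpos powr_add[of D "- (\<nu> + 2)" 1] by (simp add: algebra_simps)
  also have "2 * q * l1 * (D powr (- (\<nu> + 2)) * D) + (2 * \<nu> + 2) * (1 - q\<^sup>2) * ((1 - q\<^sup>2) / E * (s - q) * l1 + (1 - q\<^sup>2) / E * sqrt (1 - s\<^sup>2) * w * l2) * D powr (- (\<nu> + 2))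
      = D powr (- (\<nu> + 2)) * D * (2 * q * l1 + (2 * \<nu> + 2) * ((s - q) * l1 + sqrt (1 - s\<^sup>2) * w * l2))"
  proof -
    obtain d c where d: "d = D powr (- (\<nu> + 2))" and c: "c = (1 - q\<^sup>2) / E" by blast
    have Dc: "D = (1 - q\<^sup>2) * c" by (simp add: D_def c power2_eq_square)
    show ?thesis unfolding d[symmetric] c[symmetric] unfolding Dc by algebra
  qed
  \<comment> \<open>Origin of the constant (n - 2) / n: differentiating the numerator of the kernel
    adds 2 q to n (s - q), and 2 q + n (s - q) = n (s - (n - 2) / n q), where (n - 2) / n = \<nu> /
    (\<nu> + 1).\<close>
  also have "2 * q * l1 + (2 * \<nu> + 2) * ((s - q) * l1 + sqrt (1 - s\<^sup>2) * w * l2) = (2 * \<nu> + 2) * L"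
  proof -
    have "(2 * \<nu> + 2) * (\<nu> / (\<nu> + 1) * q) = 2 * \<nu> * q" using nu by (simp add: field_simps)
    then have "(2 * \<nu> + 2) * (s - \<nu> / (\<nu> + 1) * q) = (2 * \<nu> + 2) * s - 2 * \<nu> * q" by (simp only: right_diff_distrib)
    moreover have "(2 * \<nu> + 2) * L = ((2 * \<nu> + 2) * (s - \<nu> / (\<nu> + 1) * q)) * l1 + (2 * \<nu> + 2) * (sqrt (1 - s\<^sup>2) * w * l2)"
      unfolding L_def by (simp only: distrib_left mult.assoc)
    ultimately show ?thesis by (simp add: algebra_simps)
  qed
  also have "\<bar>D powr (- (\<nu> + 2)) * D * ((2 * \<nu> + 2) * L)\<bar> = D powr (- (\<nu> + 2)) * D * (2 * \<nu> + 2) * \<bar>L\<bar>"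
    using Dpos nu by (simp add: abs_mult)
  finally have F: "disc_integrand (g, sqrt (1 - g\<^sup>2) * w) = D powr (- (\<nu> + 2)) * D * (2 * \<nu> + 2) * \<bar>L\<bar>" .
  have "(1 - g\<^sup>2) powr (\<nu> - 1/2) * disc_integrand (g, sqrt (1 - g\<^sup>2) * w) * ((1 - q\<^sup>2)\<^sup>2 / E\<^sup>2)
     = ((1 - g\<^sup>2) powr (\<nu> - 1/2) * D powr (- (\<nu> + 2)) * D * ((1 - q\<^sup>2)\<^sup>2 / E\<^sup>2)) * ((2 * \<nu> + 2) * \<bar>L\<bar>)"
    unfolding F by (simp only: mult_ac)
  also have "\<dots> = ((1 - s\<^sup>2) powr (\<nu> - 1/2) / E powr \<nu> / (1 - q\<^sup>2)) * ((2 * \<nu> + 2) * \<bar>L\<bar>)"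
    unfolding T D_def moebius_weight[OF P E S] ..
  also have "\<dots> = (2 * \<nu> + 2) / (1 - q\<^sup>2) * ((1 - s\<^sup>2) powr (\<nu> - 1/2) / E powr \<nu> * \<bar>L\<bar>)"
    by (simp add: mult_ac)
  finally show ?thesis unfolding L_def .
qed

text \<open>Projection to the disc, then Fubini with \<open>t\<close> innermost: for each
  \<open>w\<close> the Moebius map is a substitution in one variable.\<close>

lemma integral_poisson_grad_eq_extremal:
  "ennreal (planar_mass \<nu> * (\<integral>z. \<bar>poisson_grad (- q *\<^sub>R e) z \<bullet> (l1 *\<^sub>R e + l2 *\<^sub>R f)\<bar> \<partial>sphere_measure))
     = ennreal ((2 * \<nu> + 2) / (1 - q\<^sup>2)) * extremal_integral \<nu> q l1 l2"
proof -
  have P: "1 - q\<^sup>2 > 0" using q by (simp add: abs_square_less_1)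
  interpret J1: finite_measure "jacobi_measure (\<nu> - 1/2)" by (rule finite_jacobi_measure) (use nu in simp)
  interpret J2: finite_measure "jacobi_measure (\<nu> - 1)" by (rule finite_jacobi_measure) (use nu in simp)
  interpret J: pair_sigma_finite "jacobi_measure (\<nu> - 1/2)" "jacobi_measure (\<nu> - 1)" ..
  have [measurable]: "disc_integrand \<in> borel_measurable (borel \<Otimes>\<^sub>M borel)"
    using disc_integrand_measurable by (simp add: borel_prod)
  have "bounded (disc_integrand ` cbox (-1, -1) (1, 1))"
    by (intro compact_imp_bounded compact_continuous_image disc_integrand_continuous compact_cbox)
  then obtain B where B: "\<And>z. z \<in> cbox (-1, -1) (1, 1) \<Longrightarrow> \<bar>disc_integrand z\<bar> \<le> B" unfolding bounded_iff by fastforce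
  have int: "integrable (planar_measure \<nu>) (\<lambda>z. disc_integrand (disc_point z))"
    by (rule integrable_planar_measure[OF nu disc_integrand_measurable B])
  have "(\<integral>z. \<bar>poisson_grad (- q *\<^sub>R e) z \<bullet> (l1 *\<^sub>R e + l2 *\<^sub>R f)\<bar> \<partial>sphere_measure)
      = (\<integral>z. disc_integrand (z \<bullet> e, z \<bullet> f) \<partial>sphere_measure)"
    by (rule Bochner_Integration.integral_cong) (auto simp only: space_sphere_measure mem_sphere dist_0_norm poisson_grad_disc_integrand)
  then have "ennreal (planar_mass \<nu> * (\<integral>z. \<bar>poisson_grad (- q *\<^sub>R e) z \<bullet> (l1 *\<^sub>R e + l2 *\<^sub>R f)\<bar> \<partial>sphere_measure))
      = ennreal (\<integral>z. disc_integrand (disc_point z) \<partial>planar_measure \<nu>)"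
    by (simp only: sphere_integral_planar[OF ef nu dim disc_integrand_measurable disc_integrand_continuous])
  also have "\<dots> = (\<integral>\<^sup>+z. ennreal (disc_integrand (disc_point z)) \<partial>planar_measure \<nu>)"
    by (rule nn_integral_eq_integral[symmetric, OF int]) (simp add: disc_integrand_nonneg)
  also have "\<dots> = (\<integral>\<^sup>+w. (\<integral>\<^sup>+t. ennreal (disc_integrand (t, sqrt (1 - t\<^sup>2) * w)) \<partial>jacobi_measure (\<nu> - 1/2)) \<partial>jacobi_measure (\<nu> - 1))"
  proof (subst J.nn_integral_snd[symmetric])
    show "(\<lambda>z. ennreal (disc_integrand (disc_point z))) \<in> borel_measurable (planar_measure \<nu>)"
      using int by measurable
  qed (simp add: disc_point_def)
  also have "\<dots> = (\<integral>\<^sup>+w. ennreal ((2 * \<nu> + 2) / (1 - q\<^sup>2)) * (\<integral>\<^sup>+t. ennreal ((1 - t\<^sup>2) powr (\<nu> - 1/2) / (1 + q\<^sup>2 - 2 * q * t) powr \<nu>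
     * \<bar>(t - \<nu> / (\<nu> + 1) * q) * l1 + sqrt (1 - t\<^sup>2) * w * l2\<bar>) * indicator {-1..1} t \<partial>lborel) \<partial>jacobi_measure (\<nu> - 1))"
  proof (rule nn_integral_cong)
    fix w :: real
    define E where "E s = 1 + q\<^sup>2 - 2 * q * s" for s
    define g where "g s = ((1 + q\<^sup>2) * s - 2 * q) / E s" for s
    have E: "E s > 0" if "\<bar>s\<bar> \<le> 1" for s unfolding E_def using that q by (intro one_plus_sq_pos) auto
    have "(1 - q)\<^sup>2 > 0" "(1 + q)\<^sup>2 > 0" using q by simp_all
    \<comment> \<open>The substitution fixes both endpoints, so it maps [-1, 1] onto itself.\<close>
    then have g1: "g (-1) = -1" "g 1 = 1"
      by (simp_all add: g_def E_def power2_eq_square field_simps)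
    have "(\<integral>\<^sup>+t. ennreal (disc_integrand (t, sqrt (1 - t\<^sup>2) * w)) \<partial>jacobi_measure (\<nu> - 1/2))
        = (\<integral>\<^sup>+t. ennreal ((1 - t\<^sup>2) powr (\<nu> - 1/2)) * indicator {-1..1} t * ennreal (disc_integrand (t, sqrt (1 - t\<^sup>2) * w)) \<partial>lborel)"
      by (rule nn_integral_jacobi_measure) measurable
    also have "\<dots> = (\<integral>\<^sup>+t. ennreal ((1 - t\<^sup>2) powr (\<nu> - 1/2) * disc_integrand (t, sqrt (1 - t\<^sup>2) * w)) * indicator {g (-1)..g 1} t \<partial>lborel)"
      unfolding g1 by (intro nn_integral_cong) (simp add: ennreal_mult'' disc_integrand_nonneg mult_ac)
    also have "\<dots> = (\<integral>\<^sup>+s. ennreal ((1 - (g s)\<^sup>2) powr (\<nu> - 1/2) * disc_integrand (g s, sqrt (1 - (g s)\<^sup>2) * w) * ((1 - q\<^sup>2)\<^sup>2 / (E s)\<^sup>2)) * indicator {-1..1} s \<partial>lborel)"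
    proof (rule nn_integral_substitution_Icc)
      show "(\<lambda>t. (1 - t\<^sup>2) powr (\<nu> - 1/2) * disc_integrand (t, sqrt (1 - t\<^sup>2) * w)) \<in> borel_measurable borel" by measurable
      fix s :: real assume "s \<in> {-1..1}"
      then have Es: "E s > 0" by (intro E) auto
      have "(g has_real_derivative ((1 + q\<^sup>2) * E s - ((1 + q\<^sup>2) * s - 2 * q) * (- 2 * q)) / (E s * E s)) (at s)"
        unfolding g_def[abs_def]
        by (rule DERIV_divide) (use Es in \<open>auto simp: E_def intro!: derivative_eq_intros\<close>)
      moreover have "(1 + q\<^sup>2) * E s - ((1 + q\<^sup>2) * s - 2 * q) * (- 2 * q) = (1 - q\<^sup>2)\<^sup>2" unfolding E_def by algebra
      ultimately show "(g has_real_derivative (1 - q\<^sup>2)\<^sup>2 / (E s)\<^sup>2) (at s)" by (simp add: power2_eq_square)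
    next
      have "E s \<noteq> 0" if "s \<in> {-1..1}" for s using E[of s] that by (auto simp: abs_le_iff)
      then show "continuous_on {-1..1} (\<lambda>s. (1 - q\<^sup>2)\<^sup>2 / (E s)\<^sup>2)"
        unfolding E_def by (intro continuous_intros) auto
    qed auto
    also have "\<dots> = (\<integral>\<^sup>+t. ennreal ((2 * \<nu> + 2) / (1 - q\<^sup>2)) * (ennreal ((1 - t\<^sup>2) powr (\<nu> - 1/2) / (1 + q\<^sup>2 - 2 * q * t) powr \<nu>
       * \<bar>(t - \<nu> / (\<nu> + 1) * q) * l1 + sqrt (1 - t\<^sup>2) * w * l2\<bar>) * indicator {-1..1} t) \<partial>lborel)"
    proof (rule nn_integral_cong)
      fix s :: real
      show "ennreal ((1 - (g s)\<^sup>2) powr (\<nu> - 1/2) * disc_integrand (g s, sqrt (1 - (g s)\<^sup>2) * w) * ((1 - q\<^sup>2)\<^sup>2 / (E s)\<^sup>2)) * indicator {-1..1} s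
        = ennreal ((2 * \<nu> + 2) / (1 - q\<^sup>2)) * (ennreal ((1 - s\<^sup>2) powr (\<nu> - 1/2) / (1 + q\<^sup>2 - 2 * q * s) powr \<nu>
       * \<bar>(s - \<nu> / (\<nu> + 1) * q) * l1 + sqrt (1 - s\<^sup>2) * w * l2\<bar>) * indicator {-1..1} s)"
      proof (cases "\<bar>s\<bar> \<le> 1")
        case True
        show ?thesis
          unfolding g_def E_def disc_integrand_moebius[OF True] using nu P
          by (subst ennreal_mult) (auto simp: mult.assoc)
      qed (auto simp: indicator_def abs_le_iff)
    qed
    also have "\<dots> = ennreal ((2 * \<nu> + 2) / (1 - q\<^sup>2)) * (\<integral>\<^sup>+t. ennreal ((1 - t\<^sup>2) powr (\<nu> - 1/2) / (1 + q\<^sup>2 - 2 * q * t) powr \<nu>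
       * \<bar>(t - \<nu> / (\<nu> + 1) * q) * l1 + sqrt (1 - t\<^sup>2) * w * l2\<bar>) * indicator {-1..1} t \<partial>lborel)"
      by (rule nn_integral_cmult) measurable
    finally show "(\<integral>\<^sup>+t. ennreal (disc_integrand (t, sqrt (1 - t\<^sup>2) * w)) \<partial>jacobi_measure (\<nu> - 1/2)) = \<dots>" .
  qed
  also have "\<dots> = ennreal ((2 * \<nu> + 2) / (1 - q\<^sup>2)) * extremal_integral \<nu> q l1 l2"
    unfolding extremal_integral_def by (rule nn_integral_cmult) measurable
  finally show ?thesis .
qed

end

section \<open>Coordinates along the level circles\<close>

lemma nn_integral_substitution_antimono:
  fixes f :: "real \<Rightarrow> real"
  assumes f: "f \<in> borel_measurable borel"
    and "\<And>x. x \<in> {a..b} \<Longrightarrow> (g has_real_derivative g' x) (at x)"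
    and "continuous_on {a..b} g'" and "\<And>x. x \<in> {a..b} \<Longrightarrow> g' x \<le> 0" and "a \<le> b"
  shows "(\<integral>\<^sup>+x. ennreal (f x) * indicator {g b..g a} x \<partial>lborel)
       = (\<integral>\<^sup>+x. ennreal (f (g x) * - g' x) * indicator {a..b} x \<partial>lborel)"
proof -
  have "(\<integral>\<^sup>+x. ennreal (f x) * indicator {g b..g a} x \<partial>lborel)
      = (\<integral>\<^sup>+x. ennreal (f (- x)) * indicator {- g a..- g b} x \<partial>lborel)"
    using f by (subst nn_integral_real_affine[of _ "-1" 0]) (auto intro!: nn_integral_cong simp: indicator_def)
  also have "\<dots> = (\<integral>\<^sup>+x. ennreal (f (- (- g x)) * - g' x) * indicator {a..b} x \<partial>lborel)"
    by (rule nn_integral_substitution_Icc[where f="\<lambda>x. f (- x)"])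
       (use assms in \<open>auto intro!: derivative_eq_intros continuous_intros\<close>)
  finally show ?thesis by simp
qed

text \<open>With (l1, l2) = (cos p, sin p) and F(x) = |b + R cos x| the integrand is F(\<theta> - p)
  + F(\<theta> + p). Since F is even, the two terms integrate F over [p - pi, p] and [p, p + pi],
  together a full period, so the value does not depend on p.\<close>

lemma circle_abs_integral:
  fixes b R l1 l2 :: real
  assumes "l1\<^sup>2 + l2\<^sup>2 = 1"
  shows "((\<lambda>\<theta>. \<bar>b + R * (l1 * cos \<theta> + l2 * sin \<theta>)\<bar> + \<bar>b + R * (l1 * cos \<theta> - l2 * sin \<theta>)\<bar>) has_integral
     integral {0..pi} (\<lambda>\<theta>. \<bar>b + R * cos \<theta>\<bar> + \<bar>b - R * cos \<theta>\<bar>)) {0..pi}"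
proof -
  obtain p where p: "0 \<le> p" "p < 2 * pi" and l: "l1 = cos p" "l2 = sin p"
    using sincos_total_2pi[OF assms] by metis
  define F where "F x = \<bar>b + R * cos x\<bar>" for x
  have pi4: "pi < 4" by (rule pi_less_4)
  \<comment> \<open>One antiderivative on a window with room for all arguments: p < 2 pi, and pi < 4
    keeps the shifts by pi and 2 pi within 20.\<close>
  have "continuous_on {-20..20} F" unfolding F_def by (intro continuous_intros)
  then obtain G where G0: "\<And>x. x \<in> {-20..20} \<Longrightarrow> (G has_vector_derivative F x) (at x within {-20..20})"
    using antiderivative_continuous by blast
  have G: "(G has_real_derivative F x) (at x)" if "\<bar>x\<bar> < 20" for x
    using G0[of x] that at_within_Icc_at[of "-20" x 20]
    by (auto simp: has_real_derivative_iff_has_vector_derivative abs_less_iff)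
  have FTC: "((\<lambda>x. s * F (c + s * x)) has_integral G (c + s * pi) - G c) {0..pi}"
    if "\<bar>c\<bar> < 11" "\<bar>s\<bar> = 1" for c s
  proof -
    have "((\<lambda>x. s * F (c + s * x)) has_integral G (c + s * pi) - G (c + s * 0)) {0..pi}"
    proof (rule fundamental_theorem_of_calculus)
      fix x assume x: "x \<in> {0..pi}"
      have "\<bar>c + s * x\<bar> < 20"
        using abs_triangle_ineq[of c "s * x"] that x pi4 by (simp add: abs_mult)
      then have "((\<lambda>x. G (c + s * x)) has_real_derivative F (c + s * x) * s) (at x)"
        by (intro DERIV_chain2[OF G]) (auto intro!: derivative_eq_intros)
      then show "((\<lambda>x. G (c + s * x)) has_vector_derivative s * F (c + s * x)) (at x within {0..pi})"
        by (auto simp: has_real_derivative_iff_has_vector_derivative mult.commute intro: has_vector_derivative_at_within)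
    qed simp
    then show ?thesis by simp
  qed
  have even: "G (- x) + G x = G 0 + G 0" if x: "\<bar>x\<bar> < 20" for x
  proof -
    have "((\<lambda>x. G (- x) + G x) has_real_derivative 0) (at y within {-20<..<20})" if y: "y \<in> {-20<..<20}" for y
    proof -
      have "((\<lambda>x. G (- x)) has_real_derivative F (- y) * (- 1)) (at y)"
        using y by (intro DERIV_chain2[OF G]) (auto intro!: derivative_eq_intros)
      moreover have "(G has_real_derivative F y) (at y)" using y by (intro G) auto
      ultimately have "((\<lambda>x. G (- x) + G x) has_real_derivative F (- y) * (- 1) + F y) (at y)" by (rule DERIV_add)
      then show ?thesis by (auto simp: F_def intro: has_field_derivative_at_within)
    qed
    then obtain c where "\<And>y. y \<in> {-20<..<20} \<Longrightarrow> G (- y) + G y = c"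
      using has_field_derivative_zero_constant[of "{-20<..<20::real}" "\<lambda>x. G (- x) + G x"] by auto
    from this[of x] this[of 0] x show ?thesis by (simp add: abs_less_iff)
  qed
  have per: "G (x + 2 * pi) - G x = G (- pi + 2 * pi) - G (- pi)" if x: "\<bar>x\<bar> < 11" for x
  proof -
    have "((\<lambda>x. G (x + 2 * pi) - G x) has_real_derivative 0) (at y within {-11<..<11})" if y: "y \<in> {-11<..<11}" for y
    proof -
      have "((\<lambda>x. G (x + 2 * pi)) has_real_derivative F (y + 2 * pi) * 1) (at y)"
        using y pi4 pi_gt3 by (intro DERIV_chain2[OF G]) (auto intro!: derivative_eq_intros simp: abs_less_iff)
      moreover have "(G has_real_derivative F y) (at y)" using y by (intro G) auto
      ultimately have "((\<lambda>x. G (x + 2 * pi) - G x) has_real_derivative F (y + 2 * pi) * 1 - F y) (at y)" by (rule DERIV_diff)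
      then show ?thesis by (auto simp: F_def intro: has_field_derivative_at_within)
    qed
    then obtain c where "\<And>y. y \<in> {-11<..<11} \<Longrightarrow> G (y + 2 * pi) - G y = c"
      using has_field_derivative_zero_constant[of "{-11<..<11::real}" "\<lambda>x. G (x + 2 * pi) - G x"] by auto
    from this[of x] this[of "- pi"] x pi4 pi_gt3 show ?thesis by (simp add: abs_less_iff)
  qed
  have pb: "\<bar>p\<bar> < 11" "\<bar>- p\<bar> < 11" "\<bar>p - pi\<bar> < 11" "\<bar>p - pi\<bar> < 20" "\<bar>p\<bar> < 20" "\<bar>pi\<bar> < 20" using p pi4 pi_gt3 by (auto simp: abs_less_iff)
  have "((\<lambda>\<theta>. F (- p + \<theta>) + F (p + \<theta>)) has_integral (G (- p + pi) - G (- p)) + (G (p + pi) - G p)) {0..pi}"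
    using has_integral_add[OF FTC[of "- p" 1] FTC[of p 1]] pb by simp
  moreover have "(G (- p + pi) - G (- p)) + (G (p + pi) - G p) = 2 * (G pi - G 0)"
    using even[OF pb(5)] even[OF pb(4)] even[OF pb(6)] per[OF pb(3)] by (simp add: add.commute[of pi p])
  ultimately have lhs: "((\<lambda>\<theta>. F (- p + \<theta>) + F (p + \<theta>)) has_integral 2 * (G pi - G 0)) {0..pi}" by simp
  have "((\<lambda>\<theta>. F (0 + 1 * \<theta>) - (- 1 * F (pi + - 1 * \<theta>))) has_integral (G pi - G 0) - (G 0 - G pi)) {0..pi}"
    using has_integral_diff[OF FTC[of 0 1] FTC[of pi "-1"]] pi4 by simp
  then have rhs: "((\<lambda>\<theta>. \<bar>b + R * cos \<theta>\<bar> + \<bar>b - R * cos \<theta>\<bar>) has_integral 2 * (G pi - G 0)) {0..pi}"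
    by (simp add: F_def cos_diff)
  have "cos (- p + \<theta>) = cos p * cos \<theta> + sin p * sin \<theta>" "cos (p + \<theta>) = cos p * cos \<theta> - sin p * sin \<theta>" for \<theta>
    using cos_add[of "- p" \<theta>] cos_add[of p \<theta>] by simp_all
  with lhs show ?thesis
    unfolding integral_unique[OF rhs] l F_def by (simp only:)
qed

text \<open>The integral of |b + R cos \<theta>| over a full circle, not divided by its length.
  Pairing \<theta> with pi - \<theta> makes the comparison in \<open>b\<close> pointwise.\<close>

definition circle_abs_mean :: "real \<Rightarrow> real \<Rightarrow> real" where
  "circle_abs_mean b R = integral {0..pi} (\<lambda>\<theta>. \<bar>b + R * cos \<theta>\<bar> + \<bar>b - R * cos \<theta>\<bar>)"

text \<open>|b + y| + |b - y| = 2 max(|b|, |y|), which is increasing in |b|.\<close>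

lemma circle_abs_mean_mono:
  assumes "\<bar>b\<bar> \<le> \<bar>c\<bar>"
  shows "circle_abs_mean b R \<le> circle_abs_mean c R"
  unfolding circle_abs_mean_def
proof -
  have int: "(\<lambda>\<theta>. \<bar>b + R * cos \<theta>\<bar> + \<bar>b - R * cos \<theta>\<bar>) integrable_on {0..pi}" for b
    by (intro integrable_continuous_interval continuous_intros)
  show "integral {0..pi} (\<lambda>\<theta>. \<bar>b + R * cos \<theta>\<bar> + \<bar>b - R * cos \<theta>\<bar>)
      \<le> integral {0..pi} (\<lambda>\<theta>. \<bar>c + R * cos \<theta>\<bar> + \<bar>c - R * cos \<theta>\<bar>)"
  proof (rule integral_le[OF int int])
  show "\<bar>b + R * cos \<theta>\<bar> + \<bar>b - R * cos \<theta>\<bar> \<le> \<bar>c + R * cos \<theta>\<bar> + \<bar>c - R * cos \<theta>\<bar>" for \<theta>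
    using assms by (simp add: abs_if split: if_splits)
  qed
qed

context
  fixes \<nu> q l1 l2 :: real
  assumes nu: "\<nu> > 0" and q: "0 \<le> q" "q < 1"
begin

text \<open>The integrand in (t, g). The root is the modulus of the second disc coordinate, half its
  reciprocal is the Jacobian part, and the two moduli belong to the points above and below the
  axis.\<close>

definition polar_integrand :: "real \<Rightarrow> real \<Rightarrow> real" where
  "polar_integrand t g = g powr (\<nu> - 1) / (2 * sqrt (1 - t\<^sup>2 - g * (1 + q\<^sup>2 - 2 * q * t)))
     * (\<bar>(t - \<nu> / (\<nu> + 1) * q) * l1 + sqrt (1 - t\<^sup>2 - g * (1 + q\<^sup>2 - 2 * q * t)) * l2\<bar>
      + \<bar>(t - \<nu> / (\<nu> + 1) * q) * l1 - sqrt (1 - t\<^sup>2 - g * (1 + q\<^sup>2 - 2 * q * t)) * l2\<bar>)"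

text \<open>The integral over \<open>w\<close> is folded to [0, 1]; there g = (1 - w^2) (1 - t^2) /
  (1 + q^2 - 2 q t) decreases in \<open>w\<close> and turns the weights into g^(\<nu> - 1) over
  twice the root.\<close>

lemma jacobi_to_polar_integrand:
  assumes t: "\<bar>t\<bar> < 1"
  defines "h \<equiv> (t - \<nu> / (\<nu> + 1) * q) * l1"
  shows "(\<integral>\<^sup>+w. ennreal ((1 - t\<^sup>2) powr (\<nu> - 1/2) / (1 + q\<^sup>2 - 2 * q * t) powr \<nu> * \<bar>h + sqrt (1 - t\<^sup>2) * w * l2\<bar>) \<partial>jacobi_measure (\<nu> - 1))
     = (\<integral>\<^sup>+g. ennreal (polar_integrand t g) * indicator {0..(1 - t\<^sup>2) / (1 + q\<^sup>2 - 2 * q * t)} g \<partial>lborel)"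
proof -
  define T D where "T = 1 - t\<^sup>2" and "D = 1 + q\<^sup>2 - 2 * q * t"
  have T: "T > 0" using t by (simp add: T_def abs_square_less_1)
  have D: "D > 0" unfolding D_def using t q by (intro one_plus_sq_pos) auto
  define k where "k w = T powr (\<nu> - 1/2) / D powr \<nu> * (1 - w\<^sup>2) powr (\<nu> - 1)" for w
  have k0: "k w \<ge> 0" for w by (simp add: k_def)
  have km[measurable]: "k \<in> borel_measurable borel" unfolding k_def[abs_def] by measurable
  have "(\<integral>\<^sup>+w. ennreal (T powr (\<nu> - 1/2) / D powr \<nu> * \<bar>h + sqrt T * w * l2\<bar>) \<partial>jacobi_measure (\<nu> - 1))
     = (\<integral>\<^sup>+w. ennreal ((1 - w\<^sup>2) powr (\<nu> - 1)) * indicator {-1..1} w * ennreal (T powr (\<nu> - 1/2) / D powr \<nu> * \<bar>h + sqrt T * w * l2\<bar>) \<partial>lborel)"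
    by (rule nn_integral_jacobi_measure) measurable
  also have "\<dots> = (\<integral>\<^sup>+w. ennreal (k w * \<bar>h + sqrt T * w * l2\<bar>) * indicator {-1..0} w + ennreal (k w * \<bar>h + sqrt T * w * l2\<bar>) * indicator {0..1} w \<partial>lborel)"
    by (intro nn_integral_cong_AE AE_I[of _ _ "{0}"])
       (auto simp: indicator_def k_def ennreal_mult'[symmetric] mult_ac)
  also have "\<dots> = (\<integral>\<^sup>+w. ennreal (k w * \<bar>h + sqrt T * w * l2\<bar>) * indicator {-1..0} w \<partial>lborel)
      + (\<integral>\<^sup>+w. ennreal (k w * \<bar>h + sqrt T * w * l2\<bar>) * indicator {0..1} w \<partial>lborel)"
    by (rule nn_integral_add) measurable
  also have "(\<integral>\<^sup>+w. ennreal (k w * \<bar>h + sqrt T * w * l2\<bar>) * indicator {-1..0} w \<partial>lborel)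
      = (\<integral>\<^sup>+w. ennreal (k w * \<bar>h - sqrt T * w * l2\<bar>) * indicator {0..1} w \<partial>lborel)"
    by (subst nn_integral_real_affine[of _ "-1" 0]) (auto intro!: nn_integral_cong simp: indicator_def k_def)
  also have "\<dots> + (\<integral>\<^sup>+w. ennreal (k w * \<bar>h + sqrt T * w * l2\<bar>) * indicator {0..1} w \<partial>lborel)
      = (\<integral>\<^sup>+w. ennreal (k w * \<bar>h - sqrt T * w * l2\<bar>) * indicator {0..1} w + ennreal (k w * \<bar>h + sqrt T * w * l2\<bar>) * indicator {0..1} w \<partial>lborel)"
    by (rule nn_integral_add[symmetric]) measurable
  also have "\<dots> = (\<integral>\<^sup>+w. ennreal (polar_integrand t ((1 - w\<^sup>2) * T / D) * - (- 2 * w * T / D)) * indicator {0..1} w \<partial>lborel)"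
  \<comment> \<open>Excluded are w = 0, where the root in the denominator vanishes, and w = 1, where
    1 - w^2 does.\<close>
  proof (intro nn_integral_cong_AE AE_I[of _ _ "{0, 1}"])
    have "w = 0 \<or> w = 1" if ne: "ennreal (k w * \<bar>h - sqrt T * w * l2\<bar>) * indicator {0..1} w + ennreal (k w * \<bar>h + sqrt T * w * l2\<bar>) * indicator {0..1} w
      \<noteq> ennreal (polar_integrand t ((1 - w\<^sup>2) * T / D) * - (- 2 * w * T / D)) * indicator {0..1} w" for w
    proof (rule ccontr)
      assume w: "\<not> (w = 0 \<or> w = 1)"
      have win: "w \<in> {0..1}" by (rule ccontr) (use ne in simp)
      with w have w01: "0 < w" "w < 1" by auto
      have S: "1 - w\<^sup>2 > 0" using w01 by (simp add: abs_square_less_1)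
      have "(1 - w\<^sup>2) * T / D * D = (1 - w\<^sup>2) * T" using D by simp
      then have "T - (1 - w\<^sup>2) * T / D * D = w\<^sup>2 * T" by (simp add: left_diff_distrib)
      then have Q: "sqrt (1 - t\<^sup>2 - (1 - w\<^sup>2) * T / D * (1 + q\<^sup>2 - 2 * q * t)) = sqrt T * w"
        using w01 unfolding T_def[symmetric] D_def[symmetric] by (simp add: real_sqrt_mult)
      have "polar_integrand t ((1 - w\<^sup>2) * T / D) * - (- 2 * w * T / D)
         = ((1 - w\<^sup>2) * T / D) powr (\<nu> - 1) / (2 * (sqrt T * w)) * (2 * w * T / D) * (\<bar>h + sqrt T * w * l2\<bar> + \<bar>h - sqrt T * w * l2\<bar>)"
        unfolding polar_integrand_def Q h_def by simp
      also have "((1 - w\<^sup>2) * T / D) powr (\<nu> - 1) / (2 * (sqrt T * w)) * (2 * w * T / D) = k w"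
      proof -
        have "((1 - w\<^sup>2) * T / D) powr (\<nu> - 1) = (1 - w\<^sup>2) powr (\<nu> - 1) * (T powr (\<nu> - 1) / D powr (\<nu> - 1))"
          using S T D by (simp add: powr_mult powr_divide)
        moreover have "T powr (\<nu> - 1/2) = T powr (\<nu> - 1) * sqrt T"
          using T powr_add[of T "\<nu> - 1" "1/2"] by (simp add: powr_half_sqrt)
        moreover have "D powr \<nu> = D powr (\<nu> - 1) * D"
          using D powr_add[of D "\<nu> - 1" 1] by simp
        moreover have "T = sqrt T * sqrt T" using T by simp
        ultimately show ?thesis
          unfolding k_def using w01 T D by (simp add: field_simps)
      qed
      finally have eq: "polar_integrand t ((1 - w\<^sup>2) * T / D) * - (- 2 * w * T / D) = k w * \<bar>h - sqrt T * w * l2\<bar> + k w * \<bar>h + sqrt T * w * l2\<bar>"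
        by (simp add: distrib_left)
      have "ennreal (k w * \<bar>h - sqrt T * w * l2\<bar>) + ennreal (k w * \<bar>h + sqrt T * w * l2\<bar>)
          \<noteq> ennreal (k w * \<bar>h - sqrt T * w * l2\<bar> + k w * \<bar>h + sqrt T * w * l2\<bar>)"
        using ne by (simp only: eq indicator_simps(1)[OF win] mult_1_right not_False_eq_True)
      then show False using k0[of w] by simp
    qed
    then show "{w \<in> space lborel. \<not> ennreal (k w * \<bar>h - sqrt T * w * l2\<bar>) * indicator {0..1} w + ennreal (k w * \<bar>h + sqrt T * w * l2\<bar>) * indicator {0..1} w
      = ennreal (polar_integrand t ((1 - w\<^sup>2) * T / D) * - (- 2 * w * T / D)) * indicator {0..1} w} \<subseteq> {0, 1}" by blast
  qed (auto simp: emeasure_lborel_countable)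
  also have "\<dots> = (\<integral>\<^sup>+g. ennreal (polar_integrand t g) * indicator {(1 - 1\<^sup>2) * T / D..(1 - 0\<^sup>2) * T / D} g \<partial>lborel)"
    by (rule nn_integral_substitution_antimono[symmetric])
       (use T D in \<open>auto intro!: derivative_eq_intros continuous_intros simp: polar_integrand_def[abs_def]\<close>)
  finally show ?thesis by (simp add: T_def D_def)
qed

text \<open>At fixed \<open>g\<close> the range of \<open>t\<close> is an interval of radius R about
  g q. For t = g q + R cos \<theta> the root is R sin \<theta>, which cancels the Jacobian, and the
  linear form has constant term (g - a) q l1 with a = \<nu> / (\<nu> + 1).\<close>

lemma polar_integrand_to_circle:
  assumes g: "0 < g" "g < 1" and l: "l1\<^sup>2 + l2\<^sup>2 = 1"
  shows "(\<integral>\<^sup>+t. ennreal (polar_integrand t g) * indicator {t. 0 \<le> 1 - t\<^sup>2 - g * (1 + q\<^sup>2 - 2 * q * t)} t \<partial>lborel)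
     = ennreal (g powr (\<nu> - 1) / 2 * circle_abs_mean ((g - \<nu> / (\<nu> + 1)) * q * l1) (sqrt ((1 - g) * (1 - g * q\<^sup>2))))"
proof -
  define R where "R = sqrt ((1 - g) * (1 - g * q\<^sup>2))"
  have "g * q\<^sup>2 < 1" using g q by (metis abs_of_nonneg abs_square_less_1 less_imp_le mult_strict_mono mult.right_neutral zero_le_power2 zero_less_one)
  then have Rsq: "(1 - g) * (1 - g * q\<^sup>2) > 0" using g by simp
  then have R: "R > 0" and R2: "R\<^sup>2 = (1 - g) * (1 - g * q\<^sup>2)" by (simp_all add: R_def)
  \<comment> \<open>Completing the square in \<open>t\<close>: this identifies the level curve as a
    circle.\<close>
  have Q: "1 - t\<^sup>2 - g * (1 + q\<^sup>2 - 2 * q * t) = R\<^sup>2 - (t - g * q)\<^sup>2" for t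
    unfolding R2 by algebra
  have set: "{t. 0 \<le> 1 - t\<^sup>2 - g * (1 + q\<^sup>2 - 2 * q * t)} = {g * q + R * cos pi..g * q + R * cos 0}"
  proof -
    have "0 \<le> R\<^sup>2 - (t - g * q)\<^sup>2 \<longleftrightarrow> g * q - R \<le> t \<and> t \<le> g * q + R" for t
      using R abs_le_square_iff[of "t - g * q" R] by (simp only: diff_ge_0_iff_ge abs_of_pos) linarith
    then show ?thesis unfolding Q by (intro set_eqI) (simp only: mem_Collect_eq atLeastAtMost_iff cos_pi cos_zero, simp)
  qed
  let ?b = "(g - \<nu> / (\<nu> + 1)) * q * l1"
  let ?H = "\<lambda>\<theta>. \<bar>?b + R * (l1 * cos \<theta> + l2 * sin \<theta>)\<bar> + \<bar>?b + R * (l1 * cos \<theta> - l2 * sin \<theta>)\<bar>"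
  have "(\<integral>\<^sup>+t. ennreal (polar_integrand t g) * indicator {g * q + R * cos pi..g * q + R * cos 0} t \<partial>lborel)
      = (\<integral>\<^sup>+\<theta>. ennreal (polar_integrand (g * q + R * cos \<theta>) g * - (- R * sin \<theta>)) * indicator {0..pi} \<theta> \<partial>lborel)"
    by (rule nn_integral_substitution_antimono)
       (use R in \<open>auto intro!: derivative_eq_intros continuous_intros mult_nonneg_nonneg sin_ge_zero simp: polar_integrand_def[abs_def]\<close>)
  also have "\<dots> = (\<integral>\<^sup>+\<theta>. ennreal (g powr (\<nu> - 1) / 2) * ennreal (indicator {0..pi} \<theta> * ?H \<theta>) \<partial>lborel)"
  proof (intro nn_integral_cong_AE AE_I[of _ _ "{0, pi}"])
    have "\<theta> = 0 \<or> \<theta> = pi" if ne: "ennreal (polar_integrand (g * q + R * cos \<theta>) g * - (- R * sin \<theta>)) * indicator {0..pi} \<theta>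
       \<noteq> ennreal (g powr (\<nu> - 1) / 2) * ennreal (indicator {0..pi} \<theta> * ?H \<theta>)" for \<theta>
    proof (rule ccontr)
      assume "\<not> (\<theta> = 0 \<or> \<theta> = pi)"
      moreover have thin: "\<theta> \<in> {0..pi}" by (rule ccontr) (use ne in simp)
      ultimately have th: "0 < \<theta>" "\<theta> < pi" by auto
      then have sin: "sin \<theta> > 0" by (rule sin_gt_zero)
      have "R\<^sup>2 - (g * q + R * cos \<theta> - g * q)\<^sup>2 = (R * sin \<theta>)\<^sup>2"
        by (simp add: power_mult_distrib sin_squared_eq algebra_simps)
      then have sq: "sqrt (1 - (g * q + R * cos \<theta>)\<^sup>2 - g * (1 + q\<^sup>2 - 2 * q * (g * q + R * cos \<theta>))) = R * sin \<theta>"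
        unfolding Q using R sin by simp
      have eq: "polar_integrand (g * q + R * cos \<theta>) g * - (- R * sin \<theta>) = g powr (\<nu> - 1) / 2 * ?H \<theta>"
        unfolding polar_integrand_def sq using R sin by (simp add: algebra_simps)
      have "ennreal (g powr (\<nu> - 1) / 2 * ?H \<theta>) \<noteq> ennreal (g powr (\<nu> - 1) / 2) * ennreal (?H \<theta>)"
        using ne by (simp only: eq indicator_simps(1)[OF thin] mult_1_right mult_1_left not_False_eq_True)
      moreover have "ennreal (g powr (\<nu> - 1) / 2 * ?H \<theta>) = ennreal (g powr (\<nu> - 1) / 2) * ennreal (?H \<theta>)"
        by (rule ennreal_mult) simp_all
      ultimately show False by contradiction
    qed
    then show "{\<theta> \<in> space lborel. \<not> ennreal (polar_integrand (g * q + R * cos \<theta>) g * - (- R * sin \<theta>)) * indicator {0..pi} \<theta>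
       = ennreal (g powr (\<nu> - 1) / 2) * ennreal (indicator {0..pi} \<theta> * ?H \<theta>)} \<subseteq> {0, pi}" by blast
  qed (auto simp: emeasure_lborel_countable)
  also have "\<dots> = ennreal (g powr (\<nu> - 1) / 2) * (\<integral>\<^sup>+\<theta>. ennreal (indicator {0..pi} \<theta> * ?H \<theta>) \<partial>lborel)"
    by (rule nn_integral_cmult) measurable
  also have "(\<integral>\<^sup>+\<theta>. ennreal (indicator {0..pi} \<theta> * ?H \<theta>) \<partial>lborel) = ennreal (circle_abs_mean ?b R)"
    unfolding circle_abs_mean_def
    by (rule nn_integral_has_integral_lebesgue[OF _ circle_abs_integral[OF l]]) simp
  finally have circle: "(\<integral>\<^sup>+t. ennreal (polar_integrand t g) * indicator {g * q + R * cos pi..g * q + R * cos 0} t \<partial>lborel)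
      = ennreal (g powr (\<nu> - 1) / 2) * ennreal (circle_abs_mean ?b R)" .
  show ?thesis
    unfolding set R_def[symmetric] circle by (rule ennreal_mult'[symmetric]) simp
qed

text \<open>Two exchanges of order, first of \<open>t\<close> with \<open>w\<close>, then of
  \<open>t\<close> with \<open>g\<close>, make the two substitutions available one variable at a
  time.\<close>

lemma extremal_integral_polar:
  assumes l: "l1\<^sup>2 + l2\<^sup>2 = 1"
  shows "extremal_integral \<nu> q l1 l2 = (\<integral>\<^sup>+g. ennreal (g powr (\<nu> - 1) / 2
     * circle_abs_mean ((g - \<nu> / (\<nu> + 1)) * q * l1) (sqrt ((1 - g) * (1 - g * q\<^sup>2)))) * indicator {0<..<1} g \<partial>lborel)"
proof -
  interpret J2: finite_measure "jacobi_measure (\<nu> - 1)" by (rule finite_jacobi_measure) (use nu in simp)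
  interpret J: pair_sigma_finite "jacobi_measure (\<nu> - 1)" "lborel :: real measure" ..
  define Q where "Q t g = 1 - t\<^sup>2 - g * (1 + q\<^sup>2 - 2 * q * t)" for t g
  let ?h = "\<lambda>t w. ennreal ((1 - t\<^sup>2) powr (\<nu> - 1/2) / (1 + q\<^sup>2 - 2 * q * t) powr \<nu> * \<bar>(t - \<nu> / (\<nu> + 1) * q) * l1 + sqrt (1 - t\<^sup>2) * w * l2\<bar>)"
  let ?\<Phi> = "\<lambda>t g. ennreal (polar_integrand t g) * indicator {(t, g). \<bar>t\<bar> < 1 \<and> 0 < g \<and> g < 1 \<and> 0 \<le> Q t g} (t, g)"
  have pm: "(\<lambda>(t, g). polar_integrand t g) \<in> borel_measurable (borel \<Otimes>\<^sub>M borel)"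
    unfolding polar_integrand_def by measurable
  have sm: "{(t, g). \<bar>t\<bar> < 1 \<and> 0 < g \<and> g < 1 \<and> 0 \<le> Q t g} \<in> sets (borel \<Otimes>\<^sub>M borel)"
  proof -
    have "{z \<in> space (borel \<Otimes>\<^sub>M borel). \<bar>fst z\<bar> < 1 \<and> 0 < snd z \<and> snd z < 1 \<and> 0 \<le> Q (fst z) (snd z)} \<in> sets (borel \<Otimes>\<^sub>M borel)"
      unfolding Q_def by measurable
    then show ?thesis by (simp add: space_pair_measure case_prod_beta')
  qed
  have "extremal_integral \<nu> q l1 l2 = (\<integral>\<^sup>+t. (\<integral>\<^sup>+w. ?h t w * indicator {-1..1} t \<partial>jacobi_measure (\<nu> - 1)) \<partial>lborel)"
    unfolding extremal_integral_def by (rule J.Fubini'[symmetric]) measurable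
  also have "\<dots> = (\<integral>\<^sup>+t. (\<integral>\<^sup>+g. ?\<Phi> t g \<partial>lborel) \<partial>lborel)"
  proof (intro nn_integral_cong_AE)
    have "AE t::real in lborel. t \<notin> {-1, 1}"
      by (rule AE_I[of _ _ "{-1, 1}"]) (auto simp: emeasure_lborel_countable)
    then show "AE t in lborel. (\<integral>\<^sup>+w. ?h t w * indicator {-1..1} t \<partial>jacobi_measure (\<nu> - 1)) = (\<integral>\<^sup>+g. ?\<Phi> t g \<partial>lborel)"
    proof eventually_elim
      case (elim t)
      show ?case
      proof (cases "\<bar>t\<bar> < 1")
        case True
        have D: "1 + q\<^sup>2 - 2 * q * t > 0" using True q by (intro one_plus_sq_pos) auto
        have "(\<integral>\<^sup>+w. ?h t w * indicator {-1..1} t \<partial>jacobi_measure (\<nu> - 1))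
            = (\<integral>\<^sup>+g. ennreal (polar_integrand t g) * indicator {0..(1 - t\<^sup>2) / (1 + q\<^sup>2 - 2 * q * t)} g \<partial>lborel)"
          using jacobi_to_polar_integrand[OF True] True by (simp add: abs_less_iff)
        also have "\<dots> = (\<integral>\<^sup>+g. ?\<Phi> t g \<partial>lborel)"
        proof (intro nn_integral_cong_AE)
          have "AE g::real in lborel. g \<notin> {0, 1}"
            by (rule AE_I[of _ _ "{0, 1}"]) (auto simp: emeasure_lborel_countable)
          then show "AE g in lborel. ennreal (polar_integrand t g) * indicator {0..(1 - t\<^sup>2) / (1 + q\<^sup>2 - 2 * q * t)} g = ?\<Phi> t g"
          proof eventually_elim
            case (elim g)
            have le: "g \<le> (1 - t\<^sup>2) / (1 + q\<^sup>2 - 2 * q * t) \<longleftrightarrow> 0 \<le> Q t g"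
              using D by (simp add: Q_def pos_le_divide_eq)
            \<comment> \<open>The level \<open>g\<close> never exceeds 1, as denominator minus
              numerator is (t - q)^2.\<close>
            have "(1 - t\<^sup>2) / (1 + q\<^sup>2 - 2 * q * t) \<le> 1"
            proof -
              have "(1 + q\<^sup>2 - 2 * q * t) - (1 - t\<^sup>2) = (t - q)\<^sup>2" by (simp add: power2_diff algebra_simps)
              then have "1 - t\<^sup>2 \<le> 1 + q\<^sup>2 - 2 * q * t" using zero_le_power2[of "t - q"] by linarith
              then show ?thesis using D by simp
            qed
            then have "g \<in> {0..(1 - t\<^sup>2) / (1 + q\<^sup>2 - 2 * q * t)} \<longleftrightarrow> 0 < g \<and> g < 1 \<and> 0 \<le> Q t g"
              using elim le by auto
            then show ?case using True by (simp add: indicator_def)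
          qed
        qed
        finally show ?thesis .
      next
        case False
        then show ?thesis using elim by (auto simp: indicator_def abs_less_iff)
      qed
    qed
  qed
  also have "\<dots> = (\<integral>\<^sup>+g. (\<integral>\<^sup>+t. ?\<Phi> t g \<partial>lborel) \<partial>lborel)"
  proof (rule lborel_pair.Fubini'[symmetric])
    have "(\<lambda>z. ennreal ((\<lambda>(t, g). polar_integrand t g) z) * indicator {(t, g). \<bar>t\<bar> < 1 \<and> 0 < g \<and> g < 1 \<and> 0 \<le> Q t g} z)
        \<in> borel_measurable (borel \<Otimes>\<^sub>M borel)"
      by (rule borel_measurable_times_ennreal[OF measurable_compose[OF pm measurable_ennreal] borel_measurable_indicator[OF sm]])
    then show "(\<lambda>(t, g). ?\<Phi> t g) \<in> borel_measurable (lborel \<Otimes>\<^sub>M lborel)"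
      by (simp add: case_prod_beta' measurable_cong_sets[OF sets_pair_measure_cong[OF sets_lborel sets_lborel] refl])
  qed
  also have "\<dots> = (\<integral>\<^sup>+g. ennreal (g powr (\<nu> - 1) / 2
     * circle_abs_mean ((g - \<nu> / (\<nu> + 1)) * q * l1) (sqrt ((1 - g) * (1 - g * q\<^sup>2)))) * indicator {0<..<1} g \<partial>lborel)"
  proof (rule nn_integral_cong)
    fix g :: real
    show "(\<integral>\<^sup>+t. ?\<Phi> t g \<partial>lborel) = ennreal (g powr (\<nu> - 1) / 2
     * circle_abs_mean ((g - \<nu> / (\<nu> + 1)) * q * l1) (sqrt ((1 - g) * (1 - g * q\<^sup>2)))) * indicator {0<..<1} g"
    proof (cases "0 < g \<and> g < 1")
      case True
      have "(\<integral>\<^sup>+t. ?\<Phi> t g \<partial>lborel) = (\<integral>\<^sup>+t. ennreal (polar_integrand t g) * indicator {t. 0 \<le> 1 - t\<^sup>2 - g * (1 + q\<^sup>2 - 2 * q * t)} t \<partial>lborel)"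
      proof (rule nn_integral_cong)
        fix t :: real
        \<comment> \<open>The level circle lies inside the unit disc: |t - g q| is at most its
          radius, which is below 1 - g q because q < 1. Hence fixing \<open>g\<close> leaves only
          the condition \<open>0 \<le> Q t g\<close>.\<close>
        have "\<bar>t\<bar> < 1" if "0 \<le> Q t g"
        proof (rule ccontr)
          have "Q t g = (1 - g) * (1 - g * q\<^sup>2) - (t - g * q)\<^sup>2" unfolding Q_def by algebra
          then have "(t - g * q)\<^sup>2 \<le> (1 - g) * (1 - g * q\<^sup>2)" using that by simp
          also have "\<dots> < (1 - g * q)\<^sup>2"
          proof -
            have "(1 - g * q)\<^sup>2 - (1 - g) * (1 - g * q\<^sup>2) = g * (1 - q)\<^sup>2" by algebra
            moreover have "g * (1 - q)\<^sup>2 > 0" using True q by simp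
            ultimately show ?thesis by linarith
          qed
          finally have "\<bar>t - g * q\<bar>\<^sup>2 < (1 - g * q)\<^sup>2" by simp
          moreover have "0 \<le> 1 - g * q" using True q by (simp add: mult_le_one)
          ultimately have "\<bar>t - g * q\<bar> < 1 - g * q" by (rule power2_less_imp_less)
          moreover have "0 \<le> g * q" using True q by simp
          moreover assume "\<not> \<bar>t\<bar> < 1"
          ultimately show False by (simp add: abs_if split: if_splits)
        qed
        then show "?\<Phi> t g = ennreal (polar_integrand t g) * indicator {t. 0 \<le> 1 - t\<^sup>2 - g * (1 + q\<^sup>2 - 2 * q * t)} t"
          using True by (auto simp: indicator_def Q_def)
      qed
      then show ?thesis using polar_integrand_to_circle[OF _ _ l, of g] True by simp
    qed (auto simp: indicator_def)
  qed
  finally show ?thesis .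
qed

end

text \<open>For a fixed level \<open>g\<close> only the constant term \<open>b\<close> of \<open>b + R cos \<theta>\<close> depends on the direction, and the mean of
  its modulus grows with \<open>\<bar>b\<bar>\<close>; hence the radial direction is extremal.\<close>

lemma extremal_integral_le:
  assumes "\<nu> > 0" "0 \<le> q" "q < 1" and l: "l1\<^sup>2 + l2\<^sup>2 = 1"
  shows "extremal_integral \<nu> q l1 l2 \<le> extremal_integral \<nu> q 1 0"
proof -
  have "\<bar>l1\<bar> \<le> 1" using l by (metis abs_square_le_1 le_add_same_cancel1 zero_le_power2)
  then have "\<bar>c * l1\<bar> \<le> \<bar>c * 1\<bar>" for c by (simp add: abs_mult mult_left_le)
  then have "circle_abs_mean (c * l1) R \<le> circle_abs_mean (c * 1) R" for c R
    by (rule circle_abs_mean_mono)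
  moreover have "(1::real)\<^sup>2 + 0\<^sup>2 = 1" by simp
  ultimately show ?thesis
    unfolding extremal_integral_polar[OF assms(1-3) l] extremal_integral_polar[OF assms(1-3), of 1 0, OF \<open>1\<^sup>2 + 0\<^sup>2 = 1\<close>]
    by (intro nn_integral_mono mult_right_mono ennreal_leI mult_left_mono) auto
qed

section \<open>Evaluation of the constant\<close>

text \<open>With second component 0 the inner integral is the same for every \<open>w\<close>, so
  the outer one contributes the total mass of its weight.\<close>

lemma extremal_integral_radial:
  assumes nu: "\<nu> > 0" and q: "0 \<le> q" "q < 1"
  shows "extremal_integral \<nu> q 1 0 = ennreal (jacobi_moment (\<nu> - 1) 0 *
     integral {-1..1} (\<lambda>t. (1 - t\<^sup>2) powr (\<nu> - 1/2) * (\<bar>t - \<nu> / (\<nu> + 1) * q\<bar> / (1 + q\<^sup>2 - 2 * q * t) powr \<nu>)))"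
    and "0 \<le> integral {-1..1} (\<lambda>t. (1 - t\<^sup>2) powr (\<nu> - 1/2) * (\<bar>t - \<nu> / (\<nu> + 1) * q\<bar> / (1 + q\<^sup>2 - 2 * q * t) powr \<nu>))"
proof -
  let ?f = "\<lambda>t. \<bar>t - \<nu> / (\<nu> + 1) * q\<bar> / (1 + q\<^sup>2 - 2 * q * t) powr \<nu>"
  let ?w = "\<lambda>t::real. (1 - t\<^sup>2) powr (\<nu> - 1/2)"
  have "1 + q\<^sup>2 - 2 * q * t > 0" if "t \<in> {-1..1}" for t
    using that q by (intro one_plus_sq_pos) auto
  then have "1 + q\<^sup>2 - 2 * q * t \<noteq> 0" if "t \<in> {-1..1}" for t using that by fastforce
  then have "continuous_on {-1..1} ?f" by (intro continuous_intros) auto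
  then have "bounded (?f ` {-1..1})" by (intro compact_imp_bounded compact_continuous_image) auto
  then obtain B where B: "\<And>t. t \<in> {-1..1} \<Longrightarrow> \<bar>?f t\<bar> \<le> B" unfolding bounded_iff by fastforce
  have fm: "?f \<in> borel_measurable borel" by measurable
  have "integrable (jacobi_measure (\<nu> - 1/2)) ?f"
    by (rule integrable_jacobi_measure[OF _ fm, of _ B]) (use B nu in \<open>auto simp: abs_less_iff\<close>)
  then have int: "integrable lborel (\<lambda>t. indicator {-1..1} t * ?w t * ?f t)"
    by (simp only: integral_jacobi_measure(2)[OF fm])
  have eq: "(\<lambda>t. indicator {-1..1} t * ?w t * ?f t) = (\<lambda>t. if t \<in> {-1..1} then ?w t * ?f t else 0)"
    by (auto simp: fun_eq_iff)
  have I: "(\<integral>t. indicator {-1..1} t * ?w t * ?f t \<partial>lborel) = integral {-1..1} (\<lambda>t. ?w t * ?f t)"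
    using has_integral_integral_lborel[OF int] unfolding eq has_integral_restrict_UNIV
    by (rule integral_unique[symmetric])
  have inner: "(\<integral>\<^sup>+t. ennreal (?w t / (1 + q\<^sup>2 - 2 * q * t) powr \<nu> * \<bar>(t - \<nu> / (\<nu> + 1) * q) * 1 + sqrt (1 - t\<^sup>2) * w * 0\<bar>)
      * indicator {-1..1} t \<partial>lborel) = ennreal (integral {-1..1} (\<lambda>t. ?w t * ?f t))" for w
  proof -
    have "(\<integral>\<^sup>+t. ennreal (?w t / (1 + q\<^sup>2 - 2 * q * t) powr \<nu> * \<bar>(t - \<nu> / (\<nu> + 1) * q) * 1 + sqrt (1 - t\<^sup>2) * w * 0\<bar>)
        * indicator {-1..1} t \<partial>lborel) = (\<integral>\<^sup>+t. ennreal (indicator {-1..1} t * ?w t * ?f t) \<partial>lborel)"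
      by (rule nn_integral_cong) (auto simp: indicator_def)
    also have "\<dots> = ennreal (\<integral>t. indicator {-1..1} t * ?w t * ?f t \<partial>lborel)"
      by (rule nn_integral_eq_integral[OF int]) simp
    finally show ?thesis by (simp only: I)
  qed
  show nonneg: "0 \<le> integral {-1..1} (\<lambda>t. ?w t * ?f t)"
    unfolding I[symmetric] by (rule integral_nonneg_AE) simp
  have "emeasure (jacobi_measure (\<nu> - 1)) UNIV = ennreal (jacobi_moment (\<nu> - 1) 0)"
    using nu by (simp add: emeasure_jacobi_measure jacobi_moment_0)
  then show "extremal_integral \<nu> q 1 0 = ennreal (jacobi_moment (\<nu> - 1) 0 * integral {-1..1} (\<lambda>t. ?w t * ?f t))"
    unfolding extremal_integral_def inner
    using nonneg nu jacobi_moment_0_pos[of "\<nu> - 1"] by (simp add: ennreal_mult mult.commute)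
qed

text \<open>\<open>planar_mass\<close> has the factor B(1/2, \<nu> + 1/2) = Gamma(1/2) Gamma(\<nu> +
  1/2) / Gamma(\<nu> + 1), while \<open>c_const\<close> is 2 (\<nu> + 1) Gamma(\<nu> + 1) /
  (Gamma(1/2) Gamma(\<nu> + 1/2)). Their product is n = 2 \<nu> + 2.\<close>

lemma radial_constant:
  fixes n :: nat
  assumes n: "n \<ge> 3" and nu: "\<nu> = (real n - 2) / 2"
  shows "(2 * \<nu> + 2) / (1 - q\<^sup>2) * (jacobi_moment (\<nu> - 1) 0 *
     integral {-1..1} (\<lambda>t. (1 - t\<^sup>2) powr (\<nu> - 1/2) * (\<bar>t - \<nu> / (\<nu> + 1) * q\<bar> / (1 + q\<^sup>2 - 2 * q * t) powr \<nu>)))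
     = planar_mass \<nu> * K_const n q"
proof -
  have pos: "\<nu> > 0" using n nu by simp
  let ?I = "integral {-1..1} (\<lambda>t. (1 - t\<^sup>2) powr (\<nu> - 1/2) * (\<bar>t - \<nu> / (\<nu> + 1) * q\<bar> / (1 + q\<^sup>2 - 2 * q * t) powr \<nu>))"
  have e: "(real n - 2) / real n = \<nu> / (\<nu> + 1)" "(real n - 3) / 2 = \<nu> - 1/2" "(real n - 2) / 2 = \<nu>"
    using n by (simp_all add: nu field_simps)
  have I: "integral {-1..1} (\<lambda>t. \<bar>t - (real n - 2) / real n * q\<bar> * (1 - t\<^sup>2) powr ((real n - 3) / 2)
        / (1 - 2 * t * q + q\<^sup>2) powr ((real n - 2) / 2)) = ?I"
    unfolding e by (rule arg_cong[where f="integral {-1..1}"]) (auto simp: fun_eq_iff algebra_simps)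
  have c: "planar_mass \<nu> * c_const n = (2 * \<nu> + 2) * jacobi_moment (\<nu> - 1) 0"
  proof -
    obtain a b g where abg: "a = Gamma (1/2 :: real)" "b = Gamma (\<nu> + 1/2)" "g = Gamma (\<nu> + 1)" by blast
    have pos': "a > 0" "b > 0" "g > 0" unfolding abg using pos by (auto intro: Gamma_real_pos)
    have J: "jacobi_moment (\<nu> - 1/2) 0 = a * b / g"
      using pos by (simp add: jacobi_moment_0 Beta_def abg add.commute)
    have c: "c_const n = 2 * ((\<nu> + 1) * g) / (a * b)"
    proof -
      have "(real n + 2) / 2 = \<nu> + 1 + 1" "(real n - 1) / 2 = \<nu> + 1/2" by (simp_all add: nu field_simps)
      moreover have "Gamma (\<nu> + 1 + 1) = (\<nu> + 1) * g"
        unfolding abg using pos by (intro Gamma_plus1) (auto elim!: nonpos_Ints_cases)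
      ultimately show ?thesis by (simp only: c_const_def abg)
    qed
    show ?thesis unfolding planar_mass_def J c using pos' by (simp add: field_simps)
  qed
  have "planar_mass \<nu> * K_const n q = (planar_mass \<nu> * c_const n) / (1 - q\<^sup>2) * ?I"
    by (simp only: K_const_def I) simp
  then show ?thesis unfolding c by simp
qed

lemma integral_poisson_grad_frame:
  fixes e f :: "'a::euclidean_space"
  assumes dim: "DIM('a) \<ge> 3" and ef: "e \<bullet> e = 1" "f \<bullet> f = 1" "e \<bullet> f = 0" and q: "0 \<le> q" "q < 1" and l: "l1\<^sup>2 + l2\<^sup>2 = 1"
  shows "(\<integral>z. \<bar>poisson_grad (- q *\<^sub>R e) z \<bullet> (l1 *\<^sub>R e + l2 *\<^sub>R f)\<bar> \<partial>sphere_measure) \<le> K_const DIM('a) q"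
    and "(\<integral>z. \<bar>poisson_grad (- q *\<^sub>R e) z \<bullet> e\<bar> \<partial>sphere_measure) = K_const DIM('a) q"
proof -
  define \<nu> where "\<nu> = (real DIM('a) - 2) / 2"
  have nu: "\<nu> > 0" and dim': "real DIM('a) = 2 * \<nu> + 2" using dim by (simp_all add: \<nu>_def field_simps)
  note mass = planar_mass_pos[OF nu]
  define N where "N l1 l2 = (\<integral>z. \<bar>poisson_grad (- q *\<^sub>R e) z \<bullet> (l1 *\<^sub>R e + l2 *\<^sub>R f)\<bar> \<partial>sphere_measure)" for l1 l2
  have N0: "N l1 l2 \<ge> 0" for l1 l2 unfolding N_def by (rule integral_nonneg_AE) simp
  have P: "1 - q\<^sup>2 > 0" using q by (simp add: abs_square_less_1)
  have N: "ennreal (planar_mass \<nu> * N l1 l2) = ennreal ((2 * \<nu> + 2) / (1 - q\<^sup>2)) * extremal_integral \<nu> q l1 l2" for l1 l2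
    unfolding N_def by (rule integral_poisson_grad_eq_extremal[OF ef nu dim' q])
  have "ennreal (planar_mass \<nu> * N 1 0) = ennreal (planar_mass \<nu> * K_const DIM('a) q)"
    unfolding N extremal_integral_radial(1)[OF nu q] radial_constant[OF dim \<nu>_def, symmetric]
    using nu P extremal_integral_radial(2)[OF nu q] jacobi_moment_0_pos[of "\<nu> - 1"]
    by (intro ennreal_mult[symmetric]) auto
  moreover have K: "0 \<le> planar_mass \<nu> * K_const DIM('a) q"
    unfolding radial_constant[OF dim \<nu>_def, symmetric]
    using nu P extremal_integral_radial(2)[OF nu q] jacobi_moment_0_pos[of "\<nu> - 1"]
    by (intro mult_nonneg_nonneg) auto
  ultimately have eq: "N 1 0 = K_const DIM('a) q" using mass N0[of 1 0] by (simp add: ennreal_inj)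
  then show "(\<integral>z. \<bar>poisson_grad (- q *\<^sub>R e) z \<bullet> e\<bar> \<partial>sphere_measure) = K_const DIM('a) q"
    by (simp add: N_def)
  have "ennreal (planar_mass \<nu> * N l1 l2) \<le> ennreal (planar_mass \<nu> * N 1 0)"
    unfolding N by (intro mult_left_mono extremal_integral_le nu q l) simp
  then have "N l1 l2 \<le> N 1 0" using mass N0[of 1 0] by (simp add: ennreal_le_iff)
  then show "(\<integral>z. \<bar>poisson_grad (- q *\<^sub>R e) z \<bullet> (l1 *\<^sub>R e + l2 *\<^sub>R f)\<bar> \<partial>sphere_measure) \<le> K_const DIM('a) q"
    unfolding eq unfolding N_def .
qed

section \<open>Bound in every direction, and sharpness\<close>

lemma exists_unit_orthogonal:
  fixes e :: "'a::euclidean_space"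
  assumes "DIM('a) \<ge> 2"
  obtains f where "f \<bullet> f = 1" "e \<bullet> f = 0"
proof -
  obtain y where y: "y \<noteq> 0" "orthogonal e y" using orthogonal_to_vector_exists[OF assms] by blast
  show thesis
    by (rule that[of "sgn y"]) (use y in \<open>auto simp: orthogonal_def sgn_div_norm power2_norm_eq_inner[symmetric] power2_eq_square\<close>)
qed

text \<open>At the origin every unit vector is an axis, and \<open>l\<close> supplies one; elsewhere
  the axis points away from \<open>x\<close>.\<close>

lemma exists_axis:
  fixes x l :: "'a::euclidean_space"
  assumes "norm l = 1"
  obtains e where "e \<bullet> e = 1" "x = - norm x *\<^sub>R e"
proof (cases "x = 0")
  case True
  then show thesis using that[of l] assms by (simp add: norm_eq_1)
next
  case False
  then show thesis
    by (intro that[of "- sgn x"]) (auto simp: sgn_div_norm power2_norm_eq_inner[symmetric] power2_eq_square)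
qed

lemma integral_poisson_grad_le:
  fixes x l :: "'a::euclidean_space"
  assumes dim: "DIM('a) \<ge> 3" and x: "norm x < 1" and l: "norm l = 1"
  shows "(\<integral>z. \<bar>poisson_grad x z \<bullet> l\<bar> \<partial>sphere_measure) \<le> K_const DIM('a) (norm x)"
proof -
  obtain e where e: "e \<bullet> e = 1" "x = - norm x *\<^sub>R e" using exists_axis[OF l] by blast
  define v where "v = l - (l \<bullet> e) *\<^sub>R e"
  have ev: "e \<bullet> v = 0" using e by (simp add: v_def inner_diff_right inner_commute)
  \<comment> \<open>The unit vector along the part of \<open>l\<close> orthogonal to
    \<open>e\<close>; if \<open>l\<close> is parallel to \<open>e\<close>, any unit vector
    orthogonal to \<open>e\<close> completes the frame.\<close>
  obtain f where f: "f \<bullet> f = 1" "e \<bullet> f = 0" "v = norm v *\<^sub>R f"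
  proof (cases "v = 0")
    case True
    obtain f where "f \<bullet> f = 1" "e \<bullet> f = 0" using exists_unit_orthogonal[of e] dim by auto
    with True show thesis by (intro that[of f]) auto
  next
    case False
    then show thesis
      by (intro that[of "sgn v"]) (use ev in \<open>auto simp: sgn_div_norm power2_norm_eq_inner[symmetric] power2_eq_square\<close>)
  qed
  have lv: "l = (l \<bullet> e) *\<^sub>R e + norm v *\<^sub>R f" using f(3) by (simp add: v_def)
  have "l \<bullet> l = (l \<bullet> e)\<^sup>2 + (norm v)\<^sup>2"
    by (subst (1 2) lv) (use e(1) f(1,2) in \<open>simp add: inner_add_left inner_add_right inner_commute[of f e] power2_eq_square\<close>)
  then have "(l \<bullet> e)\<^sup>2 + (norm v)\<^sup>2 = 1" using l by (simp add: norm_eq_1)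
  from integral_poisson_grad_frame(1)[OF dim e(1) f(1,2) norm_ge_zero x this] show ?thesis
    unfolding e(2)[symmetric] lv[symmetric] .
qed

text \<open>The boundary data are the sign of the kernel's derivative along the axis, so
  differentiating under the integral yields the integral of its modulus. The bound 1 holds because
  the kernel is nonnegative with integral 1.\<close>

lemma extremal_harmonic_function:
  fixes x :: "'a::euclidean_space"
  assumes dim: "DIM('a) \<ge> 3" and x: "norm x < 1"
  obtains u where "harmonic_on (ball 0 1) u" "\<And>y. norm y < 1 \<Longrightarrow> \<bar>u y\<bar> \<le> 1" "K_const DIM('a) (norm x) \<le> norm (grad u x)"
proof -
  obtain b :: 'a where "norm b = 1" using norm_to_sphere by blast
  then obtain e where e: "e \<bullet> e = 1" "x = - norm x *\<^sub>R e" using exists_axis by blast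
  obtain f where f: "f \<bullet> f = 1" "e \<bullet> f = 0" using exists_unit_orthogonal[of e] dim by auto
  define g where "g z = sgn (poisson_grad x z \<bullet> e)" for z
  have gm: "g \<in> borel_measurable borel" unfolding g_def[abs_def] by measurable
  have gb: "\<bar>g z\<bar> \<le> 1" for z by (simp add: g_def sgn_real_def)
  show thesis
  proof (rule that[of "poisson_integral g"])
    show "harmonic_on (ball 0 1) (poisson_integral g)" by (rule harmonic_on_poisson_integral[OF gm gb])
    show "\<bar>poisson_integral g y\<bar> \<le> 1" if y: "norm y < 1" for y
    proof -
      have int: "integrable sphere_measure (poisson_kernel y)"
        using integrable_poisson_kernel[of "\<lambda>_. 1" 1 y] y by simp
      have "\<bar>poisson_integral g y\<bar> \<le> (\<integral>z. \<bar>g z * poisson_kernel y z\<bar> \<partial>sphere_measure)"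
        unfolding poisson_integral_def by (rule integral_abs_bound)
      also have "\<dots> \<le> (\<integral>z. poisson_kernel y z \<partial>sphere_measure)"
      proof (rule integral_mono)
        show "integrable sphere_measure (\<lambda>z. \<bar>g z * poisson_kernel y z\<bar>)"
          using integrable_poisson_kernel[OF gm gb y] by simp
        show "\<bar>g z * poisson_kernel y z\<bar> \<le> poisson_kernel y z" for z
          using gb[of z] poisson_kernel_nonneg[of y z] y by (simp add: abs_mult mult_left_le_one_le)
      qed (rule int)
      finally show ?thesis by (simp add: integral_poisson_kernel[OF y])
    qed
    have "K_const DIM('a) (norm x) = (\<integral>z. \<bar>poisson_grad x z \<bullet> e\<bar> \<partial>sphere_measure)"
      using integral_poisson_grad_frame(2)[OF dim e(1) f norm_ge_zero x, of 1 0] unfolding e(2)[symmetric] by simp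
    also have "\<dots> = (\<integral>z. g z * (poisson_grad x z \<bullet> e) \<partial>sphere_measure)"
      by (rule Bochner_Integration.integral_cong) (auto simp: g_def sgn_real_def)
    also have "\<dots> = grad (poisson_integral g) x \<bullet> e"
      by (rule grad_inner[OF has_derivative_poisson_integral[OF gm gb x], symmetric])
    also have "\<dots> \<le> norm (grad (poisson_integral g) x) * norm e"
      by (rule norm_cauchy_schwarz)
    finally show "K_const DIM('a) (norm x) \<le> norm (grad (poisson_integral g) x)"
      using e(1) by (simp add: norm_eq_1[symmetric])
  qed
qed

lemma harmonic_on_const: "harmonic_on (ball 0 1) (\<lambda>_::'a::euclidean_space. c)"
  and grad_const: "grad (\<lambda>_. c) (y::'a::euclidean_space) = 0"
proof -
  have 0: "partial_deriv (\<lambda>_::'a. c) i = (\<lambda>_. 0)" for i c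
    by (rule ext) (rule partial_deriv_eqI[OF has_derivative_const])
  show "harmonic_on (ball 0 1) (\<lambda>_::'a::euclidean_space. c)" by (simp add: harmonic_on_def 0)
  show "grad (\<lambda>_. c) y = 0" by (simp add: grad_def 0)
qed

lemma abs_le_sup_norm_ball:
  assumes "bounded (u ` ball 0 1)" "norm y < 1"
  shows "\<bar>u y\<bar> \<le> sup_norm_ball u"
proof -
  obtain B where "\<And>y. norm y < 1 \<Longrightarrow> \<bar>u y\<bar> \<le> B" using assms(1) unfolding bounded_iff by fastforce
  then have "bdd_above ((\<lambda>y. \<bar>u y\<bar>) ` ball 0 1)" by (intro bdd_aboveI[of _ B]) auto
  then show ?thesis unfolding sup_norm_ball_def using assms(2) by (intro cSUP_upper) auto
qed

theorem theorem1p3: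
  fixes x :: "real ^ 'n"
  assumes "CARD('n) \<ge> 3" and "x \<in> ball 0 1"
  shows "(\<forall>u :: real ^ 'n \<Rightarrow> real. harmonic_on (ball 0 1) u \<and> bounded (u ` ball 0 1) \<longrightarrow>
            norm (grad u x) \<le> K_const CARD('n) (norm x) * sup_norm_ball u)
       \<and> (\<forall>C. (\<forall>u :: real ^ 'n \<Rightarrow> real. harmonic_on (ball 0 1) u \<and> bounded (u ` ball 0 1) \<longrightarrow>
                 norm (grad u x) \<le> C * sup_norm_ball u)
              \<longrightarrow> K_const CARD('n) (norm x) \<le> C)"
proof (intro conjI allI impI)
  have dim: "DIM(real ^ 'n) \<ge> 3" and x: "norm x < 1" using assms by simp_all
  have D: "DIM(real ^ 'n) = CARD('n)" by simp
  fix u :: "real ^ 'n \<Rightarrow> real"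
  assume u: "harmonic_on (ball 0 1) u \<and> bounded (u ` ball 0 1)"
  define M where "M = sup_norm_ball u"
  have M: "\<bar>u y\<bar> \<le> M" if "norm y < 1" for y
    unfolding M_def using u that by (intro abs_le_sup_norm_ball) auto
  have M0: "0 \<le> M" using M[of 0] by simp
  \<comment> \<open>The default for a vanishing gradient keeps \<open>l\<close> a unit vector in all
    cases.\<close>
  define l where "l = (if grad u x = 0 then axis undefined 1 else sgn (grad u x))"
  have l: "norm l = 1" by (simp add: l_def norm_sgn)
  have "norm (grad u x) = grad u x \<bullet> l"
    by (auto simp: l_def sgn_div_norm power2_norm_eq_inner[symmetric] power2_eq_square)
  also have "\<dots> \<le> M * (\<integral>z. \<bar>poisson_grad x z \<bullet> l\<bar> \<partial>sphere_measure)"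
    using u M x by (intro grad_le_integral_poisson_grad) auto
  also have "\<dots> \<le> M * K_const CARD('n) (norm x)"
    using integral_poisson_grad_le[OF dim x l] M0 unfolding D by (rule mult_left_mono)
  finally show "norm (grad u x) \<le> K_const CARD('n) (norm x) * sup_norm_ball u"
    by (simp add: M_def mult.commute)
next
  have dim: "DIM(real ^ 'n) \<ge> 3" and x: "norm x < 1" using assms by simp_all
  fix C :: real
  assume C: "\<forall>u :: real ^ 'n \<Rightarrow> real. harmonic_on (ball 0 1) u \<and> bounded (u ` ball 0 1) \<longrightarrow>
                 norm (grad u x) \<le> C * sup_norm_ball u"
  \<comment> \<open>Testing \<open>C\<close> on the constant 1 gives \<open>0 \<le> C\<close>; this
    is what turns the bound 1 on the extremal function into
    \<open>C * sup_norm_ball u \<le> C\<close>.\<close>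
  have "sup_norm_ball (\<lambda>_::real ^ 'n. 1) = 1" by (simp add: sup_norm_ball_def)
  then have C0: "0 \<le> C"
    using C[rule_format, of "\<lambda>_. 1"] harmonic_on_const[of 1] by (auto simp: grad_const image_constant_conv)
  obtain u :: "real ^ 'n \<Rightarrow> real" where u: "harmonic_on (ball 0 1) u" "\<And>y. norm y < 1 \<Longrightarrow> \<bar>u y\<bar> \<le> 1"
    and K: "K_const DIM(real ^ 'n) (norm x) \<le> norm (grad u x)"
    using extremal_harmonic_function[OF dim x] by metis
  have "bounded (u ` ball 0 1)" unfolding bounded_iff using u(2) by (intro exI[of _ 1]) auto
  with C u(1) have "norm (grad u x) \<le> C * sup_norm_ball u" by blast
  also have "\<dots> \<le> C * 1"
    unfolding sup_norm_ball_def using C0 u(2) by (intro mult_left_mono cSUP_least) auto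
  finally show "K_const CARD('n) (norm x) \<le> C" using K by simp
qed

end
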